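(* Let $\gamma_0:\mathbb{S}^1\to\mathbb{H}^2$ be a smooth immersed closed curve with Euclidean total curvature $T[\gamma_0]=0$, and let $(\gamma_t)_{t\ge0}$ be its evolution by the (unpenalized) elastic flow. Then $(\mathcal{L}(\gamma_t))_{t\ge0}$ is unbounded. In particular, $(\gamma_t)_{t\ge0}$ is a nonconvergent evolution.
   Context: $\mathbb{H}^2=\mathbb{R}\times(0,\infty)$ is the hyperbolic half plane with metric $g_{(x,y)}=\frac{1}{y^2}(dx^2+dy^2)$ and Levi-Civita connection $\nabla$. For an immersed curve $\gamma=(\gamma_1,\gamma_2)$ in $\mathbb{H}^2$, $ds=\frac{\sqrt{\gamma_1'^2+\gamma_2'^2}}{\gamma_2}\,dt$ is the hyperbolic arclength element, $\mathcal{L}(\gamma)=\int_\gamma ds$ is the hyperbolic length, $T$ is the (hyperbolic) unit tangent field, $N=iT$ is the unit normal obtained by rotating $T$ by $+\pi/2$ (in $\mathbb{H}^2\subset\mathbb{C}$), the scalar curvature $\kappa$ is defined by $\nabla_TT=\kappa N$, and the elastic energy is $\mathcal{E}(\gamma)=\int_\gamma\kappa^2\,ds$. The Euclidean total curvature of a closed immersed curve $\gamma$ in $\mathbb{H}^2\subset\mathbb{R}^2$ is $T[\gamma]=\frac1{2\pi}\int_\gamma\kappa_{\mathbb{R}^2}\,ds_{\mathbb{R}^2}$, where $\kappa_{\mathbb{R}^2}$ is the signed Euclidean curvature and $ds_{\mathbb{R}^2}$ Euclidean arclength. The (unpenalized) elastic flow is the $L^2(ds)$-gradient flow of $\mathcal{E}$: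 $\partial_t f=-\nabla_{L^2}\mathcal{E}(f)$ on $\mathbb{S}^1\times(0,\infty)$, $f(\cdot,0)=f_0$, where $\nabla_{L^2}\mathcal{E}(f)=(2\partial_s^2\kappa+\kappa^3-2\kappa)N$. It is known that for every smooth immersion $f_0:\mathbb{S}^1\to\mathbb{H}^2$ there is a unique smooth global solution $f:\mathbb{S}^1\times[0,\infty)\to\mathbb{H}^2$, and that if $\mathcal{L}(f(\cdot,t))$ is bounded in $t$, then for any $t_n\to\infty$ suitable isometric images $a_n(\tilde f(\cdot,t_n)-(p_n,0)^T)$ ($a_n>0$, $p_n\in\mathbb{R}$) of the constant hyperbolic speed reparametrizations $\tilde f(\cdot,t_n)$ converge, along a subsequence, in $W^{m,2}$ for all $m\in\mathbb{N}$ to a closed free elastica (a closed curve with $2\kappa''+\kappa^3-2\kappa=0$ in hyperbolic arclength). Convergence of an evolution means convergence of $a(t)(\tilde f(\cdot,t)-(p(t),0)^T)$, for some smooth $p:[0,\infty)\to\mathbb{R}$, $a:[0,\infty)\to(0,\infty)$, in $W^{m,2}$ for all $m$ to an immersed closed curve in $\mathbb{H}^2$. *)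

theory Defs
  imports "HOL-Analysis.Analysis"
begin

text \<open>
  The half plane is the set of complex numbers with positive imaginary part, and a closed
  curve, that is, a map on the circle \<open>\<real>/\<int>\<close>, is a function on \<^typ>\<open>real\<close> of period 1.
  Tangent vectors are complex numbers.
\<close>

section \<open>Smooth functions\<close>

text \<open>
  Derivatives are taken within \<open>S\<close>, hence one-sided on the boundary. The definition is meant
  for convex sets \<open>S\<close> with nonempty interior, where derivatives within \<open>S\<close> are unique;
  below, \<open>S\<close> is \<open>\<real>\<close>, \<open>[0,\<infinity>)\<close> or \<open>[0,\<infinity>) \<times> \<real>\<close>.
\<close>

primrec Ck_on :: "nat \<Rightarrow> 'a::euclidean_space set \<Rightarrow> ('a \<Rightarrow> 'b::real_normed_vector) \<Rightarrow> bool" where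
  "Ck_on 0 = (\<lambda>S f. continuous_on S f)"
| "Ck_on (Suc k) = (\<lambda>S f. \<exists>f'. (\<forall>x\<in>S. (f has_derivative f' x) (at x within S)) \<and>
     (\<forall>v. Ck_on k S (\<lambda>x. f' x v)))"

definition smooth_on :: "'a::euclidean_space set \<Rightarrow> ('a \<Rightarrow> 'b::real_normed_vector) \<Rightarrow> bool" where
  "smooth_on S f \<longleftrightarrow> (\<forall>k. Ck_on k S f)"

definition vderiv :: "(real \<Rightarrow> 'a::real_normed_vector) \<Rightarrow> real \<Rightarrow> 'a" where
  "vderiv f x = vector_derivative f (at x)"

section \<open>Curves in the hyperbolic half plane\<close>

definition closed_immersion :: "(real \<Rightarrow> complex) \<Rightarrow> bool" where
  "closed_immersion \<gamma> \<longleftrightarrow> smooth_on UNIV \<gamma> \<and>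
     (\<forall>x. \<gamma> (x + 1) = \<gamma> x \<and> Im (\<gamma> x) > 0 \<and> vderiv \<gamma> x \<noteq> 0)"

definition hyp_metric :: "complex \<Rightarrow> complex \<Rightarrow> complex \<Rightarrow> real" where
  "hyp_metric z v w = (v \<bullet> w) / (Im z)\<^sup>2"

definition hyp_speed :: "(real \<Rightarrow> complex) \<Rightarrow> real \<Rightarrow> real" where
  "hyp_speed \<gamma> x = sqrt (hyp_metric (\<gamma> x) (vderiv \<gamma> x) (vderiv \<gamma> x))"

definition hyp_length :: "(real \<Rightarrow> complex) \<Rightarrow> real" where
  "hyp_length \<gamma> = integral {0..1} (hyp_speed \<gamma>)"

definition arc_deriv :: "(real \<Rightarrow> complex) \<Rightarrow> (real \<Rightarrow> 'a::real_normed_vector) \<Rightarrow> real \<Rightarrow> 'a" where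
  "arc_deriv \<gamma> h x = vderiv h x /\<^sub>R hyp_speed \<gamma> x"

definition hyp_tangent :: "(real \<Rightarrow> complex) \<Rightarrow> real \<Rightarrow> complex" where
  "hyp_tangent \<gamma> = arc_deriv \<gamma> \<gamma>"

definition hyp_normal :: "(real \<Rightarrow> complex) \<Rightarrow> real \<Rightarrow> complex" where
  "hyp_normal \<gamma> x = \<i> * hyp_tangent \<gamma> x"

text \<open>
  The covariant derivative of a field \<open>V\<close> along \<open>\<gamma>\<close> in the parameter direction. The nonzero
  Christoffel symbols at \<open>(x,y)\<close> are \<open>\<Gamma>\<^sup>1\<^sub>1\<^sub>2 = \<Gamma>\<^sup>1\<^sub>2\<^sub>1 = \<Gamma>\<^sup>2\<^sub>2\<^sub>2 = -1/y\<close> and \<open>\<Gamma>\<^sup>2\<^sub>1\<^sub>1 = 1/y\<close>, so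
  \<open>\<Gamma>(v,w)\<close> is the complex number \<open>\<i>vw/y\<close>. It is symmetric in \<open>v\<close> and \<open>w\<close>;
  metric compatibility is proved below.
\<close>

definition cov_deriv :: "(real \<Rightarrow> complex) \<Rightarrow> (real \<Rightarrow> complex) \<Rightarrow> real \<Rightarrow> complex" where
  "cov_deriv \<gamma> V x = vderiv V x + \<i> * vderiv \<gamma> x * V x / of_real (Im (\<gamma> x))"

definition nabla_T_T :: "(real \<Rightarrow> complex) \<Rightarrow> real \<Rightarrow> complex" where
  "nabla_T_T \<gamma> x = cov_deriv \<gamma> (hyp_tangent \<gamma>) x /\<^sub>R hyp_speed \<gamma> x"

definition hyp_curvature :: "(real \<Rightarrow> complex) \<Rightarrow> real \<Rightarrow> real" where
  "hyp_curvature \<gamma> x = (THE k. nabla_T_T \<gamma> x = k *\<^sub>R hyp_normal \<gamma> x)"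

definition euclid_curvature :: "(real \<Rightarrow> complex) \<Rightarrow> real \<Rightarrow> real" where
  "euclid_curvature \<gamma> x =
     (Re (vderiv \<gamma> x) * Im (vderiv (vderiv \<gamma>) x) - Im (vderiv \<gamma> x) * Re (vderiv (vderiv \<gamma>) x))
       / norm (vderiv \<gamma> x) ^ 3"

definition total_curvature :: "(real \<Rightarrow> complex) \<Rightarrow> real" where
  "total_curvature \<gamma> =
     1 / (2 * pi) * integral {0..1} (\<lambda>x. euclid_curvature \<gamma> x * norm (vderiv \<gamma> x))"

section \<open>The elastic flow\<close>

text \<open>The \<open>L\<^sup>2(ds)\<close>-gradient of the elastic energy \<open>\<integral>\<kappa>\<^sup>2 ds\<close>.\<close>

definition elastic_gradient :: "(real \<Rightarrow> complex) \<Rightarrow> real \<Rightarrow> complex" where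
  "elastic_gradient \<gamma> x =
     (2 * arc_deriv \<gamma> (arc_deriv \<gamma> (hyp_curvature \<gamma>)) x
        + hyp_curvature \<gamma> x ^ 3 - 2 * hyp_curvature \<gamma> x) *\<^sub>R hyp_normal \<gamma> x"

text \<open>The first argument of the evolution \<open>\<gamma>\<close> is time; its values at negative times are irrelevant.\<close>

definition elastic_flow :: "(real \<Rightarrow> complex) \<Rightarrow> (real \<Rightarrow> real \<Rightarrow> complex) \<Rightarrow> bool" where
  "elastic_flow \<gamma>\<^sub>0 \<gamma> \<longleftrightarrow>
     smooth_on ({0..} \<times> UNIV) (\<lambda>(t, x). \<gamma> t x) \<and>
     (\<forall>t\<ge>0. closed_immersion (\<gamma> t)) \<and>
     \<gamma> 0 = \<gamma>\<^sub>0 \<and>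
     (\<forall>t>0. \<forall>x. ((\<lambda>s. \<gamma> s x) has_vector_derivative - elastic_gradient (\<gamma> t) x) (at t))"

section \<open>Convergence of evolutions\<close>

text \<open>
  Reparametrization is by the lift \<open>\<phi>\<close> of an orientation preserving diffeomorphism of \<open>\<real>/\<int>\<close>,
  which makes constant hyperbolic speed reparametrizations unique up to a shift of the base point.
\<close>

definition const_speed_reparam :: "(real \<Rightarrow> complex) \<Rightarrow> (real \<Rightarrow> complex) \<Rightarrow> bool" where
  "const_speed_reparam \<gamma> \<beta> \<longleftrightarrow>
     (\<exists>\<phi>::real \<Rightarrow> real. smooth_on UNIV \<phi> \<and> (\<forall>x. vderiv \<phi> x > 0 \<and> \<phi> (x + 1) = \<phi> x + 1) \<and>
        \<beta> = \<gamma> \<circ> \<phi>) \<and>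
     (\<exists>c. \<forall>x. hyp_speed \<beta> x = c)"

definition sobolev_norm :: "nat \<Rightarrow> (real \<Rightarrow> complex) \<Rightarrow> real" where
  "sobolev_norm m f = sqrt (\<Sum>k\<le>m. integral {0..1} (\<lambda>x. (norm ((vderiv ^^ k) f x))\<^sup>2))"

definition convergent_evolution :: "(real \<Rightarrow> real \<Rightarrow> complex) \<Rightarrow> bool" where
  "convergent_evolution \<gamma> \<longleftrightarrow>
     (\<exists>\<beta> p a \<sigma>.
        (\<forall>t\<ge>0. const_speed_reparam (\<gamma> t) (\<beta> t)) \<and>
        smooth_on {0..} p \<and> smooth_on {0..} a \<and> (\<forall>t\<ge>0. a t > 0) \<and>
        closed_immersion \<sigma> \<and>
        (\<forall>m. ((\<lambda>t. sobolev_norm m (\<lambda>x. a t *\<^sub>R (\<beta> t x - of_real (p t)) - \<sigma> x))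
                \<longlongrightarrow> 0) at_top))"

section \<open>Consistency of the definitions\<close>

lemma cov_deriv_metric:
  assumes "\<gamma> differentiable at x" "V differentiable at x" "W differentiable at x" "Im (\<gamma> x) > 0"
  shows "((\<lambda>x. hyp_metric (\<gamma> x) (V x) (W x)) has_real_derivative
           hyp_metric (\<gamma> x) (cov_deriv \<gamma> V x) (W x) + hyp_metric (\<gamma> x) (V x) (cov_deriv \<gamma> W x)) (at x)"
proof -
  note D = assms(1-3)[unfolded vector_derivative_works, folded vderiv_def]
  have re: "((\<lambda>x. Re (F x)) has_real_derivative Re F') (at x)"
    and im: "((\<lambda>x. Im (F x)) has_real_derivative Im F') (at x)"
    if "(F has_vector_derivative F') (at x)" for F F'
    using bounded_linear.has_vector_derivative[OF bounded_linear_Re that]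
      bounded_linear.has_vector_derivative[OF bounded_linear_Im that]
    by (auto simp: has_real_derivative_iff_has_vector_derivative)
  show ?thesis
    unfolding hyp_metric_def inner_complex_def cov_deriv_def
    by (rule derivative_eq_intros re[OF D(2)] re[OF D(3)] im[OF D(1)] im[OF D(2)] im[OF D(3)] refl)+
      (use assms(4) in \<open>auto simp: field_simps power2_eq_square\<close>)
qed

lemma smooth_on_imp:
  fixes f :: "real \<Rightarrow> 'a::real_normed_vector"
  assumes "smooth_on UNIV f"
  shows "f differentiable at x" and "vderiv f differentiable at x"
proof -
  have "Ck_on (Suc (Suc 0)) UNIV f" using assms smooth_on_def by blast
  then obtain f' where f': "\<And>x. (f has_derivative f' x) (at x)"
    and c: "\<And>v. Ck_on (Suc 0) UNIV (\<lambda>x. f' x v)" by auto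
  show "f differentiable at x" using f' differentiable_def by blast
  have "vderiv f = (\<lambda>x. f' x 1)"
  proof
    fix x
    have "f' x = (\<lambda>h. h *\<^sub>R f' x 1)"
    proof
      fix h
      have "f' x (h *\<^sub>R 1) = h *\<^sub>R f' x 1"
        using has_derivative_linear[OF f'] linear_cmul by blast
      then show "f' x h = h *\<^sub>R f' x 1" by simp
    qed
    then have "(f has_vector_derivative f' x 1) (at x)"
      using f'[of x] unfolding has_vector_derivative_def by metis
    then show "vderiv f x = f' x 1" unfolding vderiv_def by (rule vector_derivative_at)
  qed
  with c[of 1] show "vderiv f differentiable at x"
    by (auto simp: differentiable_def)
qed

lemma hyp_curvature:
  assumes "closed_immersion \<gamma>"
  shows "nabla_T_T \<gamma> x = hyp_curvature \<gamma> x *\<^sub>R hyp_normal \<gamma> x"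
proof -
  let ?T = "hyp_tangent \<gamma>"
  have y: "Im (\<gamma> x) > 0" "vderiv \<gamma> x \<noteq> 0" for x
    using assms closed_immersion_def by auto
  have d: "\<gamma> differentiable at x" "vderiv \<gamma> differentiable at x" for x
    using assms smooth_on_imp closed_immersion_def by auto
  have sp: "hyp_speed \<gamma> x = norm (vderiv \<gamma> x) / Im (\<gamma> x)" for x
    using y(1)[of x] unfolding hyp_speed_def hyp_metric_def
    by (simp add: real_sqrt_divide norm_eq_sqrt_inner)
  have T: "?T = (\<lambda>x. (Im (\<gamma> x) / norm (vderiv \<gamma> x)) *\<^sub>R vderiv \<gamma> x)"
    by (auto simp: hyp_tangent_def arc_deriv_def sp)
  obtain D where D: "(\<gamma> has_derivative D) (at x)" using d differentiable_def by blast
  have "(\<lambda>x. Im (\<gamma> x)) differentiable at x"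
    using bounded_linear.has_derivative[OF bounded_linear_Im D] differentiable_def by blast
  moreover have "(\<lambda>x. norm (vderiv \<gamma> x)) differentiable at x"
    using differentiable_compose[of norm "vderiv \<gamma>" x UNIV] d(2)[of x] y(2)[of x]
      differentiable_norm_at by blast
  ultimately have dT: "?T differentiable at x"
    unfolding T using y d by (intro derivative_intros) auto
  have unit: "hyp_metric (\<gamma> z) (?T z) (?T z) = 1" for z
    using y(1)[of z] y(2)[of z]
    unfolding T hyp_metric_def
    by (simp add: dot_square_norm field_simps power2_eq_square)
  have "((\<lambda>_. 1) has_real_derivative
     (hyp_metric (\<gamma> x) (cov_deriv \<gamma> ?T x) (?T x) + hyp_metric (\<gamma> x) (?T x) (cov_deriv \<gamma> ?T x))) (at x)"
    using cov_deriv_metric[OF d(1) dT dT y(1)] unfolding unit .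
  then have "hyp_metric (\<gamma> x) (cov_deriv \<gamma> ?T x) (?T x) + hyp_metric (\<gamma> x) (?T x) (cov_deriv \<gamma> ?T x) = 0"
    using DERIV_unique DERIV_const by blast
  then have orth: "cov_deriv \<gamma> ?T x \<bullet> ?T x = 0"
    using y(1)[of x] by (auto simp: hyp_metric_def inner_commute)
  have nz: "?T x \<noteq> 0" using y[of x] by (auto simp: T)
  have "\<exists>k. w = k *\<^sub>R (\<i> * v)" if "w \<bullet> v = 0" "v \<noteq> 0" for v w :: complex
  proof
    let ?n = "(Re v)\<^sup>2 + (Im v)\<^sup>2"
    have n: "?n \<noteq> 0" using that(2) by (simp add: complex_eq_iff)
    have o: "Re w * Re v = - (Im w * Im v)" using that(1) by (simp add: inner_complex_def)
    have "Re w * ?n = (Re w * Re v) * Re v + Re w * (Im v)\<^sup>2"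
      by (simp add: algebra_simps power2_eq_square)
    also have "\<dots> = - (Im w * Re v - Re w * Im v) * Im v"
      unfolding o by (simp add: algebra_simps power2_eq_square)
    finally have a: "Re w = - ((Im w * Re v - Re w * Im v) * Im v / ?n)" using n by (simp add: field_simps)
    have "Im w * ?n = Im w * (Re v)\<^sup>2 + (Im w * Im v) * Im v"
      by (simp add: algebra_simps power2_eq_square)
    also have "\<dots> = (Im w * Re v - Re w * Im v) * Re v"
      using o by (simp add: algebra_simps power2_eq_square)
    finally have b: "Im w = (Im w * Re v - Re w * Im v) * Re v / ?n" using n by (simp add: field_simps)
    show "w = ((Im w * Re v - Re w * Im v) / ?n) *\<^sub>R (\<i> * v)"
      using a b by (simp add: complex_eq_iff)
  qed
  then obtain k where k: "cov_deriv \<gamma> ?T x = k *\<^sub>R (\<i> * ?T x)" using orth nz by blast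
  have "nabla_T_T \<gamma> x = (k / hyp_speed \<gamma> x) *\<^sub>R hyp_normal \<gamma> x"
    by (simp add: nabla_T_T_def k hyp_normal_def divide_inverse)
  moreover have "hyp_normal \<gamma> x \<noteq> 0" using nz by (simp add: hyp_normal_def)
  ultimately have "\<exists>!k. nabla_T_T \<gamma> x = k *\<^sub>R hyp_normal \<gamma> x" by auto
  then show ?thesis unfolding hyp_curvature_def by (rule theI')
qed

end

theory Submission
  imports Defs "HOL-Complex_Analysis.Cauchy_Integral_Theorem"
begin

text \<open>
  Along the flow the energy \<open>E\<close> satisfies \<open>E' = -Q\<close> with \<open>Q\<close> the squared \<open>L\<^sup>2\<close> norm of the
  gradient, and the Euclidean total curvature is constant. If the lengths were bounded, a lower
  bound for \<open>Q\<close> on curves with bounded length and energy and total curvature zero would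
  make \<open>E\<close> negative in finite time.

  The lower bound comes from the Killing field of a free elastica. For any curve let \<open>q\<^sub>s\<close> be the
  Killing field, that is, the real quadratic polynomial, with value \<open>\<kappa>\<^sup>2 T + 2 \<kappa>' N\<close> and rotation
  \<open>2 \<kappa>\<close> at the point with parameter \<open>s\<close>. Its derivative in \<open>s\<close> is linear in
  \<open>2 \<kappa>'' + \<kappa>\<^sup>3 - 2 \<kappa>\<close>, so after normalization by an isometry \<open>q\<^sub>s\<close> is close to a fixed \<open>q\<close> when
  \<open>Q\<close> is small, and by compactness of the set of coefficients only a single \<open>q\<close> has
  to be excluded. The discriminant of \<open>q\<^sub>s\<close> is \<open>\<kappa>\<^sup>4 + 4 \<kappa>'\<^sup>2 - 4 \<kappa>\<^sup>2\<close>, and the inner product of \<open>q\<^sub>s\<close>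
  with \<open>T\<close> is \<open>\<kappa>\<^sup>2\<close>. If \<open>q\<close> has a nonnegative discriminant and is not zero, then \<open>1 / q\<close> is
  holomorphic on the half plane, and the real part of \<open>\<integral> dz / q(z) = 0\<close> forces the energy to be
  small, which is impossible for a closed curve of bounded length; \<open>q = 0\<close> forces the
  same. If the discriminant is negative, then \<open>\<kappa>\<close> has no zero, \<open>T\<close> is homotopic to \<open>q\<close> along the
  curve, so the winding number of the curve about the zero of \<open>q\<close> equals the total curvature; it
  is not zero, again by \<open>\<integral> dz / q(z)\<close>.
\<close>

section \<open>Closed curves in arclength data\<close>

text \<open>No limit of curves is ever taken. A small gradient yields only an approximate elastica,
  so all statements are made for approximate fields, and what is kept of a curve is a triple of real
  coefficients together with the relation that the inner product with T is \<open>k^2\<close> up to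
  an error. Compactness is then needed for triples of reals only; the price is a gap that is not
  explicit. The length bound enters twice. It confines a curve normalized to start at \<i> to a
  compact rectangle, where the height and its inverse are bounded. It also makes the length small
  when the energy is small, whereas an energy bound forces a definite length; this is the
  contradiction for a nonnegative discriminant. For a negative discriminant \<open>1 / q\<close> has
  a pole w0 in the half plane, and each turn about it contributes the real number pi / (d Im w0) to
  the integral of dz / q. So the real part of this integral does not contradict closedness for a
  curve that winds about w0; vanishing total curvature is what excludes winding.\<close>

lemma integral_deriv_periodic:
  fixes F f :: "real \<Rightarrow> 'a::banach"
  assumes "\<And>x. x \<in> {0..1} \<Longrightarrow> (F has_vector_derivative f x) (at x)" "F 1 = F 0"
  shows "(f has_integral 0) {0..1}"
  using fundamental_theorem_of_calculus[of 0 1 F f] assms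
  by (simp add: has_vector_derivative_at_within)

lemma oscillation_le_integral:
  fixes F f h :: "real \<Rightarrow> real"
  assumes F: "\<And>x. (F has_real_derivative f x) (at x)"
    and h: "continuous_on {0..1} h" and fh: "\<And>x. x \<in> {0..1} \<Longrightarrow> \<bar>f x\<bar> \<le> h x"
    and xy: "x \<in> {0..1}" "y \<in> {0..1}"
  shows "\<bar>F x - F y\<bar> \<le> integral {0..1} h"
  using xy
proof (induction x y rule: linorder_wlog)
  case (le x y)
  have i: "(f has_integral (F y - F x)) {x..y}"
    using fundamental_theorem_of_calculus[of x y F f] F le
    by (simp add: has_vector_derivative_at_within has_real_derivative_iff_has_vector_derivative)
  have hi: "h integrable_on {x..y}" "h integrable_on {0..1}"
    using h le by (auto intro!: integrable_continuous_real elim: continuous_on_subset)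
  have "norm (integral {x..y} f) \<le> integral {x..y} h"
    using i hi fh le by (intro integral_norm_bound_integral) auto
  also have "\<dots> \<le> integral {0..1} h"
    using hi le by (intro integral_subset_le) (auto intro!: order_trans[OF abs_ge_zero fh])
  finally show ?case using integral_unique[OF i] by simp
qed (simp add: abs_minus_commute)

lemma weighted_Cauchy_Schwarz:
  fixes f h v :: "real \<Rightarrow> real"
  assumes c: "continuous_on {0..1} f" "continuous_on {0..1} h" "continuous_on {0..1} v"
    and v: "\<And>x. x \<in> {0..1} \<Longrightarrow> 0 \<le> v x"
  shows "integral {0..1} (\<lambda>x. f x * h x * v x)
    \<le> sqrt (integral {0..1} (\<lambda>x. (f x)\<^sup>2 * v x) * integral {0..1} (\<lambda>x. (h x)\<^sup>2 * v x))"
proof -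
  define A B C where "A = integral {0..1} (\<lambda>x. (f x)\<^sup>2 * v x)"
    and "B = integral {0..1} (\<lambda>x. f x * h x * v x)"
    and "C = integral {0..1} (\<lambda>x. (h x)\<^sup>2 * v x)"
  have q: "0 \<le> A * t\<^sup>2 - 2 * t * B + C" for t
  proof -
    have I: "((\<lambda>x. (f x)\<^sup>2 * v x) has_integral A) {0..1}" "((\<lambda>x. f x * h x * v x) has_integral B) {0..1}"
      "((\<lambda>x. (h x)\<^sup>2 * v x) has_integral C) {0..1}"
      unfolding A_def B_def C_def using c
      by (auto intro!: integrable_integral integrable_continuous_real continuous_intros)
    have "((\<lambda>x. (f x)\<^sup>2 * v x * t\<^sup>2 - f x * h x * v x * (2*t) + (h x)\<^sup>2 * v x) has_integral
        (A * t\<^sup>2 - B * (2*t) + C)) {0..1}"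
      by (intro has_integral_add has_integral_diff has_integral_mult_left I)
    moreover have "(f x)\<^sup>2 * v x * t\<^sup>2 - f x * h x * v x * (2*t) + (h x)\<^sup>2 * v x = (f x * t - h x)\<^sup>2 * v x" for x
      by (simp add: power2_eq_square algebra_simps)
    ultimately have "((\<lambda>x. (f x * t - h x)\<^sup>2 * v x) has_integral (A * t\<^sup>2 - B * (2*t) + C)) {0..1}" by simp
    then have "0 \<le> A * t\<^sup>2 - B * (2*t) + C" by (rule has_integral_nonneg) (use v in auto)
    then show ?thesis by (simp add: algebra_simps)
  qed
  have A0: "0 \<le> A" unfolding A_def
    by (intro integral_nonneg integrable_continuous_real continuous_intros c) (use v in auto)
  have C0: "0 \<le> C" using q[of 0] by simp
  have "B\<^sup>2 \<le> A * C"
  proof (cases "A = 0")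
    case True
    have "B = 0"
    proof (rule ccontr)
      assume "B \<noteq> 0"
      \<comment> \<open>For A = 0 the polynomial is affine in t, and at this t its value is
        -1.\<close>
      then show False using q[of "(C+1)/(2*B)"] True by simp
    qed
    then show ?thesis using True by simp
  next
    case False
    have "0 \<le> A * (A * (B/A)\<^sup>2 - 2 * (B/A) * B + C)" using q[of "B/A"] A0 by (intro mult_nonneg_nonneg)
    also have "\<dots> = A * C - B\<^sup>2" using False by (simp add: field_simps power2_eq_square)
    finally show ?thesis by simp
  qed
  then show ?thesis unfolding A_def[symmetric] B_def[symmetric] C_def[symmetric]
    using real_le_rsqrt by blast
qed

text \<open>
  The curve \<open>(p, Y)\<close> has hyperbolic speed \<open>v\<close>, Euclidean unit direction \<open>(c, s)\<close>, and curvature \<open>k\<close>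
  with arclength derivatives \<open>k1\<close> and \<open>k2\<close>. Since \<open>k = Y k\<^sub>E + c\<close> with the Euclidean curvature \<open>k\<^sub>E\<close>, the
  direction turns at the rate \<open>(k - c) v\<close>.
\<close>

locale closed_curve =
  fixes p Y c s v k k1 k2 :: "real \<Rightarrow> real"
  assumes p': "(p has_real_derivative v x * Y x * c x) (at x)"
    and Y': "(Y has_real_derivative v x * Y x * s x) (at x)"
    and c': "(c has_real_derivative - ((k x - c x) * v x * s x)) (at x)"
    and s': "(s has_real_derivative (k x - c x) * v x * c x) (at x)"
    and k': "(k has_real_derivative k1 x * v x) (at x)"
    and k1': "(k1 has_real_derivative k2 x * v x) (at x)"
    and cont_v: "continuous_on UNIV v" and cont_k2: "continuous_on UNIV k2"
    and v_pos: "0 < v x" and Y_pos: "0 < Y x" and unit: "(c x)\<^sup>2 + (s x)\<^sup>2 = 1"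
    and periodic: "p 1 = p 0" "Y 1 = Y 0" "c 1 = c 0" "s 1 = s 0" "k 1 = k 0" "k1 1 = k1 0"
begin

definition g where "g x = 2 * k2 x + k x ^ 3 - 2 * k x"
definition len where "len = integral {0..1} v"
definition energy where "energy = integral {0..1} (\<lambda>x. (k x)\<^sup>2 * v x)"
definition grad where "grad = integral {0..1} (\<lambda>x. (g x)\<^sup>2 * v x)"
text \<open>The total rotation of the direction \<open>(c, s)\<close>, hence 2 pi times the
  Euclidean total curvature.\<close>

definition turning where "turning = integral {0..1} (\<lambda>x. (k x - c x) * v x)"

lemmas derivs = p' Y' c' s' k' k1'

lemma cont[continuous_intros]:
  "continuous_on A p" "continuous_on A Y" "continuous_on A c" "continuous_on A s"
  "continuous_on A k" "continuous_on A k1" "continuous_on A k2" "continuous_on A v"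
  by (rule continuous_at_imp_continuous_on ballI DERIV_isCont derivs
      continuous_on_subset[OF cont_v subset_UNIV] continuous_on_subset[OF cont_k2 subset_UNIV])+

lemma cont_g[continuous_intros]: "continuous_on A g"
  unfolding g_def by (intro continuous_intros)

lemma Y_nz[simp]: "Y x \<noteq> 0" using Y_pos[of x] by simp

lemma cont_divide_Y: "continuous_on A f \<Longrightarrow> continuous_on A (\<lambda>x. f x / Y x)"
  by (intro continuous_on_divide cont) auto

lemma abs_cs: "\<bar>c x\<bar> \<le> 1" "\<bar>s x\<bar> \<le> 1"
proof -
  have "(c x)\<^sup>2 \<le> 1" "(s x)\<^sup>2 \<le> 1"
    using unit[of x] zero_le_power2[of "s x"] zero_le_power2[of "c x"] by linarith+
  then show "\<bar>c x\<bar> \<le> 1" "\<bar>s x\<bar> \<le> 1" by (simp_all add: abs_square_le_1)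
qed

lemma cs_le: "c x * a + s x * b \<le> sqrt (a\<^sup>2 + b\<^sup>2)" "- (c x * a + s x * b) \<le> sqrt (a\<^sup>2 + b\<^sup>2)"
proof -
  have "(c x * a + s x * b)\<^sup>2 \<le> a\<^sup>2 + b\<^sup>2"
  proof -
    have "(c x * a + s x * b)\<^sup>2 + (c x * b - s x * a)\<^sup>2 = ((c x)\<^sup>2 + (s x)\<^sup>2) * (a\<^sup>2 + b\<^sup>2)"
      by (simp add: power2_eq_square algebra_simps)
    then show ?thesis using zero_le_power2[of "c x * b - s x * a"] unfolding unit mult_1 by linarith
  qed
  then show "c x * a + s x * b \<le> sqrt (a\<^sup>2 + b\<^sup>2)" "- (c x * a + s x * b) \<le> sqrt (a\<^sup>2 + b\<^sup>2)"
    using real_le_rsqrt[of "- (c x * a + s x * b)"] by (auto intro: real_le_rsqrt simp only: power2_minus)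
qed

lemma integral_mono_unit: "continuous_on {0..1} f \<Longrightarrow> continuous_on {0..1} h \<Longrightarrow>
  (\<And>x. x \<in> {0..1} \<Longrightarrow> f x \<le> h x) \<Longrightarrow> integral {0..1} f \<le> integral {0..1} (h :: real \<Rightarrow> real)"
  by (intro integral_le integrable_continuous_real)

lemma len_pos: "0 < len"
proof -
  have "integral {0..1} (\<lambda>_::real. 0) < integral {0..1} v"
    by (rule integral_less_real) (auto simp: v_pos cont)
  then show ?thesis by (simp add: len_def)
qed

lemma energy_nonneg: "0 \<le> energy" and grad_nonneg: "0 \<le> grad"
  unfolding energy_def grad_def
  by (intro integral_nonneg integrable_continuous_real continuous_intros mult_nonneg_nonneg
      zero_le_power2 less_imp_le[OF v_pos])+

lemma integral_abs_le:
  assumes "continuous_on {0..1} f"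
  shows "integral {0..1} (\<lambda>x. \<bar>f x\<bar> * v x) \<le> sqrt (integral {0..1} (\<lambda>x. (f x)\<^sup>2 * v x) * len)"
  using weighted_Cauchy_Schwarz[of "\<lambda>x. \<bar>f x\<bar>" "\<lambda>_. 1" v] assms
  by (simp add: len_def v_pos less_imp_le cont continuous_on_rabs)

text \<open>A closed curve cannot move in directions that all lie in an open half plane.\<close>

lemma length_energy_bound: "1 \<le> len + sqrt (energy * len)"
proof -
  \<comment> \<open>The cosine of the angle between the directions at x and at 0.\<close>
  define d where "d x = c x * c 0 + s x * s 0" for x
  have d': "(d has_real_derivative (k x - c x) * v x * (c x * s 0 - s x * c 0)) (at x)" for x
    unfolding d_def by (rule derivative_eq_intros derivs refl | simp add: algebra_simps)+
  have "\<exists>x\<in>{0..1}. d x \<le> 0"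
  proof (rule ccontr)
    assume "\<not> ?thesis"
    then have pos: "\<And>x. x \<in> {0..1} \<Longrightarrow> 0 < d x" by force
    have "((\<lambda>x. p x * c 0 + Y x * s 0) has_real_derivative v x * Y x * d x) (at x)" for x
      unfolding d_def by (rule derivative_eq_intros derivs refl | simp add: algebra_simps)+
    then have "((\<lambda>x. v x * Y x * d x) has_integral 0) {0..1}"
      by (intro integral_deriv_periodic[where F = "\<lambda>x. p x * c 0 + Y x * s 0"])
        (auto simp: periodic has_real_derivative_iff_has_vector_derivative)
    then have "integral {0..1} (\<lambda>x. v x * Y x * d x) = 0" by (rule integral_unique)
    moreover have "integral {0..1} (\<lambda>_::real. 0) < integral {0..1} (\<lambda>x. v x * Y x * d x)"
    proof (rule integral_less_real)
      show "continuous_on {0..1} (\<lambda>x. v x * Y x * d x)" unfolding d_def by (intro continuous_intros)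
    qed (use pos in \<open>simp_all add: v_pos Y_pos\<close>)
    ultimately show False by simp
  qed
  then obtain x where x: "x \<in> {0..1}" "d x \<le> 0" by blast
  have d0: "d 0 = 1" using unit[of 0] by (simp add: d_def power2_eq_square)
  \<comment> \<open>\<open>d\<close> has dropped from 1 to at most 0, while its rate is at most (|k|
    + 1) v; the 1 accounts for the Euclidean turning \<open>-c\<close> of a geodesic.\<close>
  have "1 \<le> \<bar>d x - d 0\<bar>" using x d0 by simp
  also have "\<dots> \<le> integral {0..1} (\<lambda>x. \<bar>k x\<bar> * v x + v x)"
  proof (rule oscillation_le_integral[OF d'])
    show "\<bar>(k x - c x) * v x * (c x * s 0 - s x * c 0)\<bar> \<le> \<bar>k x\<bar> * v x + v x" for x
    proof -
      have a: "\<bar>c x * s 0 - s x * c 0\<bar> \<le> 1"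
        using cs_le[of x "s 0" "- c 0"] unit[of 0] by (simp add: abs_le_iff add.commute)
      have b: "\<bar>k x - c x\<bar> \<le> \<bar>k x\<bar> + 1" using abs_cs[of x] by linarith
      have "\<bar>k x - c x\<bar> * v x * \<bar>c x * s 0 - s x * c 0\<bar> \<le> (\<bar>k x\<bar> + 1) * v x * 1"
        using a b v_pos[of x] by (intro mult_mono) auto
      moreover have "\<bar>(k x - c x) * v x * (c x * s 0 - s x * c 0)\<bar> = \<bar>k x - c x\<bar> * v x * \<bar>c x * s 0 - s x * c 0\<bar>"
        by (simp add: abs_mult abs_of_pos[OF v_pos])
      ultimately show ?thesis by (simp add: distrib_right)
    qed
    show "continuous_on {0..1} (\<lambda>x. \<bar>k x\<bar> * v x + v x)" by (intro continuous_intros)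
  qed (use x in auto)
  also have "\<dots> = integral {0..1} (\<lambda>x. \<bar>k x\<bar> * v x) + len"
    unfolding len_def by (intro integral_add integrable_continuous_real continuous_intros)
  also have "\<dots> \<le> sqrt (energy * len) + len"
    unfolding energy_def by (intro add_right_mono integral_abs_le continuous_intros)
  finally show ?thesis by simp
qed

text \<open>In arclength, ln Y has slope \<open>s\<close>, of size at most 1, so a curve of length
  at most L starting at height 1 stays between the heights exp (-L) and exp L. There the Euclidean
  speed of \<open>p\<close> is at most exp L times the hyperbolic one.\<close>

lemma height_bounds:
  assumes "len \<le> L" "Y 0 = 1" "p 0 = 0" "x \<in> {0..1}"
  shows "exp (-L) \<le> Y x" "Y x \<le> exp L" "\<bar>p x\<bar> \<le> L * exp L"
proof -
  have lnY: "-L \<le> ln (Y x) \<and> ln (Y x) \<le> L" if "x \<in> {0..1}" for x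
  proof -
    have "((\<lambda>x. ln (Y x)) has_real_derivative v x * s x) (at x)" for x
      by (rule derivative_eq_intros derivs refl | simp add: Y_pos)+
    then have "\<bar>ln (Y x) - ln (Y 0)\<bar> \<le> integral {0..1} v"
      by (rule oscillation_le_integral)
        (use that in \<open>auto intro!: mult_left_le simp: abs_mult v_pos less_imp_le abs_cs cont\<close>)
    then have "\<bar>ln (Y x)\<bar> \<le> L" using assms(1,2) by (simp add: len_def)
    then show ?thesis by linarith
  qed
  have Y: "exp (-L) \<le> Y x \<and> Y x \<le> exp L" if "x \<in> {0..1}" for x
    using lnY[OF that] exp_le_cancel_iff[of "-L" "ln (Y x)"] exp_le_cancel_iff[of "ln (Y x)" L]
    unfolding exp_ln[OF Y_pos] by blast
  then show "exp (-L) \<le> Y x" "Y x \<le> exp L" using assms by auto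
  have "\<bar>p x - p 0\<bar> \<le> integral {0..1} (\<lambda>x. v x * exp L)"
  proof (rule oscillation_le_integral[OF p'])
    show "\<bar>v x * Y x * c x\<bar> \<le> v x * exp L" if "x \<in> {0..1}" for x
    proof -
      have "v x * Y x * \<bar>c x\<bar> \<le> v x * exp L * 1"
        using Y[OF that] v_pos[of x] Y_pos[of x] abs_cs[of x] by (intro mult_mono) auto
      then show ?thesis using v_pos[of x] Y_pos[of x] by (simp add: abs_mult)
    qed
    show "continuous_on {0..1} (\<lambda>x. v x * exp L)" by (intro continuous_intros)
  qed (use assms in auto)
  also have "\<dots> \<le> L * exp L" using assms by (simp add: len_def)
  finally show "\<bar>p x\<bar> \<le> L * exp L" using assms by simp
qed

text \<open>The function \<open>1 / Y\<close> has the Hessian \<open>1 / Y\<close> times the metric, so \<open>\<integral> ds / Y = \<integral> k c ds / Y\<close>.\<close>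

lemma length_le_energy:
  assumes "len \<le> L" "Y 0 = 1" "p 0 = 0"
  shows "len \<le> exp (4 * L) * energy"
proof -
  have Y: "exp (-L) \<le> Y x" "Y x \<le> exp L" if "x \<in> {0..1}" for x
    using height_bounds[OF assms that] by auto
  have "((\<lambda>x. s x / Y x) has_real_derivative k x * c x * v x / Y x - v x / Y x) (at x)" for x
  proof -
    have "((k x - c x) * v x * c x * Y x - s x * (v x * Y x * s x)) / (Y x * Y x)
      = k x * c x * v x / Y x - v x * ((c x)\<^sup>2 + (s x)\<^sup>2) / Y x"
      by (simp add: field_simps power2_eq_square)
    then show ?thesis
      by (auto intro!: derivative_eq_intros derivs simp: unit)
  qed
  then have A: "((\<lambda>x. k x * c x * v x / Y x - v x / Y x) has_integral 0) {0..1}"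
    by (intro integral_deriv_periodic[where F = "\<lambda>x. s x / Y x"])
      (auto simp: periodic has_real_derivative_iff_has_vector_derivative)
  have B: "((\<lambda>x. k x * c x * v x / Y x - v x / Y x) has_integral
      integral {0..1} (\<lambda>x. k x * c x * v x / Y x) - integral {0..1} (\<lambda>x. v x / Y x)) {0..1}"
    by (intro has_integral_diff integrable_integral integrable_continuous_real cont_divide_Y continuous_intros)
  have eq: "integral {0..1} (\<lambda>x. v x / Y x) = integral {0..1} (\<lambda>x. k x * c x * v x / Y x)"
    using has_integral_unique[OF B A] by simp
  have "len * exp (-L) = integral {0..1} (\<lambda>x. v x * exp (-L))" by (simp add: len_def)
  also have "\<dots> \<le> integral {0..1} (\<lambda>x. v x / Y x)"
  proof (rule integral_mono_unit)
    fix x :: real assume "x \<in> {0..1}"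
    then have "1 / exp L \<le> 1 / Y x" using Y Y_pos[of x] by (intro divide_left_mono) auto
    then have "v x * (1 / exp L) \<le> v x * (1 / Y x)" using v_pos[of x] by (intro mult_left_mono) auto
    then show "v x * exp (-L) \<le> v x / Y x" by (simp add: exp_minus inverse_eq_divide)
  qed (rule cont_divide_Y cont continuous_intros)+
  also have "\<dots> \<le> integral {0..1} (\<lambda>x. \<bar>k x\<bar> * v x * exp L)"
    unfolding eq
  proof (rule integral_mono_unit)
    fix x :: real assume x: "x \<in> {0..1}"
    have "1 / Y x \<le> 1 / exp (-L)" using Y[OF x] Y_pos[of x] by (intro divide_left_mono) auto
    then have i: "1 / Y x \<le> exp L" by (simp add: exp_minus divide_inverse)
    have "k x * c x \<le> \<bar>k x\<bar> * \<bar>c x\<bar>" "\<bar>k x\<bar> * \<bar>c x\<bar> \<le> \<bar>k x\<bar> * 1"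
      by (simp flip: abs_mult, intro mult_left_mono abs_cs) simp
    then have "k x * c x \<le> \<bar>k x\<bar> * 1" by (rule order_trans)
    then have "k x * c x * v x * (1 / Y x) \<le> \<bar>k x\<bar> * v x * exp L"
      using i v_pos[of x] Y_pos[of x]
      by (intro mult_mono) (auto intro!: mult_right_mono)
    then show "k x * c x * v x / Y x \<le> \<bar>k x\<bar> * v x * exp L" by simp
  qed (rule cont_divide_Y cont continuous_intros)+
  also have "\<dots> = integral {0..1} (\<lambda>x. \<bar>k x\<bar> * v x) * exp L" by simp
  also have "\<dots> \<le> sqrt (energy * len) * exp L"
    unfolding energy_def by (intro mult_right_mono integral_abs_le continuous_intros) auto
  finally have "len * exp (-L) * exp L \<le> sqrt (energy * len) * exp L * exp L" by (rule mult_right_mono) simp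
  then have "len \<le> sqrt (energy * len) * exp (2 * L)"
    by (simp add: mult.assoc exp_add[symmetric] )
  \<comment> \<open>After squaring, one factor \<open>len\<close> cancels and exp (2 L) becomes the
    exp (4 L) of the claim.\<close>
  then have "len\<^sup>2 \<le> (sqrt (energy * len) * exp (2 * L))\<^sup>2" using len_pos by (intro power_mono) auto
  also have "\<dots> = energy * len * exp (4 * L)"
    using energy_nonneg len_pos by (simp add: power_mult_distrib exp_double[symmetric])
  finally show ?thesis using len_pos by (simp add: power2_eq_square mult.commute mult.left_commute)
qed

end

section \<open>Length and curvature bounds from the energy and a small gradient\<close>

definition min_length :: "real \<Rightarrow> real" where
  "min_length E = min (1/2) (1 / (4 * (E + 1)))"

text \<open>The first summand bounds the minimum of k^2, the second its oscillation; the term in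
  parentheses bounds the integral of k1^2 ds.\<close>

definition curvature_bound :: "real \<Rightarrow> real" where
  "curvature_bound E = E / min_length E + 2 * sqrt (E * (E\<^sup>2 / min_length E + E ^ 3 + sqrt E))"

lemma min_length_pos: "0 \<le> E \<Longrightarrow> 0 < min_length E"
  by (simp add: min_length_def)

context closed_curve
begin

lemma min_length_le:
  assumes "energy \<le> E"
  shows "min_length E \<le> len"
proof (rule ccontr)
  assume "\<not> ?thesis"
  \<comment> \<open>The two entries of \<open>min_length\<close> are made so that both summands in
    \<open>length_energy_bound\<close> are at most 1/2, the first one strictly.\<close>
  then have l: "len < 1/2" "len < 1 / (4 * (E + 1))" by (auto simp: min_length_def)
  have E: "0 \<le> E" using assms energy_nonneg by linarith
  have "energy * len \<le> (E + 1) * (1 / (4 * (E + 1)))"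
    using assms l len_pos E by (intro mult_mono) auto
  also have "\<dots> = (1/2)\<^sup>2" using E by (simp add: power2_eq_square)
  finally have "sqrt (energy * len) \<le> sqrt ((1/2)\<^sup>2)" by (rule real_sqrt_le_mono)
  also have "\<dots> = 1/2" by (rule real_sqrt_unique) auto
  finally have "sqrt (energy * len) \<le> 1/2" .
  then show False using length_energy_bound l by linarith
qed

text \<open>Testing 2 k'' + k^3 - 2 k = g with k expresses the integral A of k1^2 ds through that of
  k^4 ds, which is at most sup k^2 times the energy. In turn sup k^2 grows at most like sqrt (E A),
  so A enters on the right only with the power 1/2 and can be absorbed. The bound for
  \<open>k1\<close> then comes from integrating \<open>k2\<close>, which g and k control.\<close>

lemma curvature_bounds:
  assumes L: "len \<le> L" and E: "energy \<le> E" and G: "grad \<le> 1" and x: "x \<in> {0..1}"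
  shows "(k x)\<^sup>2 \<le> curvature_bound E"
    and "\<bar>k1 x\<bar> \<le> sqrt L + (curvature_bound E + 2) * sqrt (E * L)"
proof -
  define A where "A = integral {0..1} (\<lambda>x. (k1 x)\<^sup>2 * v x)"
  define I4 where "I4 = integral {0..1} (\<lambda>x. k x ^ 4 * v x)"
  define Ig where "Ig = integral {0..1} (\<lambda>x. g x * k x * v x)"
  define l where "l = min_length E"
  have E0: "0 \<le> E" using E energy_nonneg by linarith
  have L0: "0 \<le> L" using L len_pos by linarith
  have l: "0 < l" "l \<le> len" using min_length_pos[OF E0] min_length_le[OF E] by (auto simp: l_def)
  have A0: "0 \<le> A" unfolding A_def
    by (intro integral_nonneg integrable_continuous_real continuous_intros mult_nonneg_nonneg
      zero_le_power2 less_imp_le[OF v_pos])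
  \<comment> \<open>The derivative k1^2 + k k2 in arclength, with k2 replaced by (g - k^3 + 2 k) /
    2.\<close>
  have "((\<lambda>x. k x * k1 x) has_real_derivative (k1 x)\<^sup>2 * v x + (g x * k x * v x - k x ^ 4 * v x + 2 * ((k x)\<^sup>2 * v x)) / 2) (at x)" for x
    by (rule derivative_eq_intros derivs refl)+
      (simp add: g_def algebra_simps power2_eq_square power4_eq_xxxx power3_eq_cube)
  then have a: "((\<lambda>x. (k1 x)\<^sup>2 * v x + (g x * k x * v x - k x ^ 4 * v x + 2 * ((k x)\<^sup>2 * v x)) / 2) has_integral 0) {0..1}"
    by (intro integral_deriv_periodic[where F = "\<lambda>x. k x * k1 x"])
      (auto simp: periodic has_real_derivative_iff_has_vector_derivative)
  have b: "((\<lambda>x. (k1 x)\<^sup>2 * v x + (g x * k x * v x - k x ^ 4 * v x + 2 * ((k x)\<^sup>2 * v x)) / 2) has_integral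
      A + (Ig - I4 + 2 * energy) / 2) {0..1}"
    unfolding A_def Ig_def I4_def energy_def
    by (intro has_integral_add has_integral_diff has_integral_divide has_integral_mult_right
       integrable_integral integrable_continuous_real continuous_intros)
  have parts: "2 * A = I4 - Ig - 2 * energy"
    using has_integral_unique[OF b a] by (simp add: field_simps)
  \<comment> \<open>Somewhere k^2 is at most its mean value energy / len.\<close>
  have "\<exists>x0\<in>{0..1}. (k x0)\<^sup>2 * len \<le> energy"
  proof (rule ccontr)
    assume "\<not> ?thesis"
    then have gt: "energy < (k x)\<^sup>2 * len" if "x \<in> {0..1}" for x using that by (simp add: not_le)
    have "integral {0..1} (\<lambda>x. energy * v x) < integral {0..1} (\<lambda>x. (k x)\<^sup>2 * v x * len)"
    proof (rule integral_less_real)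
      show "energy * v x < (k x)\<^sup>2 * v x * len" if "x \<in> {0<..<1}" for x
        using mult_strict_right_mono[OF gt v_pos, of x x] that by (simp add: mult_ac)
    qed (auto intro!: continuous_on_mult continuous_on_power cont continuous_on_const)
    then show False by (simp flip: len_def energy_def)
  qed
  then obtain x0 where x0: "x0 \<in> {0..1}" "(k x0)\<^sup>2 * len \<le> energy" by blast
  have kx: "(k y)\<^sup>2 \<le> E / l + 2 * sqrt (E * A)" if y: "y \<in> {0..1}" for y
  proof -
    have "((\<lambda>x. (k x)\<^sup>2) has_real_derivative 2 * k x * k1 x * v x) (at x)" for x
      by (rule derivative_eq_intros derivs refl | simp)+
    then have "\<bar>(k y)\<^sup>2 - (k x0)\<^sup>2\<bar> \<le> integral {0..1} (\<lambda>x. \<bar>k x\<bar> * \<bar>k1 x\<bar> * v x * 2)"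
    proof (rule oscillation_le_integral)
      show "continuous_on {0..1} (\<lambda>x. \<bar>k x\<bar> * \<bar>k1 x\<bar> * v x * 2)" by (intro continuous_intros)
    qed (use x0 y in \<open>auto simp: abs_mult abs_of_pos[OF v_pos]\<close>)
    also have "\<dots> = integral {0..1} (\<lambda>x. \<bar>k x\<bar> * \<bar>k1 x\<bar> * v x) * 2" by simp
    also have "\<dots> \<le> sqrt (integral {0..1} (\<lambda>x. \<bar>k x\<bar>\<^sup>2 * v x) * integral {0..1} (\<lambda>x. \<bar>k1 x\<bar>\<^sup>2 * v x)) * 2"
      by (intro mult_right_mono weighted_Cauchy_Schwarz continuous_intros) (auto simp: v_pos less_imp_le)
    also have "\<dots> = sqrt (energy * A) * 2" by (simp add: energy_def A_def)
    also have "\<dots> \<le> sqrt (E * A) * 2" using E A0 by (simp add: mult_right_mono)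
    finally have "(k y)\<^sup>2 \<le> (k x0)\<^sup>2 + sqrt (E * A) * 2" by linarith
    moreover have "(k x0)\<^sup>2 \<le> E / l"
    proof -
      have "(k x0)\<^sup>2 \<le> energy / len" using x0 len_pos by (simp add: field_simps)
      also have "\<dots> \<le> E / l" using E l energy_nonneg E0 by (intro frac_le) auto
      finally show ?thesis .
    qed
    ultimately show ?thesis by simp
  qed
  have "2 * A \<le> (E / l + 2 * sqrt (E * A)) * E + sqrt E"
  proof -
    let ?M = "E / l + 2 * sqrt (E * A)"
    have M: "0 \<le> ?M" using E0 l A0 by simp
    have "I4 \<le> integral {0..1} (\<lambda>x. ?M * ((k x)\<^sup>2 * v x))"
      unfolding I4_def
    proof (rule integral_mono_unit)
      show "k x ^ 4 * v x \<le> ?M * ((k x)\<^sup>2 * v x)" if "x \<in> {0..1}" for x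
      proof -
        have "(k x)\<^sup>2 * ((k x)\<^sup>2 * v x) \<le> ?M * ((k x)\<^sup>2 * v x)"
          using kx[OF that] v_pos[of x] by (intro mult_right_mono) auto
        then show ?thesis by (simp add: power2_eq_square power4_eq_xxxx mult_ac)
      qed
    qed (intro continuous_intros)+
    also have "\<dots> = ?M * energy" by (simp add: energy_def)
    also have "\<dots> \<le> ?M * E" using M E by (rule mult_left_mono[rotated])
    finally have 1: "I4 \<le> ?M * E" .
    have "- Ig = integral {0..1} (\<lambda>x. (- g x) * k x * v x)" by (simp add: Ig_def)
    also have "\<dots> \<le> sqrt (integral {0..1} (\<lambda>x. (- g x)\<^sup>2 * v x) * integral {0..1} (\<lambda>x. (k x)\<^sup>2 * v x))"
      by (intro weighted_Cauchy_Schwarz continuous_intros) (auto simp: v_pos less_imp_le)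
    also have "\<dots> = sqrt (grad * energy)" by (simp add: grad_def energy_def)
    also have "\<dots> \<le> sqrt (1 * E)" using G E grad_nonneg energy_nonneg by (intro real_sqrt_le_mono mult_mono) auto
    finally have 2: "- Ig \<le> sqrt E" by simp
    show ?thesis using 1 2 parts energy_nonneg by linarith
  qed
  \<comment> \<open>The absorption: twice the product of sqrt A and E sqrt E is at most the sum of
    their squares.\<close>
  moreover have "2 * sqrt (E * A) * E \<le> A + E ^ 3"
  proof -
    have "0 \<le> (sqrt A - E * sqrt E)\<^sup>2" by simp
    also have "\<dots> = A + E ^ 3 - 2 * sqrt (E * A) * E"
      using A0 E0 by (simp add: power2_diff power_mult_distrib real_sqrt_mult power3_eq_cube)
        (simp add: power2_eq_square)
    finally show ?thesis by simp
  qed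
  ultimately have A_le: "A \<le> E\<^sup>2 / l + E ^ 3 + sqrt E"
    by (simp add: algebra_simps power2_eq_square)
  have kb: "(k y)\<^sup>2 \<le> curvature_bound E" if "y \<in> {0..1}" for y
  proof -
    have "sqrt (E * A) \<le> sqrt (E * (E\<^sup>2 / l + E ^ 3 + sqrt E))"
      by (intro real_sqrt_le_mono mult_left_mono A_le E0)
    then show ?thesis using kx[OF that] unfolding curvature_bound_def l_def[symmetric] by linarith
  qed
  then show "(k x)\<^sup>2 \<le> curvature_bound E" using x by blast
  have c0: "0 \<le> curvature_bound E" using kb[OF x] zero_le_power2[of "k x"] by linarith
  \<comment> \<open>By periodicity of \<open>k\<close> there is a zero of \<open>k1\<close>, from
    which \<open>k2\<close> is integrated.\<close>
  obtain z where z: "0 < z" "z < 1" "k1 z = 0"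
  proof -
    have "\<exists>z>0. z < 1 \<and> (\<lambda>h. h * (k1 z * v z)) = (\<lambda>v. 0)"
      by (rule Rolle_deriv[of 0 1 k "\<lambda>x h. h * (k1 x * v x)"])
        (use k' in \<open>auto simp: periodic cont has_field_derivative_def mult.commute[of _ "_ * _"]\<close>)
    then obtain z where "0 < z" "z < 1" and z0: "(\<lambda>h. h * (k1 z * v z)) = (\<lambda>v. 0)" by blast
    moreover have "k1 z = 0" using fun_cong[OF z0, of 1] v_pos[of z] by simp
    ultimately show ?thesis using that by blast
  qed
  have "\<bar>k1 x - k1 z\<bar> \<le> integral {0..1} (\<lambda>x. \<bar>g x\<bar> * v x + (curvature_bound E + 2) * (\<bar>k x\<bar> * v x))"
  proof (rule oscillation_le_integral[OF k1'])
    show "\<bar>k2 y * v y\<bar> \<le> \<bar>g y\<bar> * v y + (curvature_bound E + 2) * (\<bar>k y\<bar> * v y)" if "y \<in> {0..1}" for y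
    proof -
      have "k2 y = g y / 2 - k y * (k y)\<^sup>2 / 2 + k y" by (simp add: g_def field_simps power2_eq_square power3_eq_cube)
      then have "\<bar>k2 y\<bar> \<le> \<bar>g y\<bar> / 2 + \<bar>k y\<bar> * (k y)\<^sup>2 / 2 + \<bar>k y\<bar>"
        using abs_mult[of "k y" "(k y)\<^sup>2"] by (simp only: abs_power2)
      also have "\<dots> \<le> \<bar>g y\<bar> + (curvature_bound E + 2) * \<bar>k y\<bar>"
        using mult_left_mono[OF kb[OF that] abs_ge_zero[of "k y"]] mult_nonneg_nonneg[OF c0 abs_ge_zero[of "k y"]]
        unfolding distrib_right mult.commute[of "curvature_bound E"] by linarith
      finally have "\<bar>k2 y\<bar> * v y \<le> (\<bar>g y\<bar> + (curvature_bound E + 2) * \<bar>k y\<bar>) * v y"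
        using v_pos[of y] by (intro mult_right_mono) auto
      then show ?thesis using v_pos[of y] by (simp add: abs_mult algebra_simps)
    qed
    show "continuous_on {0..1} (\<lambda>x. \<bar>g x\<bar> * v x + (curvature_bound E + 2) * (\<bar>k x\<bar> * v x))"
      by (intro continuous_intros)
  qed (use x z in auto)
  also have "\<dots> = integral {0..1} (\<lambda>x. \<bar>g x\<bar> * v x) + (curvature_bound E + 2) * integral {0..1} (\<lambda>x. \<bar>k x\<bar> * v x)"
    by (subst integral_add) (intro integrable_continuous_real continuous_intros | simp)+
  also have "\<dots> \<le> sqrt (grad * len) + (curvature_bound E + 2) * sqrt (energy * len)"
    unfolding grad_def energy_def
    by (intro add_mono mult_left_mono integral_abs_le continuous_intros) (use c0 in auto)
  also have "\<dots> \<le> sqrt (1 * L) + (curvature_bound E + 2) * sqrt (E * L)"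
    using c0 G E L grad_nonneg energy_nonneg len_pos E0 L0
    by (intro add_mono mult_left_mono real_sqrt_le_mono mult_mono) auto
  finally show "\<bar>k1 x\<bar> \<le> sqrt L + (curvature_bound E + 2) * sqrt (E * L)" using z by simp
qed

text \<open>
  The complex number \<open>j1 + \<i> j2\<close> is \<open>(k\<^sup>2 T + 2 k1 N) / Y\<close>, and \<open>kA + kB z + kC z\<^sup>2\<close> is the Killing field
  with this value (times \<open>Y\<close>) and rotation \<open>2 k\<close> at the point of the curve.
\<close>

definition j1 where "j1 x = (k x)\<^sup>2 * c x - 2 * k1 x * s x"
definition j2 where "j2 x = (k x)\<^sup>2 * s x + 2 * k1 x * c x"
definition kC where "kC x = (2 * k x - j1 x) / (2 * Y x)"
definition kB where "kB x = j2 x - 2 * kC x * p x"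
definition kA where "kA x = Y x * j1 x - kB x * p x - kC x * (p x)\<^sup>2 + kC x * (Y x)\<^sup>2"

text \<open>Covariantly, the derivative of k^2 T + 2 k1 N along T is (2 k2 + k^3) N = (g + 2 k) N,
  because the tangential terms 2 k k1 and -2 k1 k cancel; the factor 2 in front of k1 is there for
  this. For g = 0 the result is 2 k N, which explains the choice of the rotation 2 k.\<close>

lemma j1': "(j1 has_real_derivative v x * (c x * j2 x - s x * (g x + 2 * k x))) (at x)"
proof -
  have "(j1 has_real_derivative 2 * k x * (k1 x * v x) * c x + (k x)\<^sup>2 * (- ((k x - c x) * v x * s x))
      - (2 * (k2 x * v x) * s x + 2 * k1 x * ((k x - c x) * v x * c x))) (at x)"
    unfolding j1_def by (rule derivative_eq_intros derivs refl | simp)+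
  then show ?thesis
    by (simp add: g_def j2_def algebra_simps power2_eq_square power3_eq_cube)
qed

lemma j2': "(j2 has_real_derivative v x * c x * (g x + 2 * k x - j1 x)) (at x)"
proof -
  have "(j2 has_real_derivative 2 * k x * (k1 x * v x) * s x + (k x)\<^sup>2 * ((k x - c x) * v x * c x)
      + (2 * (k2 x * v x) * c x + 2 * k1 x * (- ((k x - c x) * v x * s x)))) (at x)"
    unfolding j2_def by (rule derivative_eq_intros derivs refl | simp)+
  then show ?thesis
    by (simp add: g_def j1_def algebra_simps power2_eq_square power3_eq_cube)
qed

end

section \<open>The Killing field of a curve\<close>

context closed_curve
begin

text \<open>The arclength derivative of the field is the Killing field with value g N and rotation 0
  at the point of the curve; \<open>kC'\<close>, \<open>kB'\<close> and \<open>kA'\<close> are its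
  coefficients. The value is g N because the covariant derivative of the value, (g + 2 k) N, exceeds
  the contribution 2 k N of the rotation by this much. The rotation is 0 because the rotation of a
  fixed Killing field changes along T at the rate of its normal component, here 2 k1, which is also
  the derivative of 2 k.\<close>

lemma kC': "(kC has_real_derivative v x * g x * (s x / (2 * Y x))) (at x)"
proof -
  have "c x * j2 x - s x * j1 x = 2 * k1 x * ((c x)\<^sup>2 + (s x)\<^sup>2)"
    by (simp add: j1_def j2_def algebra_simps power2_eq_square)
  then have e: "c x * j2 x = s x * j1 x + 2 * k1 x" by (simp add: unit)
  have "(kC has_real_derivative ((2 * (k1 x * v x) - v x * (c x * j2 x - s x * (g x + 2 * k x))) * (2 * Y x)
      - (2 * k x - j1 x) * (2 * (v x * Y x * s x))) / (2 * Y x * (2 * Y x))) (at x)"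
    unfolding kC_def by (rule derivative_eq_intros derivs j1' refl | simp)+
  then show ?thesis unfolding e by (simp add: field_simps)
qed

text \<open>The covariant derivative of the polynomial field q in the direction w is q' w + \<i> w q
  / Y. With q = Y (j1 + \<i> j2) and q' = j2 + 2 \<i> kC Y this is \<i> w (2 kC Y + j1), so the
  equation says that the rotation is 2 k.\<close>

lemma kC_Y: "2 * kC x * Y x = 2 * k x - j1 x"
  by (simp add: kC_def)

lemma kB': "(kB has_real_derivative v x * g x * (c x - s x * p x / Y x)) (at x)"
proof -
  have D: "(kB has_real_derivative v x * c x * (g x + 2 * k x - j1 x)
      - (2 * (v x * g x * (s x / (2 * Y x))) * p x + 2 * kC x * (v x * Y x * c x))) (at x)"
    unfolding kB_def by (rule derivative_eq_intros derivs j2' kC' refl | simp)+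
  have e: "2 * kC x * (v x * Y x * c x) = v x * c x * (2 * k x - j1 x)"
    by (simp flip: kC_Y)
  show ?thesis by (rule DERIV_cong[OF D]) (simp only: e, simp add: field_simps)
qed

lemma kA': "(kA has_real_derivative
  v x * g x * (s x * (p x)\<^sup>2 / (2 * Y x) - c x * p x - Y x * s x / 2)) (at x)"
proof -
  have D: "(kA has_real_derivative v x * Y x * s x * j1 x + Y x * (v x * (c x * j2 x - s x * (g x + 2 * k x)))
      - (v x * g x * (c x - s x * p x / Y x) * p x + kB x * (v x * Y x * c x))
      - (v x * g x * (s x / (2 * Y x)) * (p x)\<^sup>2 + kC x * (2 * p x * (v x * Y x * c x)))
      + (v x * g x * (s x / (2 * Y x)) * (Y x)\<^sup>2 + kC x * (2 * Y x * (v x * Y x * s x)))) (at x)"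
    unfolding kA_def by (rule derivative_eq_intros derivs j1' kB' kC' refl | simp)+
  have e: "kC x * (2 * Y x * (v x * Y x * s x)) = v x * Y x * s x * (2 * k x - j1 x)"
    by (simp flip: kC_Y)
  have f: "kB x * (v x * Y x * c x) = v x * Y x * c x * j2 x - kC x * (2 * p x * (v x * Y x * c x))"
    by (simp add: kB_def algebra_simps)
  show ?thesis by (rule DERIV_cong[OF D]) (simp only: e f, simp add: field_simps power2_eq_square)
qed

lemma killing_Re: "kA x + kB x * p x + kC x * ((p x)\<^sup>2 - (Y x)\<^sup>2) = Y x * j1 x"
  by (simp add: kA_def algebra_simps)

lemma killing_Im: "kB x * Y x + 2 * kC x * p x * Y x = Y x * j2 x"
  by (simp add: kB_def algebra_simps)

lemma j_norm: "(j1 x)\<^sup>2 + (j2 x)\<^sup>2 = k x ^ 4 + 4 * (k1 x)\<^sup>2"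
proof -
  have "(j1 x)\<^sup>2 + (j2 x)\<^sup>2 = (k x ^ 4 + 4 * (k1 x)\<^sup>2) * ((c x)\<^sup>2 + (s x)\<^sup>2)"
    by (simp add: j1_def j2_def algebra_simps power2_eq_square power4_eq_xxxx)
  then show ?thesis by (simp add: unit)
qed

lemma j_tangent: "c x * j1 x + s x * j2 x = (k x)\<^sup>2"
proof -
  have "c x * j1 x + s x * j2 x = (k x)\<^sup>2 * ((c x)\<^sup>2 + (s x)\<^sup>2)"
    by (simp add: j1_def j2_def algebra_simps power2_eq_square)
  then show ?thesis by (simp add: unit)
qed

text \<open>At every point the discriminant is the squared hyperbolic norm of the field minus the
  square of its rotation.\<close>

lemma killing_discriminant: "(kB x)\<^sup>2 - 4 * kA x * kC x = k x ^ 4 + 4 * (k1 x)\<^sup>2 - 4 * (k x)\<^sup>2"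
proof -
  have "(kB x)\<^sup>2 - 4 * kA x * kC x = (j1 x)\<^sup>2 + (j2 x)\<^sup>2 - (2 * kC x * Y x + j1 x)\<^sup>2"
    by (simp add: kA_def kB_def algebra_simps power2_eq_square)
  then show ?thesis by (simp add: kC_Y j_norm power_mult_distrib)
qed

text \<open>The factor of v g in each derivative is at most 3 R^3 in size, and the integral of |g|
  ds is at most sqrt (grad len) by Cauchy-Schwarz.\<close>

lemma killing_oscillation:
  assumes G: "grad \<le> G" and L: "len \<le> L" and R: "1 \<le> R"
    and b: "\<And>x. x \<in> {0..1} \<Longrightarrow> Y x \<le> R \<and> 1 / Y x \<le> R \<and> \<bar>p x\<bar> \<le> R" and x: "x \<in> {0..1}"
  shows "\<bar>kA x - kA 0\<bar> \<le> 3 * R ^ 3 * sqrt (G * L)"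
    and "\<bar>kB x - kB 0\<bar> \<le> 3 * R ^ 3 * sqrt (G * L)"
    and "\<bar>kC x - kC 0\<bar> \<le> 3 * R ^ 3 * sqrt (G * L)"
proof -
  have osc: "\<bar>F x - F 0\<bar> \<le> 3 * R ^ 3 * sqrt (G * L)"
    if F: "\<And>x. (F has_real_derivative v x * g x * f x) (at x)"
      and f: "\<And>x. x \<in> {0..1} \<Longrightarrow> \<bar>f x\<bar> \<le> 3 * R ^ 3" for F f
  proof -
    have "\<bar>F x - F 0\<bar> \<le> integral {0..1} (\<lambda>x. \<bar>g x\<bar> * v x * (3 * R ^ 3))"
    proof (rule oscillation_le_integral[OF F])
      show "\<bar>v y * g y * f y\<bar> \<le> \<bar>g y\<bar> * v y * (3 * R ^ 3)" if "y \<in> {0..1}" for y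
        using mult_left_mono[OF f[OF that], of "v y * \<bar>g y\<bar>"] v_pos[of y]
        by (simp add: abs_mult mult_ac)
      show "continuous_on {0..1} (\<lambda>x. \<bar>g x\<bar> * v x * (3 * R ^ 3))" by (intro continuous_intros)
    qed (use x in auto)
    also have "\<dots> = 3 * R ^ 3 * integral {0..1} (\<lambda>x. \<bar>g x\<bar> * v x)" by simp
    also have "\<dots> \<le> 3 * R ^ 3 * sqrt (grad * len)"
      unfolding grad_def using R by (intro mult_left_mono integral_abs_le continuous_intros) auto
    also have "\<dots> \<le> 3 * R ^ 3 * sqrt (G * L)"
      using R G L grad_nonneg len_pos by (intro mult_left_mono real_sqrt_le_mono mult_mono) auto
    finally show ?thesis .
  qed
  have R2: "1 \<le> R\<^sup>2" "R \<le> R ^ 3" "R\<^sup>2 \<le> R ^ 3" "1 \<le> R ^ 3"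
    using R self_le_power[of R 3] power_increasing[of 2 3 R] one_le_power[of R] by auto
  have cs: "\<bar>s y * q\<bar> \<le> \<bar>q\<bar>" "\<bar>c y * q\<bar> \<le> \<bar>q\<bar>" for y q
    using mult_right_mono[OF abs_cs(1)[of y], of "\<bar>q\<bar>"] mult_right_mono[OF abs_cs(2)[of y], of "\<bar>q\<bar>"]
    by (simp_all add: abs_mult)
  have bnd: "\<bar>1 / Y y\<bar> \<le> R" "\<bar>p y / Y y\<bar> \<le> R\<^sup>2" "\<bar>(p y)\<^sup>2 / Y y\<bar> \<le> R ^ 3" "\<bar>p y\<bar> \<le> R" "\<bar>Y y\<bar> \<le> R"
    if y: "y \<in> {0..1}" for y
  proof -
    show 1: "\<bar>1 / Y y\<bar> \<le> R" "\<bar>p y\<bar> \<le> R" "\<bar>Y y\<bar> \<le> R" using b[OF y] Y_pos[of y] by auto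
    have "\<bar>p y\<bar> * \<bar>1 / Y y\<bar> \<le> R * R" using 1 R by (intro mult_mono) auto
    then show 2: "\<bar>p y / Y y\<bar> \<le> R\<^sup>2" by (simp add: abs_mult power2_eq_square)
    have "\<bar>p y\<bar> * \<bar>p y / Y y\<bar> \<le> R * R\<^sup>2" using 1 2 R by (intro mult_mono) auto
    then show "\<bar>(p y)\<^sup>2 / Y y\<bar> \<le> R ^ 3" by (simp add: abs_mult power2_eq_square power3_eq_cube)
  qed
  show "\<bar>kC x - kC 0\<bar> \<le> 3 * R ^ 3 * sqrt (G * L)"
  proof (rule osc[OF kC'])
    fix y :: real assume y: "y \<in> {0..1}"
    define a where "a = s y * (1 / Y y)"
    have "s y / (2 * Y y) = a / 2" by (simp add: a_def)
    moreover have "\<bar>a\<bar> \<le> R" using cs(1)[of y "1 / Y y"] bnd(1)[OF y] unfolding a_def by linarith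
    ultimately show "\<bar>s y / (2 * Y y)\<bar> \<le> 3 * R ^ 3" using R2 by linarith
  qed
  show "\<bar>kB x - kB 0\<bar> \<le> 3 * R ^ 3 * sqrt (G * L)"
  proof (rule osc[OF kB'])
    fix y :: real assume y: "y \<in> {0..1}"
    define a where "a = s y * (p y / Y y)"
    have "s y * p y / Y y = a" by (simp add: a_def)
    moreover have "\<bar>a\<bar> \<le> R\<^sup>2" using cs(1)[of y "p y / Y y"] bnd(2)[OF y] unfolding a_def by linarith
    ultimately show "\<bar>c y - s y * p y / Y y\<bar> \<le> 3 * R ^ 3" using R2 abs_cs(1)[of y] by linarith
  qed
  show "\<bar>kA x - kA 0\<bar> \<le> 3 * R ^ 3 * sqrt (G * L)"
  proof (rule osc[OF kA'])
    fix y :: real assume y: "y \<in> {0..1}"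
    define a1 a2 a3 where "a1 = s y * ((p y)\<^sup>2 / Y y)" and "a2 = c y * p y" and "a3 = s y * Y y"
    have "s y * (p y)\<^sup>2 / (2 * Y y) - c y * p y - Y y * s y / 2 = a1 / 2 - a2 - a3 / 2"
      by (simp add: a1_def a2_def a3_def mult.commute)
    moreover have "\<bar>a1\<bar> \<le> R ^ 3" "\<bar>a2\<bar> \<le> R" "\<bar>a3\<bar> \<le> R"
      using cs(1)[of y "(p y)\<^sup>2 / Y y"] cs(2)[of y "p y"] cs(1)[of y "Y y"] bnd[OF y]
      unfolding a1_def a2_def a3_def by linarith+
    ultimately show "\<bar>s y * (p y)\<^sup>2 / (2 * Y y) - c y * p y - Y y * s y / 2\<bar> \<le> 3 * R ^ 3"
      using R2 by linarith
  qed
qed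

definition z where "z x = Complex (p x) (Y x)"
definition U where "U x = Complex (c x) (s x)"

lemma z': "(z has_vector_derivative of_real (v x * Y x) * U x) (at x)"
  and U': "(U has_vector_derivative \<i> * of_real ((k x - c x) * v x) * U x) (at x)"
proof -
  show "(z has_vector_derivative of_real (v x * Y x) * U x) (at x)"
    unfolding z_def[abs_def] U_def has_vector_derivative_complex_iff
    using p'[of x] Y'[of x] by (simp add: mult_ac)
  show "(U has_vector_derivative \<i> * of_real ((k x - c x) * v x) * U x) (at x)"
    unfolding U_def[abs_def] has_vector_derivative_complex_iff
    using c'[of x] s'[of x] by (simp add: mult_ac)
qed

end

section \<open>Real quadratic fields and integrals of dz / q along the curve\<close>

lemma has_vector_derivative_compose_field:
  assumes "(f has_vector_derivative f') (at x)" "(h has_field_derivative h') (at (f x))"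
  shows "((\<lambda>x. h (f x)) has_vector_derivative h' * f') (at x)"
  using field_vector_diff_chain_at[OF assms] by (simp add: o_def mult.commute)

definition quadratic :: "real \<Rightarrow> real \<Rightarrow> real \<Rightarrow> complex \<Rightarrow> complex" where
  "quadratic a b d w = of_real a + of_real b * w + of_real d * w\<^sup>2"

lemma quadratic_deriv:
  "(quadratic a b d has_field_derivative of_real b + 2 * of_real d * w) (at w)"
  unfolding quadratic_def[abs_def] by (rule derivative_eq_intros refl | simp)+

lemma quadratic_Re: "Re (quadratic a b d w) = a + b * Re w + d * ((Re w)\<^sup>2 - (Im w)\<^sup>2)"
  and quadratic_Im: "Im (quadratic a b d w) = b * Im w + 2 * d * Re w * Im w"
  by (simp_all add: quadratic_def power2_eq_square algebra_simps)

text \<open>A zero w in the half plane has its conjugate as a second root, so the discriminant would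
  be -4 (d Im w)^2.\<close>

lemma quadratic_nonzero:
  assumes "0 \<le> b\<^sup>2 - 4 * a * d" "(a, b, d) \<noteq> (0, 0, 0)" "0 < Im w"
  shows "quadratic a b d w \<noteq> 0"
proof
  assume "quadratic a b d w = 0"
  then have "Re (quadratic a b d w) = 0" "Im (quadratic a b d w) = 0" by auto
  then have r: "a + b * Re w + d * ((Re w)\<^sup>2 - (Im w)\<^sup>2) = 0" and "Im w * (b + 2 * d * Re w) = 0"
    by (simp_all add: quadratic_Re quadratic_Im algebra_simps)
  then have b: "b = - 2 * d * Re w" using assms(3) by simp
  then have a: "a = d * ((Re w)\<^sup>2 + (Im w)\<^sup>2)" using r by (simp add: algebra_simps power2_eq_square)
  have "b\<^sup>2 - 4 * a * d = - 4 * (d * Im w)\<^sup>2"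
    unfolding a b by (simp add: algebra_simps power2_eq_square)
  then have "(d * Im w)\<^sup>2 = 0" using assms(1) zero_le_power2[of "d * Im w"] by linarith
  then have "d = 0" using assms(3) by simp
  then show False using a b assms(2) by simp
qed

lemma quadratic_factor:
  assumes "b\<^sup>2 - 4 * a * d < 0"
  obtains w0 where "0 < Im w0" "d \<noteq> 0" "\<And>w. quadratic a b d w = of_real d * (w - w0) * (w - cnj w0)"
proof
  have d: "d \<noteq> 0" using assms by auto
  \<comment> \<open>The absolute value selects the root in the upper half plane for either sign of
    d.\<close>
  define w0 where "w0 = Complex (- b / (2 * d)) (sqrt (4 * a * d - b\<^sup>2) / (2 * \<bar>d\<bar>))"
  show "0 < Im w0" using assms d by (simp add: w0_def)
  show "d \<noteq> 0" by fact
  fix w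
  have im: "(Im w0)\<^sup>2 = (4 * a * d - b\<^sup>2) / (2 * d)\<^sup>2"
    using assms by (simp add: w0_def power_divide power_mult_distrib)
  have n: "w0 * cnj w0 = of_real (a / d)"
    unfolding complex_mult_cnj im using d
    by (simp add: w0_def field_simps power2_eq_square)
  have t: "w0 + cnj w0 = of_real (- b / d)"
    unfolding complex_add_cnj using d by (simp add: w0_def)
  have "of_real d * (w - w0) * (w - cnj w0) = of_real d * (w\<^sup>2 - (w0 + cnj w0) * w + w0 * cnj w0)"
    by (simp add: algebra_simps power2_eq_square)
  also have "\<dots> = quadratic a b d w"
    unfolding n t quadratic_def using d by (simp add: field_simps)
  finally show "quadratic a b d w = of_real d * (w - w0) * (w - cnj w0)" by simp
qed

context closed_curve
begin

lemma z_parts [simp]: "Re (z x) = p x" "Im (z x) = Y x" "Re (U x) = c x" "Im (U x) = s x"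
  by (simp_all add: z_def U_def)

lemma z_U_periodic: "z 1 = z 0" "U 1 = U 0"
  by (simp_all add: z_def U_def periodic)

lemma integral_along:
  assumes "\<And>x. x \<in> {0..1} \<Longrightarrow> (h has_field_derivative f (z x)) (at (z x))"
  shows "((\<lambda>x. f (z x) * (of_real (v x * Y x) * U x)) has_integral 0) {0..1}"
  by (rule integral_deriv_periodic[where F = "\<lambda>x. h (z x)"])
    (use has_vector_derivative_compose_field[OF z' assms] in \<open>auto simp: z_U_periodic\<close>)

text \<open>The real part of dz / q has the sign of the Euclidean inner product of q with the
  direction; this is how \<open>k^2\<close>, the inner product of the field with T, becomes visible
  in a complex line integral.\<close>

lemma Re_quotient: "Re (inverse w * (of_real (v x * Y x) * U x))
    = v x * Y x * (c x * Re w + s x * Im w) / (norm w)\<^sup>2"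
  by (simp add: complex_inverse cmod_power2 Re_divide field_simps)

text \<open>
  The logarithm of \<open>cnj U * q\<close> is periodic, so \<open>\<integral> q' dz / q\<close> is \<open>\<i>\<close> times the turning. With the zeros
  \<open>w0\<close> and \<open>cnj w0\<close> of \<open>q\<close>, both \<open>q' / q\<close> and \<open>1 / q\<close> are combinations of \<open>1 / (z - w0)\<close> and
  \<open>1 / (z - cnj w0)\<close>, and the second of these has no period.
\<close>

lemma no_positive_definite_field:
  assumes disc: "b\<^sup>2 - 4 * a * d < 0" and turn: "turning = 0"
    and pos: "\<And>x. x \<in> {0..1} \<Longrightarrow>
      0 < c x * Re (quadratic a b d (z x)) + s x * Im (quadratic a b d (z x))"
  shows False
proof -
  define q where "q = quadratic a b d"
  obtain w0 where w0: "0 < Im w0" "d \<noteq> 0" and fac: "\<And>w. q w = of_real d * (w - w0) * (w - cnj w0)"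
    using quadratic_factor[OF disc] unfolding q_def by metis
  have q0: "q (z x) \<noteq> 0" if "x \<in> {0..1}" for x using pos[OF that] by (auto simp: q_def)
  have nz: "z x \<noteq> w0" "z x \<noteq> cnj w0" if "x \<in> {0..1}" for x using q0[OF that] by (auto simp: fac)
  let ?dz = "\<lambda>x. of_real (v x * Y x) * U x"
  have Uc: "((\<lambda>x. cnj (U x)) has_vector_derivative - (\<i> * of_real ((k x - c x) * v x)) * cnj (U x)) (at x)" for x
    using has_vector_derivative_cnj[OF U'[of x]] by simp
  have nrm: "cnj (U x) \<noteq> 0" for x using unit[of x] by (auto simp: complex_eq_iff)
  have alg: "inverse (u * r) * (u * (D * e) + w * u * r) = w + D / r * e" if "u \<noteq> 0" "r \<noteq> 0" for u r D e w :: complex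
    using that by (simp add: field_simps)
  have "((\<lambda>x. - (\<i> * of_real ((k x - c x) * v x)) + (of_real b + 2 * of_real d * z x) / q (z x) * ?dz x)
      has_integral 0) {0..1}"
  proof (rule integral_deriv_periodic[where F = "\<lambda>x. Ln (cnj (U x) * q (z x))"])
    fix x :: real assume x: "x \<in> {0..1}"
    \<comment> \<open>The real part is the inner product of q with the direction. Being positive, it
      keeps the product off the branch cut: this is the homotopy between T and q.\<close>
    have r: "cnj (U x) * q (z x) \<notin> \<real>\<^sub>\<le>\<^sub>0"
      using pos[OF x] by (auto simp: q_def complex_nonpos_Reals_iff)
    have 1: "((\<lambda>x. q (z x)) has_vector_derivative (of_real b + 2 * of_real d * z x) * ?dz x) (at x)"
      unfolding q_def by (rule has_vector_derivative_compose_field[OF z' quadratic_deriv])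
    have 2: "((\<lambda>x. cnj (U x) * q (z x)) has_vector_derivative
        cnj (U x) * ((of_real b + 2 * of_real d * z x) * ?dz x) + - (\<i> * of_real ((k x - c x) * v x)) * cnj (U x) * q (z x)) (at x)"
      by (rule has_vector_derivative_mult[OF Uc[of x] 1])
    have 3: "((\<lambda>x. Ln (cnj (U x) * q (z x))) has_vector_derivative inverse (cnj (U x) * q (z x)) *
        (cnj (U x) * ((of_real b + 2 * of_real d * z x) * ?dz x) + - (\<i> * of_real ((k x - c x) * v x)) * cnj (U x) * q (z x))) (at x)"
      by (rule has_vector_derivative_compose_field[OF 2 has_field_derivative_Ln[OF r]])
    show "((\<lambda>x. Ln (cnj (U x) * q (z x))) has_vector_derivative
        - (\<i> * of_real ((k x - c x) * v x)) + (of_real b + 2 * of_real d * z x) / q (z x) * ?dz x) (at x)"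
      using 3 unfolding alg[OF nrm[of x] q0[OF x]] .
  qed (simp add: z_U_periodic)
  moreover have "((\<lambda>x. \<i> * of_real ((k x - c x) * v x)) has_integral \<i> * of_real turning) {0..1}"
    unfolding turning_def
    by (intro has_integral_mult_right has_integral_of_real integrable_integral
        integrable_continuous_real continuous_intros)
  ultimately have "((\<lambda>x. - (\<i> * of_real ((k x - c x) * v x)) + (of_real b + 2 * of_real d * z x) / q (z x) * ?dz x
      + \<i> * of_real ((k x - c x) * v x)) has_integral (0 + \<i> * of_real turning)) {0..1}"
    by (rule has_integral_add)
  then have I: "((\<lambda>x. (of_real b + 2 * of_real d * z x) / q (z x) * ?dz x) has_integral 0) {0..1}"
    using turn by simp
  have dq: "of_real b + 2 * of_real d * w = of_real d * (w - w0) + of_real d * (w - cnj w0)" for w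
  proof (rule DERIV_unique)
    show "(q has_field_derivative of_real b + 2 * of_real d * w) (at w)"
      unfolding q_def by (rule quadratic_deriv)
    have "q = (\<lambda>w. of_real d * (w - w0) * (w - cnj w0))" using fac by blast
    then show "(q has_field_derivative of_real d * (w - w0) + of_real d * (w - cnj w0)) (at w)"
      by (auto intro!: derivative_eq_intros simp: algebra_simps)
  qed
  have I2: "((\<lambda>x. inverse (z x - cnj w0) * ?dz x) has_integral 0) {0..1}"
  proof (rule integral_along[where h = "\<lambda>w. Ln (w - cnj w0)" and f = "\<lambda>w. inverse (w - cnj w0)"])
    fix x
    have "z x - cnj w0 \<notin> \<real>\<^sub>\<le>\<^sub>0"
      using w0 Y_pos[of x] by (auto simp: complex_nonpos_Reals_iff)
    then show "((\<lambda>w. Ln (w - cnj w0)) has_field_derivative inverse (z x - cnj w0)) (at (z x))"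
      by (auto intro!: derivative_eq_intros simp: field_simps)
  qed
  \<comment> \<open>q' / q is the sum of the two simple fractions. Subtracting twice the one with
    its pole in the lower half plane leaves their difference, which is d (w0 - cnj w0) / q.\<close>
  have "((\<lambda>x. (of_real b + 2 * of_real d * z x) / q (z x) * ?dz x - 2 * (inverse (z x - cnj w0) * ?dz x)) has_integral
     (0 - 2 * 0)) {0..1}"
    by (intro has_integral_diff has_integral_mult_right I I2)
  then have I3: "((\<lambda>x. ((of_real b + 2 * of_real d * z x) / q (z x) * ?dz x - 2 * (inverse (z x - cnj w0) * ?dz x))
      / (of_real d * (w0 - cnj w0))) has_integral (0 - 2 * 0) / (of_real d * (w0 - cnj w0))) {0..1}"
    by (rule has_integral_divide)
  have eq: "((of_real b + 2 * of_real d * z x) / q (z x) * ?dz x - 2 * (inverse (z x - cnj w0) * ?dz x))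
      / (of_real d * (w0 - cnj w0)) = inverse (q (z x)) * ?dz x" if x: "x \<in> {0..1}" for x
  proof -
    have part: "((e * A + e * B) / (e * A * B) - 2 * inverse B) / (e * (B - A)) = inverse (e * A * B)"
      if "e \<noteq> 0" "A \<noteq> 0" "B \<noteq> 0" "B \<noteq> A" for e A B :: complex
    proof -
      have "(e * A + e * B) / (e * A * B) - 2 * inverse B = (B - A) / (A * B)"
        using that by (simp add: field_simps)
      then show ?thesis using that by (simp add: inverse_eq_divide)
    qed
    have "w0 \<noteq> cnj w0" using w0 by (auto simp: complex_eq_iff)
    then have "((of_real d * (z x - w0) + of_real d * (z x - cnj w0)) / (of_real d * (z x - w0) * (z x - cnj w0))
        - 2 * inverse (z x - cnj w0)) / (of_real d * (w0 - cnj w0)) = inverse (of_real d * (z x - w0) * (z x - cnj w0))"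
      using nz[OF x] w0(2) part[of "of_real d" "z x - w0" "z x - cnj w0"] by simp
    moreover have "(X * e - 2 * (Y * e)) / D = (X - 2 * Y) / D * e" for X Y D e :: complex
      by (simp add: algebra_simps diff_divide_distrib)
    ultimately show ?thesis unfolding dq fac by (simp only:)
  qed
  have "((\<lambda>x. inverse (q (z x)) * ?dz x) has_integral 0) {0..1}"
    using has_integral_eq[OF eq I3] by simp
  from has_integral_Re[OF this]
  have "integral {0..1} (\<lambda>x. Re (inverse (q (z x)) * ?dz x)) = 0"
    by (simp add: integral_unique)
  moreover have "0 < integral {0..1} (\<lambda>x. Re (inverse (q (z x)) * ?dz x))"
  proof -
    have "integral {0..1} (\<lambda>_::real. 0) < integral {0..1} (\<lambda>x. Re (inverse (q (z x)) * ?dz x))"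
    proof (rule integral_less_real)
      have "continuous_on {0..1} z" "continuous_on {0..1} U"
        by (meson continuous_at_imp_continuous_on has_vector_derivative_continuous z' U')+
      then show "continuous_on {0..1} (\<lambda>x. Re (inverse (q (z x)) * ?dz x))"
        using q0 unfolding q_def quadratic_def by (intro continuous_intros ballI) auto
      show "0 < Re (inverse (q (z x)) * ?dz x)" if "x \<in> {0<..<1}" for x
        unfolding Re_quotient q_def using pos[of x] q0[of x] that
        by (auto intro!: divide_pos_pos mult_pos_pos v_pos Y_pos simp: q_def)
    qed auto
    then show ?thesis by simp
  qed
  ultimately show False by simp
qed

lemma indefinite_field_integral:
  assumes disc: "0 \<le> b\<^sup>2 - 4 * a * d" and nz: "(a, b, d) \<noteq> (0, 0, 0)"
  shows "((\<lambda>x. v x * Y x * (c x * Re (quadratic a b d (z x)) + s x * Im (quadratic a b d (z x)))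
    / (norm (quadratic a b d (z x)))\<^sup>2) has_integral 0) {0..1}"
proof -
  have cvx: "convex {w. Im w > 0}" "open {w. Im w > 0}"
    by (simp_all add: convex_halfspace_Im_gt open_halfspace_Im_gt)
  have "(\<lambda>w. inverse (quadratic a b d w)) holomorphic_on {w. Im w > 0}"
    using quadratic_nonzero[OF disc nz] unfolding quadratic_def[abs_def]
    by (intro holomorphic_intros) auto
  then obtain h where h: "\<And>w. w \<in> {w. Im w > 0} \<Longrightarrow>
      (h has_field_derivative inverse (quadratic a b d w)) (at w within {w. Im w > 0})"
    using holomorphic_convex_primitive'[OF cvx] by blast
  have "((\<lambda>x. inverse (quadratic a b d (z x)) * (of_real (v x * Y x) * U x)) has_integral 0) {0..1}"
  proof (rule integral_along[where h = h and f = "\<lambda>w. inverse (quadratic a b d w)"])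
    fix x
    have "z x \<in> {w. Im w > 0}" by (simp add: Y_pos)
    then show "(h has_field_derivative inverse (quadratic a b d (z x))) (at (z x))"
      using h at_within_open[OF _ cvx(2)] by metis
  qed
  from has_integral_Re[OF this] show ?thesis unfolding Re_quotient by simp
qed

end

section \<open>A lower bound for the gradient\<close>

context closed_curve
begin

lemma quadratic_near_killing:
  assumes R: "1 \<le> R" "Y x \<le> R" "\<bar>p x\<bar> \<le> R"
    and e: "\<bar>kA x - a\<bar> \<le> e" "\<bar>kB x - b\<bar> \<le> e" "\<bar>kC x - d\<bar> \<le> e"
  shows "\<bar>Re (quadratic a b d (z x)) - Y x * j1 x\<bar> \<le> 5 * R\<^sup>2 * e"
    and "\<bar>Im (quadratic a b d (z x)) - Y x * j2 x\<bar> \<le> 5 * R\<^sup>2 * e"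
proof -
  have e0: "0 \<le> e" using e(1) by linarith
  have R2: "1 \<le> R\<^sup>2" "R \<le> R\<^sup>2" using R(1) self_le_power[of R 2] by auto
  have Y: "\<bar>Y x\<bar> \<le> R" using R(2) Y_pos[of x] by simp
  have sq: "\<bar>(p x)\<^sup>2\<bar> \<le> R\<^sup>2" "\<bar>(Y x)\<^sup>2\<bar> \<le> R\<^sup>2" "\<bar>p x * Y x\<bar> \<le> R\<^sup>2"
    using mult_mono[OF R(3) R(3)] mult_mono[OF Y Y] mult_mono[OF R(3) Y] R(1)
    by (simp_all add: abs_mult power2_eq_square)
  have m: "\<bar>t * q\<bar> \<le> e * C" if "\<bar>t\<bar> \<le> e" "\<bar>q\<bar> \<le> C" for t q C
    using mult_mono[OF that] that e0 by (simp add: abs_mult)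
  have f: "e \<le> R\<^sup>2 * e" "e * R \<le> R\<^sup>2 * e" "0 \<le> R\<^sup>2 * e"
    using mult_right_mono[OF R2(1) e0] mult_right_mono[OF R2(2) e0] e0 by (simp_all add: mult.commute)
  define t1 t2 t3 t4 t5 t6 where "t1 = (kB x - b) * p x" and "t2 = (kC x - d) * (p x)\<^sup>2" and "t3 = (kC x - d) * (Y x)\<^sup>2"
    and "t4 = (kB x - b) * Y x" and "t5 = (kC x - d) * (p x * Y x)" and "t6 = kA x - a"
  have t: "\<bar>t1\<bar> \<le> e * R" "\<bar>t2\<bar> \<le> e * R\<^sup>2" "\<bar>t3\<bar> \<le> e * R\<^sup>2" "\<bar>t4\<bar> \<le> e * R" "\<bar>t5\<bar> \<le> e * R\<^sup>2" "\<bar>t6\<bar> \<le> e"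
    unfolding t1_def t2_def t3_def t4_def t5_def t6_def by (intro m e R sq Y)+
  have "Y x * j1 x - Re (quadratic a b d (z x)) = t6 + t1 + t2 - t3"
    unfolding killing_Re[symmetric] quadratic_Re t1_def t2_def t3_def t6_def
    by (simp add: algebra_simps)
  then show "\<bar>Re (quadratic a b d (z x)) - Y x * j1 x\<bar> \<le> 5 * R\<^sup>2 * e"
    using t f by (simp add: mult.commute)
  have "Y x * j2 x - Im (quadratic a b d (z x)) = t4 + 2 * t5"
    unfolding killing_Im[symmetric] quadratic_Im t4_def t5_def
    by (simp add: algebra_simps)
  then show "\<bar>Im (quadratic a b d (z x)) - Y x * j2 x\<bar> \<le> 5 * R\<^sup>2 * e"
    using t f by (simp add: mult.commute)
qed

text \<open>This transfers the sign and size of \<open>k^2\<close> from the varying field of the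
  curve to a fixed nearby polynomial, whose line integrals can be evaluated.\<close>

lemma quadratic_tangent_near:
  assumes R: "1 \<le> R" "Y x \<le> R" "\<bar>p x\<bar> \<le> R"
    and e: "\<bar>kA x - a\<bar> \<le> e" "\<bar>kB x - b\<bar> \<le> e" "\<bar>kC x - d\<bar> \<le> e"
  shows "\<bar>c x * Re (quadratic a b d (z x)) + s x * Im (quadratic a b d (z x)) - Y x * (k x)\<^sup>2\<bar> \<le> 10 * R\<^sup>2 * e"
proof -
  define A B where "A = Re (quadratic a b d (z x)) - Y x * j1 x" and "B = Im (quadratic a b d (z x)) - Y x * j2 x"
  have AB: "\<bar>A\<bar> \<le> 5 * R\<^sup>2 * e" "\<bar>B\<bar> \<le> 5 * R\<^sup>2 * e"
    using quadratic_near_killing[OF assms] by (auto simp: A_def B_def)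
  have "c x * Re (quadratic a b d (z x)) + s x * Im (quadratic a b d (z x)) - Y x * (k x)\<^sup>2 = c x * A + s x * B"
    unfolding j_tangent[symmetric] A_def B_def by (simp add: algebra_simps)
  moreover have "\<bar>c x * A\<bar> \<le> \<bar>A\<bar>" "\<bar>s x * B\<bar> \<le> \<bar>B\<bar>"
    using mult_right_mono[OF abs_cs(1)[of x] abs_ge_zero[of A]] mult_right_mono[OF abs_cs(2)[of x] abs_ge_zero[of B]]
    by (simp_all add: abs_mult)
  ultimately show ?thesis using AB by linarith
qed

end

text \<open>A predicate on the coefficients alone: the curve is hidden behind the quantifier,
  normalized to start at \<i>, and the smallness of its gradient is recorded as the closeness e of
  all its fields to one polynomial. This is what lets the compactness argument run on triples of
  reals.\<close>

definition near_field :: "real \<Rightarrow> real \<Rightarrow> real \<Rightarrow> real \<Rightarrow> real \<Rightarrow> real \<Rightarrow> bool" where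
  "near_field L E a b d e \<longleftrightarrow> (\<exists>p Y c s v k k1 k2. closed_curve p Y c s v k k1 k2 \<and>
     p 0 = 0 \<and> Y 0 = 1 \<and> closed_curve.len v \<le> L \<and> closed_curve.energy v k \<le> E \<and>
     closed_curve.turning c v k = 0 \<and>
     (\<forall>x\<in>{0..1}. \<bar>closed_curve.kA p Y c s k k1 x - a\<bar> \<le> e \<and>
       \<bar>closed_curve.kB p Y c s k k1 x - b\<bar> \<le> e \<and> \<bar>closed_curve.kC Y c s k k1 x - d\<bar> \<le> e))"

text \<open>One number dominating exp L and L exp L, hence Y, 1 / Y and |p|; the absolute values
  make it at least 1 for every real L.\<close>

definition radius :: "real \<Rightarrow> real" where "radius L = (1 + \<bar>L\<bar>) * exp \<bar>L\<bar>"

lemma radius_ge: "1 \<le> radius L" "exp \<bar>L\<bar> \<le> radius L" "\<bar>L\<bar> * exp \<bar>L\<bar> \<le> radius L"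
proof -
  have "1 * exp \<bar>L\<bar> \<le> (1 + \<bar>L\<bar>) * exp \<bar>L\<bar>" "\<bar>L\<bar> * exp \<bar>L\<bar> \<le> (1 + \<bar>L\<bar>) * exp \<bar>L\<bar>"
    by (intro mult_right_mono; simp)+
  moreover have "1 \<le> exp \<bar>L\<bar>" by simp
  ultimately show "1 \<le> radius L" "exp \<bar>L\<bar> \<le> radius L" "\<bar>L\<bar> * exp \<bar>L\<bar> \<le> radius L"
    unfolding radius_def by linarith+
qed

lemma (in closed_curve) radius_bounds:
  assumes "len \<le> L" "Y 0 = 1" "p 0 = 0" "x \<in> {0..1}"
  shows "Y x \<le> radius L" "1 / Y x \<le> radius L" "\<bar>p x\<bar> \<le> radius L" "1 / radius L \<le> Y x"
proof -
  have L: "\<bar>L\<bar> = L" using assms(1) len_pos by simp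
  note h = height_bounds[OF assms]
  show "Y x \<le> radius L" "\<bar>p x\<bar> \<le> radius L" using h radius_ge[of L] unfolding L by linarith+
  have "1 / Y x \<le> 1 / exp (-L)" using h(1) Y_pos[of x] by (intro divide_left_mono) auto
  also have "\<dots> = exp L" by (simp add: exp_minus divide_inverse)
  also have "\<dots> \<le> radius L" using radius_ge[of L] unfolding L by simp
  finally show 1: "1 / Y x \<le> radius L" .
  then show "1 / radius L \<le> Y x" using Y_pos[of x] radius_ge(1)[of L] by (simp add: field_simps)
qed

text \<open>The discriminants of the fields of the curve stay below -h/2. As they equal k^4 + 4 k1^2
  - 4 k^2, this forces k^2 to be at least h/8, so the inner product of the fixed polynomial with the
  direction is positive and \<open>no_positive_definite_field\<close> applies.\<close>

lemma not_near_negative: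
  assumes disc: "b\<^sup>2 - 4 * a * d < 0"
  shows "\<exists>e>0. \<not> near_field L E a b d e"
proof -
  define R where "R = radius L"
  define h where "h = 4 * a * d - b\<^sup>2"
  define K where "K = 2 * \<bar>b\<bar> + 1 + 4 * (\<bar>a\<bar> + \<bar>d\<bar> + 1)"
  have h: "0 < h" using disc by (simp add: h_def)
  have R: "1 \<le> R" by (simp add: R_def radius_ge)
  have K: "0 < K" by (simp add: K_def)
  \<comment> \<open>The bound 1 makes quadratic errors linear, h / (2 K) keeps the discriminant
    within h/2 of -h, and h / (100 R^3) keeps the error 10 R^2 e below the main term h / (8
    R).\<close>
  define e where "e = min 1 (min (h / (2 * K)) (h / (100 * R ^ 3)))"
  have e: "0 < e" "e \<le> 1" using h K R by (auto simp: e_def)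
  have eK: "e * K \<le> h / 2"
    using K mult_right_mono[of e "h / (2 * K)" K] by (simp add: e_def)
  have eR: "100 * R ^ 3 * e \<le> h"
    using R mult_left_mono[of e "h / (100 * R ^ 3)" "100 * R ^ 3"] by (simp add: e_def)
  have "\<not> near_field L E a b d e"
  proof
    assume "near_field L E a b d e"
    then obtain p Y c s v k k1 k2 where cc: "closed_curve p Y c s v k k1 k2"
      and n: "p 0 = 0" "Y 0 = 1" "closed_curve.len v \<le> L" and t: "closed_curve.turning c v k = 0"
      and near: "\<And>x. x \<in> {0..1} \<Longrightarrow> \<bar>closed_curve.kA p Y c s k k1 x - a\<bar> \<le> e"
       "\<And>x. x \<in> {0..1} \<Longrightarrow> \<bar>closed_curve.kB p Y c s k k1 x - b\<bar> \<le> e"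
       "\<And>x. x \<in> {0..1} \<Longrightarrow> \<bar>closed_curve.kC Y c s k k1 x - d\<bar> \<le> e"
      unfolding near_field_def by blast
    interpret closed_curve p Y c s v k k1 k2 by fact
    show False
    proof (rule no_positive_definite_field[OF disc t])
      fix x :: real assume x: "x \<in> {0..1}"
      note N = near[OF x]
      note b = radius_bounds[OF n(3,2,1) x, folded R_def]
      define \<alpha> \<beta> \<gamma> where "\<alpha> = kA x - a" and "\<beta> = kB x - b" and "\<gamma> = kC x - d"
      have N': "\<bar>\<alpha>\<bar> \<le> e" "\<bar>\<beta>\<bar> \<le> e" "\<bar>\<gamma>\<bar> \<le> e" using N by (simp_all add: \<alpha>_def \<beta>_def \<gamma>_def)
      have D: "(kB x)\<^sup>2 - 4 * kA x * kC x = - h + (2 * (\<beta> * b) + \<beta> * \<beta> - 4 * (\<alpha> * d) - 4 * (a * \<gamma>) - 4 * (\<alpha> * \<gamma>))"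
        unfolding \<alpha>_def \<beta>_def \<gamma>_def h_def by (simp add: algebra_simps power2_eq_square)
      have mm: "\<bar>u * w\<bar> \<le> e * C" if "\<bar>u\<bar> \<le> e" "\<bar>w\<bar> \<le> C" for u w C :: real
        using mult_mono[OF that] that e by (simp add: abs_mult)
      have B: "\<bar>\<beta> * b\<bar> \<le> e * \<bar>b\<bar>" "\<bar>\<beta> * \<beta>\<bar> \<le> e * 1" "\<bar>\<alpha> * d\<bar> \<le> e * \<bar>d\<bar>" "\<bar>a * \<gamma>\<bar> \<le> e * \<bar>a\<bar>" "\<bar>\<alpha> * \<gamma>\<bar> \<le> e * 1"
        using mm[OF N'(2) order_refl] mm[OF N'(2) order_trans[OF N'(2) e(2)]] mm[OF N'(1) order_refl]
          mm[OF N'(3) order_refl, of a] mm[OF N'(1) order_trans[OF N'(3) e(2)]] mult.commute[of a \<gamma>] by metis+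
      have eK': "e * K = 2 * (e * \<bar>b\<bar>) + e * 1 + 4 * (e * \<bar>a\<bar>) + 4 * (e * \<bar>d\<bar>) + 4 * (e * 1)"
        by (simp add: K_def algebra_simps)
      have "(kB x)\<^sup>2 - 4 * kA x * kC x \<le> - h / 2"
        using eK eK' D B[THEN abs_le_D1] B[THEN abs_le_D2] by linarith
      have "h / 2 \<le> 4 * (k x)\<^sup>2"
      proof -
        have "0 \<le> k x ^ 4" "0 \<le> (k1 x)\<^sup>2" by simp_all
        then show "h / 2 \<le> 4 * (k x)\<^sup>2"
          using \<open>(kB x)\<^sup>2 - 4 * kA x * kC x \<le> - h / 2\<close> unfolding killing_discriminant by linarith
      qed
      then have "h / 8 * (1 / R) \<le> (k x)\<^sup>2 * Y x"
        using h R b(4) by (intro mult_mono) auto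
      moreover have "10 * R\<^sup>2 * e < h / 8 * (1 / R)"
        using eR R h by (simp add: field_simps power2_eq_square power3_eq_cube)
      ultimately show "0 < c x * Re (quadratic a b d (z x)) + s x * Im (quadratic a b d (z x))"
        using quadratic_tangent_near[OF R b(1,3) N] by (simp add: mult.commute[of "Y x"])
    qed
  qed
  then show ?thesis using e by blast
qed

text \<open>For the zero polynomial, closeness says that Y k^2 is at most 10 R^2 e, so the energy is
  of order e; \<open>length_le_energy\<close> then pushes the length below
  \<open>min_length\<close>.\<close>

lemma not_near_zero:
  assumes E: "0 \<le> E"
  shows "\<exists>e>0. \<not> near_field L E 0 0 0 e"
proof -
  define R where "R = radius L"
  define m where "m = min_length E"
  define M where "M = exp (4 * L) * R ^ 3 * (\<bar>L\<bar> + 1)"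
  have R: "1 \<le> R" by (simp add: R_def radius_ge)
  have m: "0 < m" using min_length_pos[OF E] by (simp add: m_def)
  have M: "0 < M" using R by (simp add: M_def)
  \<comment> \<open>Chosen so that exp (4 L) times the energy is at most 10 M e = m/2, where m is
    the least possible length.\<close>
  define e where "e = m / (20 * M)"
  have e: "0 < e" using m M by (simp add: e_def)
  have "\<not> near_field L E 0 0 0 e"
  proof
    assume "near_field L E 0 0 0 e"
    then obtain p Y c s v k k1 k2 where cc: "closed_curve p Y c s v k k1 k2"
      and n: "p 0 = 0" "Y 0 = 1" "closed_curve.len v \<le> L" and En: "closed_curve.energy v k \<le> E"
      and near: "\<And>x. x \<in> {0..1} \<Longrightarrow> \<bar>closed_curve.kA p Y c s k k1 x - 0\<bar> \<le> e"
       "\<And>x. x \<in> {0..1} \<Longrightarrow> \<bar>closed_curve.kB p Y c s k k1 x - 0\<bar> \<le> e"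
       "\<And>x. x \<in> {0..1} \<Longrightarrow> \<bar>closed_curve.kC Y c s k k1 x - 0\<bar> \<le> e"
      unfolding near_field_def by blast
    interpret closed_curve p Y c s v k k1 k2 by fact
    have small: "(k x)\<^sup>2 \<le> 10 * R ^ 3 * e" if x: "x \<in> {0..1}" for x
    proof -
      note b = radius_bounds[OF n(3,2,1) x, folded R_def]
      have "Y x * (k x)\<^sup>2 \<le> 10 * R\<^sup>2 * e"
        using quadratic_tangent_near[OF R b(1,3) near[OF x]] by (simp add: quadratic_def)
      then have "Y x * (k x)\<^sup>2 * (1 / Y x) \<le> 10 * R\<^sup>2 * e * R"
        by (rule mult_mono[OF _ b(2)]) (use Y_pos[of x] e R in auto)
      then show ?thesis by (simp add: power2_eq_square power3_eq_cube mult_ac)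
    qed
    have "energy \<le> integral {0..1} (\<lambda>x. 10 * R ^ 3 * e * v x)"
      unfolding energy_def
      by (intro integral_mono_unit continuous_intros mult_right_mono small less_imp_le[OF v_pos])
    also have "\<dots> = 10 * R ^ 3 * e * len" by (simp add: len_def)
    also have "\<dots> \<le> 10 * R ^ 3 * e * (\<bar>L\<bar> + 1)"
      using n(3) R e by (intro mult_left_mono) auto
    finally have "exp (4 * L) * energy \<le> exp (4 * L) * (10 * R ^ 3 * e * (\<bar>L\<bar> + 1))"
      by (rule mult_left_mono) simp
    also have "\<dots> = 10 * (M * e)" by (simp add: M_def)
    also have "\<dots> = m / 2" using M by (simp add: e_def)
    finally show False
      using length_le_energy[OF n(3,2,1)] min_length_le[OF En] m by (simp add: m_def)
  qed
  then show ?thesis using e by blast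
qed

text \<open>The rectangle is compact and free of zeros. Below, \<mu> limits the error in the
  integral of dz / q, and \<nu> bounds its main term from below.\<close>

lemma quadratic_lower_bound:
  assumes disc: "0 \<le> b\<^sup>2 - 4 * a * d" and nz: "(a, b, d) \<noteq> (0, 0, 0)" and R: "1 \<le> R"
  obtains \<mu> \<nu> where "0 < \<mu>" "0 < \<nu>" "\<And>w. \<bar>Re w\<bar> \<le> R \<Longrightarrow> 1 / R \<le> Im w \<Longrightarrow> Im w \<le> R \<Longrightarrow>
    \<mu> \<le> (norm (quadratic a b d w))\<^sup>2 \<and> (norm (quadratic a b d w))\<^sup>2 \<le> \<nu>"
proof -
  define S where "S = cbox (Complex (-R) (1 / R)) (Complex R R)"
  have S: "w \<in> S \<longleftrightarrow> \<bar>Re w\<bar> \<le> R \<and> 1 / R \<le> Im w \<and> Im w \<le> R" for w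
    by (auto simp: S_def in_cbox_complex_iff)
  have cont: "continuous_on S (\<lambda>w. (norm (quadratic a b d w))\<^sup>2)"
    unfolding quadratic_def by (intro continuous_intros)
  have comp: "compact S" by (simp add: S_def)
  have "\<i> \<in> S" using R by (simp add: S)
  then have ne: "S \<noteq> {}" by blast
  obtain w1 where w1: "w1 \<in> S" "\<And>w. w \<in> S \<Longrightarrow> (norm (quadratic a b d w1))\<^sup>2 \<le> (norm (quadratic a b d w))\<^sup>2"
    using continuous_attains_inf[OF comp ne cont] by blast
  obtain w2 where w2: "w2 \<in> S" "\<And>w. w \<in> S \<Longrightarrow> (norm (quadratic a b d w))\<^sup>2 \<le> (norm (quadratic a b d w2))\<^sup>2"
    using continuous_attains_sup[OF comp ne cont] by blast
  have pos: "0 < (norm (quadratic a b d w))\<^sup>2" if "w \<in> S" for w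
  proof -
    have "0 < 1 / R" using R by simp
    also have "\<dots> \<le> Im w" using that S by blast
    finally show ?thesis using quadratic_nonzero[OF disc nz] by simp
  qed
  show ?thesis using that[OF pos[OF w1(1)] pos[OF w2(1)]] w1 w2 S by blast
qed

text \<open>The vanishing real part of the integral of dz / q is at least a multiple of the energy
  minus an error of order e, so the energy is of order e and the curve too short.\<close>

lemma not_near_nonnegative:
  assumes E: "0 \<le> E" and disc: "0 \<le> b\<^sup>2 - 4 * a * d" and nz: "(a, b, d) \<noteq> (0, 0, 0)"
  shows "\<exists>e>0. \<not> near_field L E a b d e"
proof -
  define R where "R = radius L"
  define m where "m = min_length E"
  have R: "1 \<le> R" by (simp add: R_def radius_ge)
  have m: "0 < m" using min_length_pos[OF E] by (simp add: m_def)
  obtain \<mu> \<nu> where mn: "0 < \<mu>" "0 < \<nu>" "\<And>w. \<bar>Re w\<bar> \<le> R \<Longrightarrow> 1 / R \<le> Im w \<Longrightarrow> Im w \<le> R \<Longrightarrow>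
    \<mu> \<le> (norm (quadratic a b d w))\<^sup>2 \<and> (norm (quadratic a b d w))\<^sup>2 \<le> \<nu>"
    using quadratic_lower_bound[OF disc nz R] by metis
  define M where "M = exp (4 * L) * (R\<^sup>2 * \<nu>) * (R * 10 * R\<^sup>2 / \<mu>) * (\<bar>L\<bar> + 1)"
  have M: "0 < M" using R mn by (simp add: M_def)
  define e where "e = m / (2 * M)"
  have e: "0 < e" using m M by (simp add: e_def)
  have "\<not> near_field L E a b d e"
  proof
    assume "near_field L E a b d e"
    then obtain p Y c s v k k1 k2 where cc: "closed_curve p Y c s v k k1 k2"
      and n: "p 0 = 0" "Y 0 = 1" "closed_curve.len v \<le> L" and En: "closed_curve.energy v k \<le> E"
      and near: "\<And>x. x \<in> {0..1} \<Longrightarrow> \<bar>closed_curve.kA p Y c s k k1 x - a\<bar> \<le> e"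
       "\<And>x. x \<in> {0..1} \<Longrightarrow> \<bar>closed_curve.kB p Y c s k k1 x - b\<bar> \<le> e"
       "\<And>x. x \<in> {0..1} \<Longrightarrow> \<bar>closed_curve.kC Y c s k k1 x - d\<bar> \<le> e"
      unfolding near_field_def by blast
    interpret closed_curve p Y c s v k k1 k2 by fact
    define F where "F x = v x * Y x * (c x * Re (quadratic a b d (z x)) + s x * Im (quadratic a b d (z x)))
        / (norm (quadratic a b d (z x)))\<^sup>2" for x
    have I: "(F has_integral 0) {0..1}"
      unfolding F_def by (rule indefinite_field_integral[OF disc nz])
    \<comment> \<open>The error per unit length: Y is at most R, the inner product is off by at most
      10 R^2 e, and |q|^2 is at least \<mu>.\<close>
    define \<delta> where "\<delta> = R * (10 * R\<^sup>2 * e) / \<mu>"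
    have low: "(k x)\<^sup>2 * v x / (R\<^sup>2 * \<nu>) - v x * \<delta> \<le> F x" if x: "x \<in> {0..1}" for x
    proof -
      note b = radius_bounds[OF n(3,2,1) x, folded R_def]
      define Q where "Q = (norm (quadratic a b d (z x)))\<^sup>2"
      have Q: "\<mu> \<le> Q" "Q \<le> \<nu>" using mn(3)[of "z x"] b by (auto simp: Q_def)
      have "Y x * (k x)\<^sup>2 - 10 * R\<^sup>2 * e \<le> c x * Re (quadratic a b d (z x)) + s x * Im (quadratic a b d (z x))"
        using quadratic_tangent_near[OF R b(1,3) near[OF x]] by linarith
      then have "v x * Y x * (Y x * (k x)\<^sup>2 - 10 * R\<^sup>2 * e) / Q \<le> F x"
        unfolding F_def Q_def using v_pos[of x] Y_pos[of x]
        by (intro divide_right_mono mult_left_mono) auto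
      moreover have "v x * Y x * (Y x * (k x)\<^sup>2 - 10 * R\<^sup>2 * e) / Q
          = (k x)\<^sup>2 * v x * ((Y x)\<^sup>2 / Q) - v x * (Y x * (10 * R\<^sup>2 * e) / Q)"
        by (simp add: algebra_simps power2_eq_square diff_divide_distrib)
      moreover have "(k x)\<^sup>2 * v x * (1 / (R\<^sup>2 * \<nu>)) \<le> (k x)\<^sup>2 * v x * ((Y x)\<^sup>2 / Q)"
      proof (rule mult_left_mono)
        have "(1 / R)\<^sup>2 / \<nu> \<le> (Y x)\<^sup>2 / Q"
          using b(4) Q mn R by (intro frac_le power_mono) auto
        then show "1 / (R\<^sup>2 * \<nu>) \<le> (Y x)\<^sup>2 / Q" by (simp add: power_divide)
      qed (use v_pos[of x] in auto)
      moreover have "v x * (Y x * (10 * R\<^sup>2 * e) / Q) \<le> v x * \<delta>"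
        unfolding \<delta>_def using v_pos[of x] Y_pos[of x] b(1) Q mn(1) e R
        by (intro mult_left_mono frac_le mult_right_mono) auto
      moreover have "(k x)\<^sup>2 * v x / (R\<^sup>2 * \<nu>) = (k x)\<^sup>2 * v x * (1 / (R\<^sup>2 * \<nu>))" by simp
      ultimately show ?thesis by linarith
    qed
    have J: "((\<lambda>x. (k x)\<^sup>2 * v x / (R\<^sup>2 * \<nu>) - v x * \<delta>) has_integral (energy / (R\<^sup>2 * \<nu>) - len * \<delta>)) {0..1}"
      unfolding energy_def len_def
      by (intro has_integral_diff has_integral_divide has_integral_mult_left integrable_integral
          integrable_continuous_real continuous_intros)
    have "energy / (R\<^sup>2 * \<nu>) - len * \<delta> \<le> 0"
      by (rule has_integral_le[OF J I low])
    then have "energy \<le> (R\<^sup>2 * \<nu>) * (len * \<delta>)" using R mn by (simp add: field_simps)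
    also have "\<dots> \<le> (R\<^sup>2 * \<nu>) * ((\<bar>L\<bar> + 1) * \<delta>)"
      using n(3) R e mn by (intro mult_left_mono mult_right_mono) (auto simp: \<delta>_def)
    finally have "exp (4 * L) * energy \<le> exp (4 * L) * ((R\<^sup>2 * \<nu>) * ((\<bar>L\<bar> + 1) * \<delta>))"
      by (rule mult_left_mono) simp
    also have "\<dots> = M * e" by (simp add: M_def \<delta>_def)
    also have "\<dots> = m / 2" using M by (simp add: e_def)
    finally show False
      using length_le_energy[OF n(3,2,1)] min_length_le[OF En] m by (simp add: m_def)
  qed
  then show ?thesis using e by blast
qed

section \<open>From a small gradient to a limit field\<close>

lemma near_field_shift:
  assumes "near_field L E a b d e" "\<bar>a - a'\<bar> \<le> e'" "\<bar>b - b'\<bar> \<le> e'" "\<bar>d - d'\<bar> \<le> e'"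
  shows "near_field L E a' b' d' (e + e')"
proof -
  have tri: "\<bar>u - a'\<bar> \<le> e + e'" if "\<bar>u - a\<bar> \<le> e" "\<bar>a - a'\<bar> \<le> e'" for u a a' :: real
    using that by linarith
  obtain p Y c s v k k1 k2 where cc: "closed_curve p Y c s v k k1 k2 \<and>
     p 0 = 0 \<and> Y 0 = 1 \<and> closed_curve.len v \<le> L \<and> closed_curve.energy v k \<le> E \<and>
     closed_curve.turning c v k = 0"
     and near: "\<And>x. x \<in> {0..1} \<Longrightarrow> \<bar>closed_curve.kA p Y c s k k1 x - a\<bar> \<le> e"
       "\<And>x. x \<in> {0..1} \<Longrightarrow> \<bar>closed_curve.kB p Y c s k k1 x - b\<bar> \<le> e"
       "\<And>x. x \<in> {0..1} \<Longrightarrow> \<bar>closed_curve.kC Y c s k k1 x - d\<bar> \<le> e"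
    using assms(1) unfolding near_field_def by blast
  show ?thesis
    unfolding near_field_def
    by (rule exI[of _ p], rule exI[of _ Y], rule exI[of _ c], rule exI[of _ s], rule exI[of _ v],
        rule exI[of _ k], rule exI[of _ k1], rule exI[of _ k2])
      (use cc near assms(2-4) tri in blast)
qed

text \<open>Horizontal translations and dilations are isometries that preserve Euclidean directions,
  so only the position changes.\<close>

lemma (in closed_curve) rescaled:
  "closed_curve (\<lambda>x. (p x - p 0) / Y 0) (\<lambda>x. Y x / Y 0) c s v k k1 k2"
proof
  fix x
  show "((\<lambda>x. (p x - p 0) / Y 0) has_real_derivative v x * (Y x / Y 0) * c x) (at x)"
    by (rule derivative_eq_intros derivs refl | simp)+
  show "((\<lambda>x. Y x / Y 0) has_real_derivative v x * (Y x / Y 0) * s x) (at x)"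
    by (rule derivative_eq_intros derivs refl | simp)+
  show "0 < Y x / Y 0" using Y_pos by simp
qed (use periodic unit v_pos cont_v cont_k2 c' s' k' k1' in auto)

text \<open>The field at parameter 0 serves as the fixed polynomial. Since the curve starts at \<i>,
  the bounds on \<open>k 0\<close> and \<open>k1 0\<close> bound its coefficients.\<close>

lemma (in closed_curve) near_own_field:
  assumes n: "Y 0 = 1" "p 0 = 0" and L: "len \<le> L" and E: "energy \<le> E" and t: "turning = 0"
    and G: "grad \<le> 1" "3 * radius L ^ 3 * sqrt (grad * L) \<le> e"
  defines "B \<equiv> 3 * (2 * curvature_bound E + 2 * (sqrt L + (curvature_bound E + 2) * sqrt (E * L)) + 2)"
  obtains a b d where "\<bar>a\<bar> \<le> B" "\<bar>b\<bar> \<le> B" "\<bar>d\<bar> \<le> B" "near_field L E a b d e"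
proof
  have 0: "(0::real) \<in> {0..1}" by simp
  define K K1 where "K = curvature_bound E" and "K1 = sqrt L + (curvature_bound E + 2) * sqrt (E * L)"
  have kb: "(k 0)\<^sup>2 \<le> K" "\<bar>k1 0\<bar> \<le> K1"
    using curvature_bounds[OF L E G(1) 0] by (auto simp: K_def K1_def)
  have ab: "\<bar>(k 0)\<^sup>2 * c 0\<bar> \<le> K" "\<bar>(k 0)\<^sup>2 * s 0\<bar> \<le> K" "\<bar>k1 0 * s 0\<bar> \<le> K1" "\<bar>k1 0 * c 0\<bar> \<le> K1"
    using mult_mono[OF kb(1) abs_cs(1)[of 0]] mult_mono[OF kb(1) abs_cs(2)[of 0]]
      mult_mono[OF kb(2) abs_cs(1)[of 0]] mult_mono[OF kb(2) abs_cs(2)[of 0]] kb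
      order_trans[OF zero_le_power2 kb(1)]
    by (simp_all add: abs_mult)
  have k: "\<bar>k 0\<bar> \<le> K + 1"
  proof -
    have "0 \<le> (\<bar>k 0\<bar> - 1)\<^sup>2" by simp
    then have "2 * \<bar>k 0\<bar> \<le> (k 0)\<^sup>2 + 1" by (simp add: power2_diff)
    then show ?thesis using kb(1) by linarith
  qed
  have j: "\<bar>j1 0\<bar> \<le> K + 2 * K1" "\<bar>j2 0\<bar> \<le> K + 2 * K1"
    using ab unfolding j1_def j2_def by linarith+
  have C: "kC 0 = k 0 - j1 0 / 2" by (simp add: kC_def n field_simps)
  have B: "B = 3 * (2 * K + 2 * K1 + 2)" by (simp add: B_def K_def K1_def)
  have pos: "0 \<le> K" "0 \<le> K1" using kb order_trans[OF zero_le_power2 kb(1)] by linarith+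

  \<comment> \<open>At the base point the coefficients are kC = k - j1 / 2, kB = j2 and kA = j1 +
    kC.\<close>
  show "\<bar>kA 0\<bar> \<le> B" unfolding kA_def kB_def C B using k j pos n by simp
  show "\<bar>kB 0\<bar> \<le> B" unfolding kB_def B using k j pos n by simp
  show "\<bar>kC 0\<bar> \<le> B" unfolding C B using k j(1) pos abs_triangle_ineq4[of "k 0" "j1 0 / 2"] by simp

  have osc: "\<bar>kA x - kA 0\<bar> \<le> e \<and> \<bar>kB x - kB 0\<bar> \<le> e \<and> \<bar>kC x - kC 0\<bar> \<le> e" if x: "x \<in> {0..1}" for x
    using killing_oscillation[OF order_refl L radius_ge(1)[of L] _ x] radius_bounds[OF L n] G(2)
    by (meson order_trans)
  show "near_field L E (kA 0) (kB 0) (kC 0) e"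
    unfolding near_field_def
    by (rule exI[of _ p], rule exI[of _ Y], rule exI[of _ c], rule exI[of _ s], rule exI[of _ v],
        rule exI[of _ k], rule exI[of _ k1], rule exI[of _ k2])
      (use closed_curve_axioms n L E t osc in blast)
qed

lemma not_near_field: "0 \<le> E \<Longrightarrow> \<exists>e>0. \<not> near_field L E a b d e"
  using not_near_negative[of b a d L E] not_near_zero[of E L] not_near_nonnegative[of E b a d L] not_less
  by (metis Pair_inject)

text \<open>Without a gap there are curves whose fields are within 1 / (n + 1) of triples in a fixed
  cube; a limit point of these triples contradicts \<open>not_near_field\<close>.\<close>

theorem gradient_gap:
  assumes E: "0 \<le> E" and L: "0 \<le> L"
  obtains \<epsilon> where "0 < \<epsilon>" "\<And>p Y c s v k k1 k2. closed_curve p Y c s v k k1 k2 \<Longrightarrow>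
    closed_curve.len v \<le> L \<Longrightarrow> closed_curve.energy v k \<le> E \<Longrightarrow>
    closed_curve.turning c v k = 0 \<Longrightarrow> \<epsilon> < closed_curve.grad v k k2"
proof (rule ccontr)
  assume neg: "\<not> thesis"
  define B where "B = 3 * (2 * curvature_bound E + 2 * (sqrt L + (curvature_bound E + 2) * sqrt (E * L)) + 2)"
  define R where "R = 3 * radius L ^ 3"
  have R: "0 < R" using radius_ge(1)[of L] by (simp add: R_def)
  have "\<exists>t :: real \<times> real \<times> real. \<bar>fst t\<bar> \<le> B \<and> \<bar>fst (snd t)\<bar> \<le> B \<and> \<bar>snd (snd t)\<bar> \<le> B \<and>
      near_field L E (fst t) (fst (snd t)) (snd (snd t)) (1 / real (Suc n))" for n
  proof -
    define \<delta> where "\<delta> = 1 / real (Suc n)"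
    \<comment> \<open>Solves R sqrt (grad L) \<le> \<delta> for the gradient; L + 1 in the
      denominator covers L = 0.\<close>
    define \<epsilon> where "\<epsilon> = min 1 ((\<delta> / R)\<^sup>2 / (L + 1))"
    have \<delta>: "0 < \<delta>" by (simp add: \<delta>_def)
    have "0 < \<epsilon>" using \<delta> R L by (simp add: \<epsilon>_def)
    then have "\<not> (\<forall>p Y c s v k k1 k2. closed_curve p Y c s v k k1 k2 \<longrightarrow> closed_curve.len v \<le> L \<longrightarrow>
        closed_curve.energy v k \<le> E \<longrightarrow> closed_curve.turning c v k = 0 \<longrightarrow>
        \<epsilon> < closed_curve.grad v k k2)"
      using neg that by blast
    then obtain p Y c s v k k1 k2 where cc: "closed_curve p Y c s v k k1 k2"
      and b: "closed_curve.len v \<le> L" "closed_curve.energy v k \<le> E"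
        "closed_curve.turning c v k = 0" and "\<not> \<epsilon> < closed_curve.grad v k k2"
      by blast
    then have g: "closed_curve.grad v k k2 \<le> \<epsilon>" by simp
    interpret C: closed_curve p Y c s v k k1 k2 by fact
    interpret D: closed_curve "\<lambda>x. (p x - p 0) / Y 0" "\<lambda>x. Y x / Y 0" c s v k k1 k2
      by (rule C.rescaled)
    have "D.grad * L \<le> (\<delta> / R)\<^sup>2 / (L + 1) * (L + 1)"
      using g L D.grad_nonneg by (intro mult_mono) (auto simp: \<epsilon>_def)
    also have "\<dots> = (\<delta> / R)\<^sup>2" using L by simp
    finally have "sqrt (D.grad * L) \<le> \<delta> / R"
      using \<delta> R by (intro real_le_lsqrt) auto
    then have "R * sqrt (D.grad * L) \<le> \<delta>" using R by (simp add: field_simps)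
    then have g2: "3 * radius L ^ 3 * sqrt (D.grad * L) \<le> \<delta>" by (simp add: R_def)
    have g1: "D.grad \<le> 1" using g by (simp add: \<epsilon>_def)
    have D0: "Y 0 / Y 0 = 1" "(p 0 - p 0) / Y 0 = 0" by simp_all
    obtain a b d where "\<bar>a\<bar> \<le> B" "\<bar>b\<bar> \<le> B" "\<bar>d\<bar> \<le> B" "near_field L E a b d \<delta>"
      by (rule D.near_own_field[OF D0 b g1 g2, folded B_def])
    then show ?thesis by (intro exI[of _ "(a, b, d)"]) (simp add: \<delta>_def)
  qed
  then obtain T :: "nat \<Rightarrow> real \<times> real \<times> real" where T: "\<And>n. \<bar>fst (T n)\<bar> \<le> B"
      "\<And>n. \<bar>fst (snd (T n))\<bar> \<le> B" "\<And>n. \<bar>snd (snd (T n))\<bar> \<le> B"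
    and near: "\<And>n. near_field L E (fst (T n)) (fst (snd (T n))) (snd (snd (T n))) (1 / real (Suc n))"
    by metis
  have mem: "\<forall>n. T n \<in> cbox (-B, -B, -B) (B, B, B)"
  proof
    fix n
    show "T n \<in> cbox (-B, -B, -B) (B, B, B)"
      using T[of n] by (cases "T n") (auto simp: cbox_Pair_eq abs_le_iff)
  qed
  have "compact (cbox (-B, -B, -B) (B, B, B))" by (rule compact_cbox)
  then obtain l r where r: "strict_mono r" and l: "(T \<circ> r) \<longlonglongrightarrow> l"
    using mem unfolding compact_def by blast
  obtain a b d where abd: "l = (a, b, d)" by (cases l)
  obtain e where e: "0 < e" "\<not> near_field L E a b d e" using not_near_field[OF E] by blast
  have "eventually (\<lambda>n. dist ((T \<circ> r) n) l < e / 2) sequentially"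
    using tendstoD[OF l, of "e / 2"] e by simp
  moreover have "eventually (\<lambda>n. 1 / real (Suc n) < e / 2) sequentially"
    using order_tendstoD(2)[OF LIMSEQ_inverse_real_of_nat, of "e / 2"] e
    by (simp add: inverse_eq_divide)
  ultimately obtain n where n: "dist (T (r n)) l < e / 2" "1 / real (Suc n) < e / 2"
    using eventually_happens[OF eventually_conj] by fastforce
  have "1 / real (Suc (r n)) \<le> 1 / real (Suc n)"
    using seq_suble[OF r, of n] by (intro divide_left_mono) auto
  then have m: "1 / real (Suc (r n)) \<le> e / 2" using n by linarith
  have "\<bar>fst (T (r n)) - a\<bar> \<le> e / 2" "\<bar>fst (snd (T (r n))) - b\<bar> \<le> e / 2" "\<bar>snd (snd (T (r n))) - d\<bar> \<le> e / 2"
    using n(1) dist_fst_le[of "T (r n)" l] dist_snd_le[of "T (r n)" l]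
      dist_fst_le[of "snd (T (r n))" "snd l"] dist_snd_le[of "snd (T (r n))" "snd l"]
    by (auto simp: abd dist_real_def)
  \<comment> \<open>The shift may be as large as e minus the closeness already attained, which is at
    least e/2; the two then add up to exactly e.\<close>
  then have "near_field L E a b d (1 / real (Suc (r n)) + (e - 1 / real (Suc (r n))))"
    using m by (intro near_field_shift[OF near]) auto
  then show False using e by simp
qed

section \<open>Smooth functions of time and space\<close>

lemma Ck_on_SucI:
  assumes "\<And>x. x \<in> S \<Longrightarrow> (f has_derivative f' x) (at x within S)" "\<And>v. Ck_on k S (\<lambda>x. f' x v)"
  shows "Ck_on (Suc k) S f"
  using assms by auto

lemma Ck_on_SucE:
  assumes "Ck_on (Suc k) S f"
  obtains f' where "\<And>x. x \<in> S \<Longrightarrow> (f has_derivative f' x) (at x within S)"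
    "\<And>v. Ck_on k S (\<lambda>x. f' x v)"
  using assms by auto

lemma Ck_on_cong:
  assumes f: "Ck_on k S f" and eq: "\<And>x. x \<in> S \<Longrightarrow> f x = g x"
  shows "Ck_on k S g"
proof (cases k)
  case 0
  then show ?thesis using f eq continuous_on_cong[of S S f g] by simp
next
  case (Suc j)
  with f obtain f' where f': "\<And>x. x \<in> S \<Longrightarrow> (f has_derivative f' x) (at x within S)"
    "\<And>v. Ck_on j S (\<lambda>x. f' x v)" using Ck_on_SucE by metis
  have g': "(g has_derivative f' x) (at x within S)" if "x \<in> S" for x
    by (rule has_derivative_transform[OF that _ f'(1)[OF that]]) (simp add: eq)
  show ?thesis unfolding Suc by (rule Ck_on_SucI[OF g' f'(2)])
qed

lemma Ck_on_Suc_imp: "Ck_on (Suc k) S f \<Longrightarrow> Ck_on k S f"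
proof (induction k arbitrary: f)
  case 0
  from 0 obtain f' where "\<And>x. x \<in> S \<Longrightarrow> (f has_derivative f' x) (at x within S)"
    "\<And>v. Ck_on 0 S (\<lambda>x. f' x v)"
    by (rule Ck_on_SucE) (rule that)
  then show ?case by (auto simp: continuous_on_eq_continuous_within intro: has_derivative_continuous)
next
  case (Suc k)
  obtain f' where f': "\<And>x. x \<in> S \<Longrightarrow> (f has_derivative f' x) (at x within S)"
    "\<And>v. Ck_on (Suc k) S (\<lambda>x. f' x v)" by (rule Ck_on_SucE[OF Suc.prems(1)]) (rule that)
  show ?case by (rule Ck_on_SucI[OF f'(1) Suc.IH[OF f'(2)]])
qed

lemma Ck_on_imp_continuous: "Ck_on k S f \<Longrightarrow> continuous_on S f"
proof (induction k)
  case (Suc k)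
  then show ?case using Ck_on_Suc_imp by blast
qed simp

lemma Ck_on_const: "Ck_on k S (\<lambda>_. c)"
proof (induction k arbitrary: c)
  case (Suc k)
  show ?case by (rule Ck_on_SucI[OF has_derivative_const Suc])
qed simp

lemma Ck_on_linear:
  assumes "bounded_linear h"
  shows "Ck_on k S f \<Longrightarrow> Ck_on k S (\<lambda>x. h (f x))"
proof (induction k arbitrary: f)
  case 0
  then show ?case using assms by (simp add: bounded_linear.continuous_on)
next
  case (Suc k)
  obtain f' where f': "\<And>x. x \<in> S \<Longrightarrow> (f has_derivative f' x) (at x within S)"
    "\<And>v. Ck_on k S (\<lambda>x. f' x v)" by (rule Ck_on_SucE[OF Suc.prems(1)]) (rule that)
  show ?case
    by (rule Ck_on_SucI[OF bounded_linear.has_derivative[OF assms f'(1)] Suc.IH[OF f'(2)]])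
qed

lemma Ck_on_add:
  "Ck_on k S f \<Longrightarrow> Ck_on k S g \<Longrightarrow> Ck_on k S (\<lambda>x. f x + g x)"
proof (induction k arbitrary: f g)
  case 0
  then show ?case by (simp add: continuous_on_add)
next
  case (Suc k)
  obtain f' where f': "\<And>x. x \<in> S \<Longrightarrow> (f has_derivative f' x) (at x within S)"
    "\<And>v. Ck_on k S (\<lambda>x. f' x v)" by (rule Ck_on_SucE[OF Suc.prems(1)]) (rule that)
  obtain g' where g': "\<And>x. x \<in> S \<Longrightarrow> (g has_derivative g' x) (at x within S)"
    "\<And>v. Ck_on k S (\<lambda>x. g' x v)" by (rule Ck_on_SucE[OF Suc.prems(2)]) (rule that)
  show ?case
    by (rule Ck_on_SucI[OF has_derivative_add[OF f'(1) g'(1)] Suc.IH[OF f'(2) g'(2)]])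
qed

lemma Ck_on_bilinear:
  assumes b: "bounded_bilinear h"
  shows "Ck_on k S f \<Longrightarrow> Ck_on k S g \<Longrightarrow> Ck_on k S (\<lambda>x. h (f x) (g x))"
proof (induction k arbitrary: f g)
  case 0
  then show ?case using b by (simp add: bounded_bilinear.continuous_on)
next
  case (Suc k)
  note fg = Suc.prems[THEN Ck_on_Suc_imp]
  obtain f' where f': "\<And>x. x \<in> S \<Longrightarrow> (f has_derivative f' x) (at x within S)"
    "\<And>v. Ck_on k S (\<lambda>x. f' x v)" by (rule Ck_on_SucE[OF Suc.prems(1)]) (rule that)
  obtain g' where g': "\<And>x. x \<in> S \<Longrightarrow> (g has_derivative g' x) (at x within S)"
    "\<And>v. Ck_on k S (\<lambda>x. g' x v)" by (rule Ck_on_SucE[OF Suc.prems(2)]) (rule that)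
  show ?case
    by (rule Ck_on_SucI[OF bounded_bilinear.FDERIV[OF b f'(1) g'(1)]
        Ck_on_add[OF Suc.IH[OF fg(1) g'(2)] Suc.IH[OF f'(2) fg(2)]]])
qed

text \<open>The derivative of 1 / f is built from 1 / f and f' by products, so the induction closes
  with the product rule.\<close>

lemma Ck_on_inverse:
  fixes f :: "'a::euclidean_space \<Rightarrow> 'b::real_normed_field"
  shows "Ck_on k S f \<Longrightarrow> (\<And>x. x \<in> S \<Longrightarrow> f x \<noteq> 0) \<Longrightarrow> Ck_on k S (\<lambda>x. inverse (f x))"
proof (induction k)
  case 0
  then show ?case by (simp add: continuous_on_inverse)
next
  case (Suc k)
  have i: "Ck_on k S (\<lambda>x. inverse (f x))" by (rule Suc.IH[OF Ck_on_Suc_imp[OF Suc.prems(1)] Suc.prems(2)])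
  obtain f' where f': "\<And>x. x \<in> S \<Longrightarrow> (f has_derivative f' x) (at x within S)"
    "\<And>v. Ck_on k S (\<lambda>x. f' x v)" by (rule Ck_on_SucE[OF Suc.prems(1)]) (rule that)
  note m = bounded_bilinear_mult
  have "Ck_on k S (\<lambda>x. - (inverse (f x) * f' x v * inverse (f x)))" for v
    by (rule Ck_on_linear[OF bounded_linear_minus[OF bounded_linear_ident]
        Ck_on_bilinear[OF m Ck_on_bilinear[OF m i f'(2)] i]])
  from Ck_on_SucI[OF Deriv.has_derivative_inverse[OF Suc.prems(2) f'(1)] this] show ?case .
qed

lemma Ck_on_sqrt:
  fixes f :: "'a::euclidean_space \<Rightarrow> real"
  shows "Ck_on k S f \<Longrightarrow> (\<And>x. x \<in> S \<Longrightarrow> 0 < f x) \<Longrightarrow> Ck_on k S (\<lambda>x. sqrt (f x))"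
proof (induction k)
  case 0
  then show ?case by (simp add: continuous_on_real_sqrt)
next
  case (Suc k)
  have "Ck_on k S (\<lambda>x. sqrt (f x))" by (rule Suc.IH[OF Ck_on_Suc_imp[OF Suc.prems(1)] Suc.prems(2)])
  then have i: "Ck_on k S (\<lambda>x. inverse (sqrt (f x)))"
    by (rule Ck_on_inverse) (use Suc.prems(2) in force)
  obtain f' where f': "\<And>x. x \<in> S \<Longrightarrow> (f has_derivative f' x) (at x within S)"
    "\<And>v. Ck_on k S (\<lambda>x. f' x v)" by (rule Ck_on_SucE[OF Suc.prems(1)]) (rule that)
  note m = bounded_bilinear_mult
  have s1: "Ck_on k S (\<lambda>x. f' x v * (inverse (sqrt (f x)) * (1/2)))" for v
    by (rule Ck_on_bilinear[OF m f'(2) Ck_on_bilinear[OF m i Ck_on_const]])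
  have s2: "((\<lambda>x. sqrt (f x)) has_derivative (\<lambda>v. f' x v * (inverse (sqrt (f x)) * (1/2)))) (at x within S)"
    if "x \<in> S" for x
    using has_derivative_real_sqrt[OF Suc.prems(2)[OF that] f'(1)[OF that]]
    by (simp add: field_simps)
  show ?case by (rule Ck_on_SucI[OF s2 s1])
qed

named_theorems smooth_intros

lemma smooth_const[smooth_intros]: "smooth_on S (\<lambda>_. c)"
  and smooth_add[smooth_intros]: "smooth_on S f \<Longrightarrow> smooth_on S g \<Longrightarrow> smooth_on S (\<lambda>x. f x + g x)"
  by (simp_all add: smooth_on_def Ck_on_const Ck_on_add)

lemma smooth_minus[smooth_intros]: "smooth_on S f \<Longrightarrow> smooth_on S (\<lambda>x. - f x)"
  by (simp add: smooth_on_def Ck_on_linear[OF bounded_linear_minus[OF bounded_linear_ident]])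

lemma smooth_diff[smooth_intros]: "smooth_on S f \<Longrightarrow> smooth_on S g \<Longrightarrow> smooth_on S (\<lambda>x. f x - g x)"
  using smooth_add[of S f "\<lambda>x. - g x"] smooth_minus[of S g] by simp

lemma smooth_mult[smooth_intros]:
  fixes f g :: "_ \<Rightarrow> 'b::real_normed_algebra"
  shows "smooth_on S f \<Longrightarrow> smooth_on S g \<Longrightarrow> smooth_on S (\<lambda>x. f x * g x)"
  by (simp add: smooth_on_def Ck_on_bilinear[OF bounded_bilinear_mult])

lemma smooth_power[smooth_intros]:
  fixes f :: "_ \<Rightarrow> 'b::real_normed_algebra_1"
  shows "smooth_on S f \<Longrightarrow> smooth_on S (\<lambda>x. f x ^ n)"
  by (induction n) (auto intro!: smooth_intros)

lemma smooth_divide[smooth_intros]: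
  fixes f g :: "_ \<Rightarrow> 'b::real_normed_field"
  shows "smooth_on S f \<Longrightarrow> smooth_on S g \<Longrightarrow> (\<And>x. x \<in> S \<Longrightarrow> g x \<noteq> 0) \<Longrightarrow> smooth_on S (\<lambda>x. f x / g x)"
  unfolding divide_inverse
  by (rule smooth_mult) (auto simp: smooth_on_def intro: Ck_on_inverse)

lemma smooth_sqrt[smooth_intros]:
  "smooth_on S f \<Longrightarrow> (\<And>x. x \<in> S \<Longrightarrow> 0 < f x) \<Longrightarrow> smooth_on S (\<lambda>x. sqrt (f x))"
  by (simp add: smooth_on_def Ck_on_sqrt)

lemma smooth_Re[smooth_intros]: "smooth_on S f \<Longrightarrow> smooth_on S (\<lambda>x. Re (f x))"
  and smooth_Im[smooth_intros]: "smooth_on S f \<Longrightarrow> smooth_on S (\<lambda>x. Im (f x))"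
  by (simp_all add: smooth_on_def Ck_on_linear bounded_linear_Re bounded_linear_Im)

lemma smooth_imp_continuous: "smooth_on S f \<Longrightarrow> continuous_on S f"
  unfolding smooth_on_def using Ck_on_imp_continuous by blast

section \<open>Partial derivatives up to the initial time\<close>

definition spacetime :: "(real \<times> real) set" where "spacetime = {0..} \<times> UNIV"

text \<open>Derivatives within \<open>spacetime\<close> keep the partial derivatives smooth up to
  the initial time, so quantities of the initial curve are values at t = 0.\<close>

definition dx :: "(real \<times> real \<Rightarrow> 'a::real_normed_vector) \<Rightarrow> real \<times> real \<Rightarrow> 'a" where
  "dx F z = frechet_derivative F (at z within spacetime) (0, 1)"

definition dt :: "(real \<times> real \<Rightarrow> 'a::real_normed_vector) \<Rightarrow> real \<times> real \<Rightarrow> 'a" where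
  "dt F z = frechet_derivative F (at z within spacetime) (1, 0)"

lemma mem_spacetime [simp]: "(t, x) \<in> spacetime \<longleftrightarrow> 0 \<le> t" by (simp add: spacetime_def)

lemma derivative_within_spacetime:
  assumes "(F has_derivative F') (at z within spacetime)" "z \<in> spacetime"
  shows "frechet_derivative F (at z within spacetime) = F'"
proof (rule frechet_derivative_unique_within)
  show "(F has_derivative frechet_derivative F (at z within spacetime)) (at z within spacetime)"
    using assms(1) frechet_derivative_works differentiable_def by blast
  show "(F has_derivative F') (at z within spacetime)" by fact
  fix i :: "real \<times> real" and e :: real assume "i \<in> Basis" "0 < e"
  then show "\<exists>d. 0 < \<bar>d\<bar> \<and> \<bar>d\<bar> < e \<and> z + d *\<^sub>R i \<in> spacetime"
    \<comment> \<open>The increment is positive, hence admissible even at t = 0.\<close>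
    using assms(2) by (intro exI[of _ "e/2"]) (cases z, auto simp: spacetime_def Basis_prod_def)
qed

lemma smooth_on_spacetime_derivative:
  assumes "smooth_on spacetime F" "z \<in> spacetime"
  shows "(F has_derivative frechet_derivative F (at z within spacetime)) (at z within spacetime)"
proof -
  have "Ck_on (Suc 0) spacetime F" using assms by (simp only: smooth_on_def)
  then obtain F' where F': "\<And>x. x \<in> spacetime \<Longrightarrow> (F has_derivative F' x) (at x within spacetime)"
    "\<And>v. Ck_on 0 spacetime (\<lambda>x. F' x v)"
    by (rule Ck_on_SucE) (rule that)
  show ?thesis
    unfolding derivative_within_spacetime[OF F'(1)[OF assms(2)] assms(2)] by (rule F'(1)[OF assms(2)])
qed

lemma smooth_on_spacetime_frechet:
  assumes "smooth_on spacetime F"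
  shows "smooth_on spacetime (\<lambda>z. frechet_derivative F (at z within spacetime) v)"
  unfolding smooth_on_def
proof
  fix k
  have "Ck_on (Suc k) spacetime F" using assms by (simp only: smooth_on_def)
  then obtain F' where F': "\<And>x. x \<in> spacetime \<Longrightarrow> (F has_derivative F' x) (at x within spacetime)"
    "\<And>v. Ck_on k spacetime (\<lambda>x. F' x v)"
    by (rule Ck_on_SucE) (rule that)
  show "Ck_on k spacetime (\<lambda>z. frechet_derivative F (at z within spacetime) v)"
    by (rule Ck_on_cong[OF F'(2)]) (simp add: derivative_within_spacetime[OF F'(1)])
qed

lemma smooth_dx[smooth_intros]: "smooth_on spacetime F \<Longrightarrow> smooth_on spacetime (dx F)"
  and smooth_dt[smooth_intros]: "smooth_on spacetime F \<Longrightarrow> smooth_on spacetime (dt F)"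
  by (simp_all add: smooth_on_spacetime_frechet dx_def[abs_def] dt_def[abs_def])

lemma has_dx:
  assumes "smooth_on spacetime F" "0 \<le> t"
  shows "((\<lambda>x. F (t, x)) has_vector_derivative dx F (t, x)) (at x)"
proof -
  have "((\<lambda>x. F (t, x)) has_derivative (\<lambda>h. frechet_derivative F (at (t, x) within spacetime) (0, h))) (at x within UNIV)"
    by (rule has_derivative_in_compose2[where t = spacetime and g' = "\<lambda>z. frechet_derivative F (at z within spacetime)"])
      (use assms smooth_on_spacetime_derivative in \<open>auto intro!: derivative_eq_intros simp: spacetime_def\<close>)
  moreover have "frechet_derivative F (at (t, x) within spacetime) (0, h) = h *\<^sub>R dx F (t, x)" for h
    using linear_cmul[OF has_derivative_linear[OF smooth_on_spacetime_derivative[OF assms(1), of "(t, x)"]], of h "(0, 1)"] assms(2)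
    by (simp add: dx_def)
  ultimately show ?thesis by (simp add: has_vector_derivative_def)
qed

lemma has_dt:
  assumes "smooth_on spacetime F" "0 \<le> t"
  shows "((\<lambda>t. F (t, x)) has_vector_derivative dt F (t, x)) (at t within {0..})"
proof -
  have "((\<lambda>t. F (t, x)) has_derivative (\<lambda>h. frechet_derivative F (at (t, x) within spacetime) (h, 0))) (at t within {0..})"
    by (rule has_derivative_in_compose2[where t = spacetime and g' = "\<lambda>z. frechet_derivative F (at z within spacetime)"])
      (use assms smooth_on_spacetime_derivative in \<open>auto intro!: derivative_eq_intros simp: spacetime_def\<close>)
  moreover have "frechet_derivative F (at (t, x) within spacetime) (h, 0) = h *\<^sub>R dt F (t, x)" for h
    using linear_cmul[OF has_derivative_linear[OF smooth_on_spacetime_derivative[OF assms(1), of "(t, x)"]], of h "(1, 0)"] assms(2)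
    by (simp add: dt_def)
  ultimately show ?thesis by (simp add: has_vector_derivative_def)
qed

lemma continuous_slice:
  assumes "smooth_on spacetime F" "0 \<le> t"
  shows "continuous_on A (\<lambda>x. F (t, x))"
  by (rule continuous_on_compose2[OF smooth_imp_continuous[OF assms(1)]])
    (use assms(2) in \<open>auto intro!: continuous_on_Pair\<close>)

lemma integral_has_dt:
  fixes F :: "real \<times> real \<Rightarrow> 'a::banach"
  assumes F: "smooth_on spacetime F" and t: "0 \<le> t"
  shows "((\<lambda>t. integral {a..b} (\<lambda>x. F (t, x))) has_vector_derivative integral {a..b} (\<lambda>x. dt F (t, x))) (at t within {0..})"
proof -
  have c: "continuous_on ({0..} \<times> {a..b}) (dt F)"
    using smooth_imp_continuous[OF smooth_dt[OF F]] by (rule continuous_on_subset) (auto simp: spacetime_def)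
  show ?thesis
    using leibniz_rule_vector_derivative[where U = "{0..}" and f = "\<lambda>t x. F (t, x)" and fx = "\<lambda>t x. dt F (t, x)" and a = a and b = b and ?x0.0 = t]
      has_dt[OF F] t c continuous_slice[OF F]
    by (auto simp: integrable_continuous_real)
qed

lemma at_within_Ici_not_bot: "0 \<le> t \<Longrightarrow> at (t::real) within {0..} \<noteq> bot"
  using at_le[of "{t<..}" "{0..}" t] trivial_limit_at_right_real[of t]
  by (metis atLeast_iff bot.extremum_uniqueI greaterThan_iff less_imp_le order_trans subsetI)

text \<open>The time derivative of F (t, y) - F (t, a), the integral of \<open>dx F\<close>, is
  computed directly and under the integral sign; differentiating both results in y gives the claim,
  including at t = 0.\<close>

lemma dx_dt_commute:
  fixes F :: "real \<times> real \<Rightarrow> 'a::banach"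
  assumes F: "smooth_on spacetime F" and t: "0 \<le> t"
  shows "dt (dx F) (t, x) = dx (dt F) (t, x)"
proof -
  define a where "a = x - 1"
  have P: "smooth_on spacetime (dx F)" using F by (rule smooth_dx)
  have eq: "integral {a..y} (\<lambda>y. dt (dx F) (t, y)) = dt F (t, y) - dt F (t, a)" if "a \<le> y" for y
  proof (rule vector_derivative_unique_within)
    have "integral {a..y} (\<lambda>y. dx F (s, y)) = F (s, y) - F (s, a)" if "0 \<le> s" for s
      using fundamental_theorem_of_calculus[of a y "\<lambda>y. F (s, y)" "\<lambda>y. dx F (s, y)"] has_dx[OF F that] \<open>a \<le> y\<close>
      by (simp add: has_vector_derivative_at_within integral_unique)
    then show "((\<lambda>s. F (s, y) - F (s, a)) has_vector_derivative integral {a..y} (\<lambda>y. dt (dx F) (t, y))) (at t within {0..})"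
      using has_vector_derivative_transform[OF _ _ integral_has_dt[OF P t, of a y]] t by simp
    show "((\<lambda>s. F (s, y) - F (s, a)) has_vector_derivative dt F (t, y) - dt F (t, a)) (at t within {0..})"
      by (intro has_vector_derivative_diff has_dt F t)
    show "at t within {0..} \<noteq> bot" by (rule at_within_Ici_not_bot[OF t])
  qed
  have "((\<lambda>y. integral {a..y} (\<lambda>y. dt (dx F) (t, y))) has_vector_derivative dt (dx F) (t, x)) (at x within {a..x+1})"
    by (rule integral_has_vector_derivative)
      (auto simp: a_def intro!: continuous_slice smooth_dt P t)
  then have W: "((\<lambda>y. dt F (t, y) - dt F (t, a)) has_vector_derivative dt (dx F) (t, x)) (at x within {a..x+1})"
    by (rule has_vector_derivative_transform[rotated 2]) (use eq in \<open>auto simp: a_def\<close>)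
  have "x \<in> interior {a..x+1}" by (simp add: a_def)
  then have A: "((\<lambda>y. dt F (t, y) - dt F (t, a)) has_vector_derivative dt (dx F) (t, x)) (at x)"
    using W by (simp only: at_within_interior)
  have B: "((\<lambda>y. dt F (t, y) - dt F (t, a)) has_vector_derivative dx (dt F) (t, x) - 0) (at x)"
    by (intro has_vector_derivative_diff has_dx smooth_dt F t has_vector_derivative_const)
  show ?thesis using vector_derivative_unique_at[OF A B] by simp
qed

section \<open>First variation\<close>

lemma has_vector_derivative_quotient:
  fixes f g :: "real \<Rightarrow> 'a::real_normed_field"
  assumes "(f has_vector_derivative f') (at x within S)" "(g has_vector_derivative g') (at x within S)" "g x \<noteq> 0"
  shows "((\<lambda>x. f x / g x) has_vector_derivative (f' * g x - f x * g') / (g x)\<^sup>2) (at x within S)"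
  using has_derivative_divide'[OF assms(1,2)[unfolded has_vector_derivative_def] assms(3)]
  unfolding has_vector_derivative_def
  by (simp add: power2_eq_square scaleR_conv_of_real algebra_simps)

lemma has_dx_real:
  fixes F :: "real \<times> real \<Rightarrow> real"
  assumes "smooth_on spacetime F" "0 \<le> t"
  shows "((\<lambda>x. F (t, x)) has_real_derivative dx F (t, x)) (at x)"
  using has_dx[OF assms] by (simp add: has_real_derivative_iff_has_vector_derivative)

lemma dx_eqI:
  assumes "smooth_on spacetime F" "0 \<le> t" "((\<lambda>x. F (t, x)) has_vector_derivative d) (at x)"
  shows "dx F (t, x) = d"
  by (rule vector_derivative_unique_at[OF has_dx[OF assms(1,2)] assms(3)])

lemma dt_eqI:
  assumes "smooth_on spacetime F" "0 \<le> t" "((\<lambda>t. F (t, x)) has_vector_derivative d) (at t within {0..})"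
  shows "dt F (t, x) = d"
  by (rule vector_derivative_unique_within[OF at_within_Ici_not_bot[OF assms(2)] has_dt[OF assms(1,2)] assms(3)])

lemma dx_cong:
  assumes "smooth_on spacetime F" "smooth_on spacetime H" "0 \<le> t" "\<And>x. F (t, x) = H (t, x)"
  shows "dx F (t, x) = dx H (t, x)"
  using dx_eqI[OF assms(1,3)] has_dx[OF assms(2,3)] assms(4) by simp

lemma dx_periodic:
  assumes "smooth_on spacetime F" "0 \<le> t" "\<And>x. F (t, x + 1) = F (t, x)"
  shows "dx F (t, x + 1) = dx F (t, x)"
proof -
  have "((\<lambda>x. F (t, x + 1)) has_vector_derivative dx F (t, x + 1)) (at x)"
    using vector_diff_chain_at[of "\<lambda>x. x + 1" 1 x "\<lambda>x. F (t, x)" "dx F (t, x + 1)"] has_dx[OF assms(1,2)]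
    by (simp add: o_def has_vector_derivative_add_const)
  then show ?thesis using dx_eqI[OF assms(1,2)] assms(3) by simp
qed

lemma dt_periodic:
  assumes "smooth_on spacetime F" "0 \<le> t" "\<And>t x. 0 \<le> t \<Longrightarrow> F (t, x + 1) = F (t, x)"
  shows "dt F (t, x + 1) = dt F (t, x)"
proof (rule sym, rule dt_eqI[OF assms(1,2)])
  show "((\<lambda>t. F (t, x)) has_vector_derivative dt F (t, x + 1)) (at t within {0..})"
    by (rule has_vector_derivative_transform[OF _ _ has_dt[OF assms(1,2)]]) (use assms in auto)
qed

text \<open>A unit vector (a, b) / N turns: its derivative is the angular velocity (a b' - b a') /
  N^2 times (-b, a) / N. The factor N (a a' + b b') / N^2 is N'.\<close>

lemma direction_derivative:
  fixes a b a' b' N :: real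
  assumes N: "N \<noteq> 0" and sq: "N\<^sup>2 = a\<^sup>2 + b\<^sup>2"
  shows "(a' * N - a * (N * ((a * a' + b * b') / N\<^sup>2))) / (N * N) = - ((a * b' - b * a') / N\<^sup>2 * (b / N))"
    and "(b' * N - b * (N * ((a * a' + b * b') / N\<^sup>2))) / (N * N) = (a * b' - b * a') / N\<^sup>2 * (a / N)"
proof -
  have num: "a' * N\<^sup>2 - a * (a * a' + b * b') = - ((a * b' - b * a') * b)"
    "b' * N\<^sup>2 - b * (a * a' + b * b') = (a * b' - b * a') * a"
    unfolding sq by (simp_all add: algebra_simps power2_eq_square)
  have "(a' * N - a * (N * ((a * a' + b * b') / N\<^sup>2))) / (N * N) = (a' * N\<^sup>2 - a * (a * a' + b * b')) / N ^ 3"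
    "(b' * N - b * (N * ((a * a' + b * b') / N\<^sup>2))) / (N * N) = (b' * N\<^sup>2 - b * (a * a' + b * b')) / N ^ 3"
    using N by (simp_all add: field_simps power2_eq_square power3_eq_cube)
  then show "(a' * N - a * (N * ((a * a' + b * b') / N\<^sup>2))) / (N * N) = - ((a * b' - b * a') / N\<^sup>2 * (b / N))"
    "(b' * N - b * (N * ((a * a' + b * b') / N\<^sup>2))) / (N * N) = (a * b' - b * a') / N\<^sup>2 * (a / N)"
    unfolding num by (simp_all add: power2_eq_square power3_eq_cube)
qed

section \<open>Geometric quantities of a family of closed curves and their variation\<close>

locale evolution =
  fixes G :: "real \<times> real \<Rightarrow> complex"
  assumes smooth_G: "smooth_on spacetime G"
    and periodic_G: "0 \<le> t \<Longrightarrow> G (t, x + 1) = G (t, x)"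
    and height_pos: "0 \<le> t \<Longrightarrow> 0 < Im (G (t, x))"
    and regular: "0 \<le> t \<Longrightarrow> dx G (t, x) \<noteq> 0"
begin

definition "a z = Re (dx G z)"
definition "b z = Im (dx G z)"
definition "y z = Im (G z)"
definition "n z = sqrt ((a z)\<^sup>2 + (b z)\<^sup>2)"
definition "v z = n z / y z"
text \<open>The logarithmic derivative of \<open>dx G\<close>: its real part is that of ln n, its
  imaginary part the rate at which the direction turns.\<close>

definition "r z = dx (dx G) z / dx G z"
text \<open>The curvature density k v; a / y is the Christoffel contribution to the Euclidean
  turning.\<close>

definition "K z = Im (r z) + a z / y z"
definition "k z = K z / v z"
definition "k1 z = dx k z / v z"
definition "k2 z = dx k1 z / v z"
definition "g z = 2 * k2 z + k z ^ 3 - 2 * k z"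
definition "\<psi> z = - g z / v z"
text \<open>The space derivative of ln v.\<close>

definition "lam z = Re (r z) - b z / y z"
text \<open>The arclength derivative of the normal speed \<psi> v, as the space derivative of \<psi>
  v is v m.\<close>

definition "m z = dx \<psi> z + \<psi> z * lam z"

lemma positive:
  assumes z: "z \<in> spacetime"
  shows "dx G z \<noteq> 0" "0 < y z" "0 < (a z)\<^sup>2 + (b z)\<^sup>2" "0 < n z" "0 < v z"
proof -
  from z show 1: "dx G z \<noteq> 0" "0 < y z" using regular height_pos by (cases z, auto simp: y_def)+
  from 1(1) show 2: "0 < (a z)\<^sup>2 + (b z)\<^sup>2" by (simp add: a_def b_def complex_neq_0)
  then show 3: "0 < n z" by (simp add: n_def)
  show "0 < v z" using 1 3 by (simp add: v_def)
qed

lemma nonzero: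
  assumes "z \<in> spacetime"
  shows "y z \<noteq> 0" "n z \<noteq> 0" "v z \<noteq> 0"
  using positive[OF assms] by simp_all

lemma smooth_abyn: "smooth_on spacetime a" "smooth_on spacetime b" "smooth_on spacetime y" "smooth_on spacetime n"
  "smooth_on spacetime v" "smooth_on spacetime r" "smooth_on spacetime lam"
proof -
  show 1: "smooth_on spacetime a" "smooth_on spacetime b" "smooth_on spacetime y"
    unfolding a_def[abs_def] b_def[abs_def] y_def[abs_def] by (intro smooth_intros smooth_G)+
  show 2: "smooth_on spacetime n" unfolding n_def[abs_def] by (intro smooth_intros 1 positive)
  show "smooth_on spacetime v" unfolding v_def[abs_def] by (intro smooth_divide 1 2 nonzero)
  show 3: "smooth_on spacetime r" unfolding r_def[abs_def] by (intro smooth_divide smooth_dx smooth_G positive)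
  show "smooth_on spacetime lam" unfolding lam_def[abs_def]
    by (intro smooth_diff smooth_divide smooth_Re 1 3 nonzero)
qed

lemma smooth_k: "smooth_on spacetime K" "smooth_on spacetime k" "smooth_on spacetime k1" "smooth_on spacetime k2"
  "smooth_on spacetime g" "smooth_on spacetime \<psi>" "smooth_on spacetime m"
proof -
  note s = smooth_abyn
  show 1: "smooth_on spacetime K" unfolding K_def[abs_def] by (intro smooth_add smooth_divide smooth_Im s nonzero)
  show 2: "smooth_on spacetime k" unfolding k_def[abs_def] by (intro smooth_divide 1 s nonzero)
  show 3: "smooth_on spacetime k1" unfolding k1_def[abs_def] by (intro smooth_divide smooth_dx 2 s nonzero)
  show 4: "smooth_on spacetime k2" unfolding k2_def[abs_def] by (intro smooth_divide smooth_dx 3 s nonzero)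
  show 5: "smooth_on spacetime g" unfolding g_def[abs_def] by (intro smooth_intros 2 4)
  show 6: "smooth_on spacetime \<psi>" unfolding \<psi>_def[abs_def] by (intro smooth_divide smooth_minus 5 s nonzero)
  show "smooth_on spacetime m" unfolding m_def[abs_def] by (intro smooth_add smooth_mult smooth_dx 6 s)
qed

lemma Im_r: "z \<in> spacetime \<Longrightarrow> Im (r z) = (a z * Im (dx (dx G) z) - b z * Re (dx (dx G) z)) / (n z)\<^sup>2"
  and Re_r: "z \<in> spacetime \<Longrightarrow> Re (r z) = (a z * Re (dx (dx G) z) + b z * Im (dx (dx G) z)) / (n z)\<^sup>2"
  by (simp_all add: r_def Im_divide Re_divide n_def a_def b_def algebra_simps)

lemma n_square: "(n z)\<^sup>2 = (a z)\<^sup>2 + (b z)\<^sup>2" by (simp add: n_def)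

context
  fixes t :: real
  assumes t: "0 \<le> t"
begin

lemma slice: "(t, x) \<in> spacetime" using t by simp

lemma dx_a: "((\<lambda>x. a (t, x)) has_real_derivative Re (dx (dx G) (t, x))) (at x)"
  and dx_b: "((\<lambda>x. b (t, x)) has_real_derivative Im (dx (dx G) (t, x))) (at x)"
  and dx_y: "((\<lambda>x. y (t, x)) has_real_derivative b (t, x)) (at x)"
  and dx_p: "((\<lambda>x. Re (G (t, x))) has_real_derivative a (t, x)) (at x)"
  using has_dx[OF smooth_dx[OF smooth_G] t, of x] has_dx[OF smooth_G t, of x]
  by (simp_all add: has_vector_derivative_complex_iff a_def b_def y_def)

lemma dx_n: "((\<lambda>x. n (t, x)) has_real_derivative n (t, x) * Re (r (t, x))) (at x)"
proof -
  have "((\<lambda>x. (a (t, x))\<^sup>2 + (b (t, x))\<^sup>2) has_real_derivative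
      2 * a (t, x) * Re (dx (dx G) (t, x)) + 2 * b (t, x) * Im (dx (dx G) (t, x))) (at x)"
    by (rule derivative_eq_intros dx_a dx_b refl | simp)+
  from DERIV_chain2[OF DERIV_real_sqrt[OF positive(3)[OF slice]] this]
  have "((\<lambda>x. n (t, x)) has_real_derivative
     inverse (n (t, x)) / 2 * (2 * a (t, x) * Re (dx (dx G) (t, x)) + 2 * b (t, x) * Im (dx (dx G) (t, x)))) (at x)"
    by (simp only: n_def)
  moreover have "inverse (n (t, x)) / 2 * (2 * a (t, x) * Re (dx (dx G) (t, x)) + 2 * b (t, x) * Im (dx (dx G) (t, x)))
      = n (t, x) * Re (r (t, x))"
    using nonzero(2)[OF slice] unfolding Re_r[OF slice] by (simp add: field_simps power2_eq_square)
  ultimately show ?thesis by simp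
qed

lemma dx_v: "((\<lambda>x. v (t, x)) has_real_derivative v (t, x) * lam (t, x)) (at x)"
  unfolding v_def lam_def
  by (rule DERIV_cong[OF DERIV_divide[OF dx_n dx_y nonzero(1)[OF slice]]])
    (use nonzero(1)[OF slice] in \<open>simp add: field_simps\<close>)

lemma dx_k: "((\<lambda>x. k (t, x)) has_real_derivative k1 (t, x) * v (t, x)) (at x)"
  and dx_k1: "((\<lambda>x. k1 (t, x)) has_real_derivative k2 (t, x) * v (t, x)) (at x)"
  using has_dx_real[OF smooth_k(2) t, of x] has_dx_real[OF smooth_k(3) t, of x] nonzero(3)[OF slice]
  by (simp_all add: k1_def k2_def)

lemma turning_density: "(k (t, x) - a (t, x) / n (t, x)) * v (t, x) = Im (r (t, x))"
  using nonzero[OF slice, of x] by (simp add: k_def K_def v_def field_simps)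

lemma slice_periodic:
  "G (t, x + 1) = G (t, x)" "dx G (t, x + 1) = dx G (t, x)" "r (t, x + 1) = r (t, x)"
  "a (t, x + 1) = a (t, x)" "b (t, x + 1) = b (t, x)" "y (t, x + 1) = y (t, x)"
  "n (t, x + 1) = n (t, x)" "v (t, x + 1) = v (t, x)"
  "k (t, x + 1) = k (t, x)" "k1 (t, x + 1) = k1 (t, x)" "k2 (t, x + 1) = k2 (t, x)"
  "\<psi> (t, x + 1) = \<psi> (t, x)" "m (t, x + 1) = m (t, x)"
proof -
  show 0: "G (t, x + 1) = G (t, x)" for x by (rule periodic_G[OF t])
  show 1: "dx G (t, x + 1) = dx G (t, x)" for x by (rule dx_periodic[OF smooth_G t 0])
  show 2: "r (t, x + 1) = r (t, x)" for x
    using dx_periodic[OF smooth_dx[OF smooth_G] t 1] by (simp add: r_def 1)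
  show 3: "a (t, x + 1) = a (t, x)" "b (t, x + 1) = b (t, x)" "y (t, x + 1) = y (t, x)" for x
    by (simp_all add: a_def b_def y_def 0 1)
  show 4: "n (t, x + 1) = n (t, x)" for x by (simp add: n_def 3)
  show 5: "v (t, x + 1) = v (t, x)" for x by (simp add: v_def 3 4)
  show 6: "k (t, x + 1) = k (t, x)" for x by (simp add: k_def K_def 2 3 5)
  show 7: "k1 (t, x + 1) = k1 (t, x)" for x using dx_periodic[OF smooth_k(2) t 6] by (simp add: k1_def 5)
  show 8: "k2 (t, x + 1) = k2 (t, x)" for x using dx_periodic[OF smooth_k(3) t 7] by (simp add: k2_def 5)
  show 9: "\<psi> (t, x + 1) = \<psi> (t, x)" for x by (simp add: \<psi>_def g_def 5 6 8)
  show "m (t, x + 1) = m (t, x)" for x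
    using dx_periodic[OF smooth_k(6) t 9] by (simp add: m_def lam_def 2 3 9)
qed

lemma slice_curve: "closed_curve (\<lambda>x. Re (G (t, x))) (\<lambda>x. y (t, x)) (\<lambda>x. a (t, x) / n (t, x)) (\<lambda>x. b (t, x) / n (t, x))
  (\<lambda>x. v (t, x)) (\<lambda>x. k (t, x)) (\<lambda>x. k1 (t, x)) (\<lambda>x. k2 (t, x))"
proof
  fix x
  note nn = nonzero[OF slice, of x]
  show "((\<lambda>x. Re (G (t, x))) has_real_derivative v (t, x) * y (t, x) * (a (t, x) / n (t, x))) (at x)"
    using dx_p[of x] nn by (simp add: v_def)
  show "((\<lambda>x. y (t, x)) has_real_derivative v (t, x) * y (t, x) * (b (t, x) / n (t, x))) (at x)"
    using dx_y[of x] nn by (simp add: v_def)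
  show "((\<lambda>x. a (t, x) / n (t, x)) has_real_derivative
      - ((k (t, x) - a (t, x) / n (t, x)) * v (t, x) * (b (t, x) / n (t, x)))) (at x)"
    unfolding turning_density
    by (rule DERIV_cong[OF DERIV_divide[OF dx_a dx_n nn(2)]])
      (simp only: Re_r[OF slice] Im_r[OF slice] direction_derivative(1)[OF nn(2) n_square])
  show "((\<lambda>x. b (t, x) / n (t, x)) has_real_derivative
      (k (t, x) - a (t, x) / n (t, x)) * v (t, x) * (a (t, x) / n (t, x))) (at x)"
    unfolding turning_density
    by (rule DERIV_cong[OF DERIV_divide[OF dx_b dx_n nn(2)]])
      (simp only: Re_r[OF slice] Im_r[OF slice] direction_derivative(2)[OF nn(2) n_square])
  show "((\<lambda>x. k (t, x)) has_real_derivative k1 (t, x) * v (t, x)) (at x)" by (rule dx_k)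
  show "((\<lambda>x. k1 (t, x)) has_real_derivative k2 (t, x) * v (t, x)) (at x)" by (rule dx_k1)
  show "0 < v (t, x)" "0 < y (t, x)" using positive[OF slice] by auto
  show "(a (t, x) / n (t, x))\<^sup>2 + (b (t, x) / n (t, x))\<^sup>2 = 1"
  proof -
    have "(a (t, x) / n (t, x))\<^sup>2 + (b (t, x) / n (t, x))\<^sup>2 = (n (t, x))\<^sup>2 / (n (t, x))\<^sup>2"
      unfolding power_divide n_square by (rule add_divide_distrib[symmetric])
    then show ?thesis using nn(2) by simp
  qed
next
  show "continuous_on UNIV (\<lambda>x. v (t, x))" "continuous_on UNIV (\<lambda>x. k2 (t, x))"
    by (intro continuous_slice smooth_abyn smooth_k t)+
qed (use slice_periodic[of 0] in auto)

end

text \<open>The time derivative of the logarithm of \<open>dx G\<close>, just as \<open>r\<close> is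
  its space derivative; this is why \<open>dt r = dx q\<close>.\<close>

definition "q z = dx (dt G) z / dx G z"

lemma smooth_q: "smooth_on spacetime q"
  unfolding q_def[abs_def] by (intro smooth_divide smooth_dx smooth_dt smooth_G positive)

context
  fixes t :: real
  assumes t: "0 \<le> t"
begin

lemma dt_dx_G: "dt (dx G) (t, x) = dx (dt G) (t, x)"
  and dt_dx_dx_G: "dt (dx (dx G)) (t, x) = dx (dx (dt G)) (t, x)"
proof -
  show 1: "dt (dx G) (t, x) = dx (dt G) (t, x)" for x by (rule dx_dt_commute[OF smooth_G t])
  show "dt (dx (dx G)) (t, x) = dx (dx (dt G)) (t, x)"
    using dx_dt_commute[OF smooth_dx[OF smooth_G] t, of x]
      dx_cong[OF smooth_dt[OF smooth_dx[OF smooth_G]] smooth_dx[OF smooth_dt[OF smooth_G]] t 1, of x]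
    by simp
qed

lemma dt_r: "dt r (t, x) = dx q (t, x)"
proof -
  note s = slice[OF t]
  have "dt r (t, x) = (dt (dx (dx G)) (t, x) * dx G (t, x) - dx (dx G) (t, x) * dt (dx G) (t, x)) / (dx G (t, x))\<^sup>2"
    unfolding r_def
    by (rule dt_eqI[OF _ t])
      (use smooth_abyn(6) in \<open>auto simp: r_def[abs_def] intro!: has_vector_derivative_quotient has_dt smooth_dx smooth_G t positive s\<close>)
  moreover have "dx q (t, x) = (dx (dx (dt G)) (t, x) * dx G (t, x) - dx (dt G) (t, x) * dx (dx G) (t, x)) / (dx G (t, x))\<^sup>2"
    unfolding q_def
    by (rule dx_eqI[OF _ t])
      (use smooth_q in \<open>auto simp: q_def[abs_def] intro!: has_vector_derivative_quotient has_dx smooth_dx smooth_dt smooth_G t positive s\<close>)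
  ultimately show ?thesis by (simp add: dt_dx_G dt_dx_dx_G mult.commute)
qed

lemma q_periodic: "q (t, x + 1) = q (t, x)"
proof -
  have "dt G (t, x + 1) = dt G (t, x)" for x by (rule dt_periodic[OF smooth_G t periodic_G])
  from dx_periodic[OF smooth_dt[OF smooth_G] t this] show ?thesis
    by (simp add: q_def slice_periodic[OF t])
qed

end

text \<open>A conservation law of every smooth family of closed immersions: the time derivative of
  \<open>r\<close> is the space derivative of the periodic function \<open>q\<close>.\<close>

lemma turning_constant:
  assumes "0 \<le> t"
  shows "integral {0..1} (\<lambda>x. Im (r (t, x))) = integral {0..1} (\<lambda>x. Im (r (0, x)))"
proof -
  define R where "R z = Im (r z)" for z
  have R: "smooth_on spacetime R" unfolding R_def[abs_def] by (intro smooth_Im smooth_abyn)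
  have "((\<lambda>t. integral {0..1} (\<lambda>x. R (t, x))) has_vector_derivative 0) (at t within {0..})" if t: "0 \<le> t" for t
  proof -
    have "dt R (t, x) = Im (dx q (t, x))" for x
    proof (rule dt_eqI[OF R t])
      show "((\<lambda>t. R (t, x)) has_vector_derivative Im (dx q (t, x))) (at t within {0..})"
        unfolding R_def dt_r[OF t, symmetric]
        by (rule bounded_linear.has_vector_derivative[OF bounded_linear_Im has_dt[OF smooth_abyn(6) t]])
    qed
    moreover have "((\<lambda>x. Im (dx q (t, x))) has_integral 0) {0..1}"
      by (rule integral_deriv_periodic[where F = "\<lambda>x. Im (q (t, x))"])
        (use q_periodic[OF t, of 0] bounded_linear.has_vector_derivative[OF bounded_linear_Im has_dx[OF smooth_q t]] in auto)
    ultimately have "integral {0..1} (\<lambda>x. dt R (t, x)) = 0" by (simp add: integral_unique)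
    then show ?thesis using integral_has_dt[OF R t, of 0 1] by simp
  qed
  then obtain c where "\<And>t. t \<in> {0..} \<Longrightarrow> integral {0..1} (\<lambda>x. R (t, x)) = c"
    using has_vector_derivative_zero_constant[of "{0..}" "\<lambda>t. integral {0..1} (\<lambda>x. R (t, x))"] by auto
  then show ?thesis using assms by (simp add: R_def)
qed

end

text \<open>The normal velocity of the flow is \<open>-g = \<psi> v\<close>, and \<open>N = \<i> dx G / v\<close>.\<close>

locale elastic_evolution = evolution +
  assumes flow: "0 < t \<Longrightarrow> dt G (t, x) = \<i> * of_real (\<psi> (t, x)) * dx G (t, x)"
begin

context
  fixes t :: real
  assumes t: "0 < t"
begin

lemma t_nonneg: "0 \<le> t" using t by simp

lemma dx_dt_G: "dx (dt G) (t, x) = \<i> * of_real (dx \<psi> (t, x)) * dx G (t, x) + \<i> * of_real (\<psi> (t, x)) * dx (dx G) (t, x)"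
proof (rule dx_eqI[OF smooth_dt[OF smooth_G] t_nonneg])
  have "((\<lambda>x. \<i> * of_real (\<psi> (t, x)) * dx G (t, x)) has_vector_derivative
     \<i> * of_real (\<psi> (t, x)) * dx (dx G) (t, x) + \<i> * of_real (dx \<psi> (t, x)) * dx G (t, x)) (at x)"
    by (intro has_vector_derivative_mult has_vector_derivative_mult_right has_vector_derivative_of_real
      has_dx has_dx_real smooth_dx smooth_G smooth_k t_nonneg)
  then show "((\<lambda>x. dt G (t, x)) has_vector_derivative \<i> * of_real (dx \<psi> (t, x)) * dx G (t, x) + \<i> * of_real (\<psi> (t, x)) * dx (dx G) (t, x)) (at x)"
    by (simp add: flow[OF t] add.commute)
qed

lemma q_flow: "q (t, x) = \<i> * (of_real (dx \<psi> (t, x)) + of_real (\<psi> (t, x)) * r (t, x))"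
  using positive(1)[OF slice[OF t_nonneg]] by (simp add: q_def r_def dx_dt_G field_simps)

lemma Im_dt_r: "Im (dt r (t, x)) = dx (dx \<psi>) (t, x) + dx \<psi> (t, x) * Re (r (t, x)) + \<psi> (t, x) * Re (dx r (t, x))"
proof -
  have "((\<lambda>x. \<i> * (of_real (dx \<psi> (t, x)) + of_real (\<psi> (t, x)) * r (t, x))) has_vector_derivative
     \<i> * (of_real (dx (dx \<psi>) (t, x)) + (of_real (\<psi> (t, x)) * dx r (t, x) + of_real (dx \<psi> (t, x)) * r (t, x)))) (at x)"
    by (intro has_vector_derivative_mult has_vector_derivative_mult_right has_vector_derivative_add has_vector_derivative_of_real
      has_dx has_dx_real smooth_dx smooth_G smooth_k smooth_abyn t_nonneg)
  then have "dx q (t, x) = \<i> * (of_real (dx (dx \<psi>) (t, x)) + (of_real (\<psi> (t, x)) * dx r (t, x) + of_real (dx \<psi> (t, x)) * r (t, x)))"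
    by (intro dx_eqI[OF smooth_q t_nonneg]) (simp add: q_flow)
  then show ?thesis by (simp add: dt_r[OF t_nonneg])
qed

lemma dx_lam: "((\<lambda>x. lam (t, x)) has_real_derivative
    Re (dx r (t, x)) - (Im (dx (dx G) (t, x)) * y (t, x) - b (t, x) * b (t, x)) / (y (t, x) * y (t, x))) (at x)"
  unfolding lam_def
  by (intro DERIV_diff DERIV_divide dx_b dx_y t_nonneg nonzero slice)
    (use has_dx[OF smooth_abyn(6) t_nonneg] in \<open>simp add: has_vector_derivative_complex_iff\<close>)

lemma dx_m: "((\<lambda>x. m (t, x)) has_real_derivative dx (dx \<psi>) (t, x) + (dx \<psi> (t, x) * lam (t, x) + \<psi> (t, x) *
   (Re (dx r (t, x)) - (Im (dx (dx G) (t, x)) * y (t, x) - b (t, x) * b (t, x)) / (y (t, x) * y (t, x))))) (at x)"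
  unfolding m_def
  by (rule derivative_eq_intros has_dx_real smooth_dx smooth_k dx_lam t_nonneg refl | simp)+

lemma dt_a: "((\<lambda>t. a (t, x)) has_real_derivative Re (dx (dt G) (t, x))) (at t within {0..})"
  and dt_b: "((\<lambda>t. b (t, x)) has_real_derivative Im (dx (dt G) (t, x))) (at t within {0..})"
  and dt_y: "((\<lambda>t. y (t, x)) has_real_derivative Im (dt G (t, x))) (at t within {0..})"
  using has_dt[OF smooth_dx[OF smooth_G] t_nonneg, of x] has_dt[OF smooth_G t_nonneg, of x]
  by (simp_all add: has_vector_derivative_complex_iff a_def b_def y_def dt_dx_G[OF t_nonneg])

text \<open>With normal speed f = \<psi> v, this is the variation f'' - f of the density of k ds,
  primes being arclength derivatives. The terms k^2 f from the variations of k and of ds cancel, and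
  -f comes from the Gauss curvature -1.\<close>

lemma dt_K: "((\<lambda>t. K (t, x)) has_real_derivative dx m (t, x) - \<psi> (t, x) * (v (t, x))\<^sup>2) (at t within {0..})"
proof -
  note s = slice[OF t_nonneg] and nn = nonzero[OF slice[OF t_nonneg]]
  have D: "((\<lambda>t. K (t, x)) has_real_derivative Im (dt r (t, x)) +
      (Re (dx (dt G) (t, x)) * y (t, x) - a (t, x) * Im (dt G (t, x))) / (y (t, x) * y (t, x))) (at t within {0..})"
    unfolding K_def
    by (intro DERIV_add DERIV_divide dt_a dt_y nn)
      (use has_dt[OF smooth_abyn(6) t_nonneg] in \<open>simp add: has_vector_derivative_complex_iff\<close>)
  have M: "dx m (t, x) = dx (dx \<psi>) (t, x) + (dx \<psi> (t, x) * lam (t, x) + \<psi> (t, x) *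
   (Re (dx r (t, x)) - (Im (dx (dx G) (t, x)) * y (t, x) - b (t, x) * b (t, x)) / (y (t, x) * y (t, x))))"
    using DERIV_unique[OF has_dx_real[OF smooth_k(7) t_nonneg] dx_m] .
  have W: "Re (dx (dt G) (t, x)) = - (dx \<psi> (t, x) * b (t, x)) - \<psi> (t, x) * Im (dx (dx G) (t, x))"
    "Im (dt G (t, x)) = \<psi> (t, x) * a (t, x)"
    by (simp_all add: dx_dt_G flow[OF t] a_def b_def)
  have V: "(v (t, x))\<^sup>2 = ((a (t, x))\<^sup>2 + (b (t, x))\<^sup>2) / (y (t, x))\<^sup>2"
    by (simp add: v_def power_divide n_square)
  show ?thesis
    by (rule DERIV_cong[OF D], unfold Im_dt_r M W V lam_def)
      (use nn(1) in \<open>simp add: field_simps power2_eq_square\<close>)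
qed

text \<open>The arclength element shrinks at the rate k times the normal speed.\<close>

lemma dt_v: "((\<lambda>t. v (t, x)) has_real_derivative - \<psi> (t, x) * v (t, x) * K (t, x)) (at t within {0..})"
proof -
  note s = slice[OF t_nonneg] and nn = nonzero[OF slice[OF t_nonneg]]
  have W: "Re (dx (dt G) (t, x)) = - (dx \<psi> (t, x) * b (t, x)) - \<psi> (t, x) * Im (dx (dx G) (t, x))"
    "Im (dx (dt G) (t, x)) = dx \<psi> (t, x) * a (t, x) + \<psi> (t, x) * Re (dx (dx G) (t, x))"
    "Im (dt G (t, x)) = \<psi> (t, x) * a (t, x)"
    by (simp_all add: dx_dt_G flow[OF t] a_def b_def)
  have "((\<lambda>t. (a (t, x))\<^sup>2 + (b (t, x))\<^sup>2) has_real_derivative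
      2 * a (t, x) * Re (dx (dt G) (t, x)) + 2 * b (t, x) * Im (dx (dt G) (t, x))) (at t within {0..})"
    by (rule derivative_eq_intros dt_a dt_b refl | simp)+
  from DERIV_chain2[OF DERIV_real_sqrt[OF positive(3)[OF s]] this]
  have "((\<lambda>t. n (t, x)) has_real_derivative
     inverse (n (t, x)) / 2 * (2 * a (t, x) * Re (dx (dt G) (t, x)) + 2 * b (t, x) * Im (dx (dt G) (t, x)))) (at t within {0..})"
    by (simp only: n_def)
  moreover have "inverse (n (t, x)) / 2 * (2 * a (t, x) * Re (dx (dt G) (t, x)) + 2 * b (t, x) * Im (dx (dt G) (t, x)))
      = - \<psi> (t, x) * n (t, x) * Im (r (t, x))"
    using nn(2) unfolding Im_r[OF s] W by (simp add: field_simps power2_eq_square)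
  ultimately have dn: "((\<lambda>t. n (t, x)) has_real_derivative - \<psi> (t, x) * n (t, x) * Im (r (t, x))) (at t within {0..})"
    by simp
  show ?thesis
    unfolding v_def K_def
    by (rule DERIV_cong[OF DERIV_divide[OF dn dt_y nn(1)]])
      (use nn in \<open>simp add: W field_simps power2_eq_square\<close>)
qed

lemma energy_derivative:
  "((\<lambda>t. integral {0..1} (\<lambda>x. (k (t, x))\<^sup>2 * v (t, x))) has_real_derivative
    - integral {0..1} (\<lambda>x. (g (t, x))\<^sup>2 * v (t, x))) (at t)"
proof -
  define F where "F z = (k z)\<^sup>2 * v z" for z
  have F: "smooth_on spacetime F" unfolding F_def[abs_def] by (intro smooth_mult smooth_power smooth_k smooth_abyn)
  have dF: "dt F (t, x) = 2 * k (t, x) * dx m (t, x) - 2 * k (t, x) * \<psi> (t, x) * (v (t, x))\<^sup>2 + k (t, x) ^ 3 * \<psi> (t, x) * (v (t, x))\<^sup>2" for x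
  proof (rule dt_eqI[OF F t_nonneg])
    note s = slice[OF t_nonneg] and nn = nonzero[OF slice[OF t_nonneg]]
    \<comment> \<open>The energy density k^2 v is written as K^2 / v, since K and v have simple
      variations.\<close>
    have "((\<lambda>t. (K (t, x))\<^sup>2 / v (t, x)) has_real_derivative
      (2 * K (t, x) * (dx m (t, x) - \<psi> (t, x) * (v (t, x))\<^sup>2) * v (t, x) - (K (t, x))\<^sup>2 * (- \<psi> (t, x) * v (t, x) * K (t, x))) / (v (t, x) * v (t, x)))
      (at t within {0..})"
      by (rule derivative_eq_intros dt_K dt_v nn refl | simp)+
    moreover have "(2 * K (t, x) * (dx m (t, x) - \<psi> (t, x) * (v (t, x))\<^sup>2) * v (t, x) - (K (t, x))\<^sup>2 * (- \<psi> (t, x) * v (t, x) * K (t, x))) / (v (t, x) * v (t, x))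
      = 2 * k (t, x) * dx m (t, x) - 2 * k (t, x) * \<psi> (t, x) * (v (t, x))\<^sup>2 + k (t, x) ^ 3 * \<psi> (t, x) * (v (t, x))\<^sup>2"
      using nn(3) by (simp add: k_def field_simps power2_eq_square power3_eq_cube)
    moreover have "F (t, x) = (K (t, x))\<^sup>2 / v (t, x)" if "0 \<le> t" for t
      using nonzero(3)[OF slice[OF that]] by (simp add: F_def k_def power2_eq_square)
    ultimately show "((\<lambda>t. F (t, x)) has_vector_derivative 2 * k (t, x) * dx m (t, x) - 2 * k (t, x) * \<psi> (t, x) * (v (t, x))\<^sup>2
       + k (t, x) ^ 3 * \<psi> (t, x) * (v (t, x))\<^sup>2) (at t within {0..})"
      using has_vector_derivative_transform[of t "{0..}" "\<lambda>t. F (t, x)" "\<lambda>t. (K (t, x))\<^sup>2 / v (t, x)"] t_nonneg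
      by (simp add: has_real_derivative_iff_has_vector_derivative)
  qed
  have I0: "((\<lambda>x. dt F (t, x) + (g (t, x))\<^sup>2 * v (t, x)) has_integral 0) {0..1}"
  proof (rule integral_deriv_periodic)
    fix x
    note nn = nonzero(3)[OF slice[OF t_nonneg], of x]
    \<comment> \<open>Two integrations by parts at once: 2 k m moves one derivative onto k, and 2 k1
      v \<psi> moves the second. What remains is \<psi> v^2 (2 k2 + k^3 - 2 k) = -g^2 v.\<close>
    have "((\<lambda>x. 2 * k (t, x) * m (t, x) - 2 * k1 (t, x) * (v (t, x) * \<psi> (t, x))) has_real_derivative
       2 * (k1 (t, x) * v (t, x)) * m (t, x) + 2 * k (t, x) * dx m (t, x)
       - (2 * (k2 (t, x) * v (t, x)) * (v (t, x) * \<psi> (t, x)) + 2 * k1 (t, x) * (v (t, x) * lam (t, x) * \<psi> (t, x) + v (t, x) * dx \<psi> (t, x)))) (at x)"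
      by (rule derivative_eq_intros dx_k dx_k1 dx_v has_dx_real smooth_k t_nonneg refl | simp add: algebra_simps)+
    moreover have "\<psi> (t, x) * v (t, x) = - g (t, x)" using nn by (simp add: \<psi>_def)
    then have "(g (t, x))\<^sup>2 * v (t, x) = - (\<psi> (t, x) * v (t, x)) * g (t, x) * v (t, x)" by (simp add: power2_eq_square)
    then have "2 * (k1 (t, x) * v (t, x)) * m (t, x) + 2 * k (t, x) * dx m (t, x)
       - (2 * (k2 (t, x) * v (t, x)) * (v (t, x) * \<psi> (t, x)) + 2 * k1 (t, x) * (v (t, x) * lam (t, x) * \<psi> (t, x) + v (t, x) * dx \<psi> (t, x)))
       = dt F (t, x) + (g (t, x))\<^sup>2 * v (t, x)"
      unfolding dF g_def m_def by (simp add: algebra_simps power2_eq_square power3_eq_cube)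
    ultimately show "((\<lambda>x. 2 * k (t, x) * m (t, x) - 2 * k1 (t, x) * (v (t, x) * \<psi> (t, x))) has_vector_derivative
       dt F (t, x) + (g (t, x))\<^sup>2 * v (t, x)) (at x)"
      by (simp add: has_real_derivative_iff_has_vector_derivative)
  qed (use slice_periodic[OF t_nonneg, of 0] in simp)
  have I1: "((\<lambda>x. dt F (t, x) + (g (t, x))\<^sup>2 * v (t, x)) has_integral
      integral {0..1} (\<lambda>x. dt F (t, x)) + integral {0..1} (\<lambda>x. (g (t, x))\<^sup>2 * v (t, x))) {0..1}"
    by (intro has_integral_add integrable_integral integrable_continuous_real continuous_slice smooth_dt F t_nonneg
        continuous_on_mult continuous_on_power smooth_k smooth_abyn)
  have "integral {0..1} (\<lambda>x. dt F (t, x)) = - integral {0..1} (\<lambda>x. (g (t, x))\<^sup>2 * v (t, x))"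
    using has_integral_unique[OF I1 I0] by linarith
  then have "((\<lambda>t. integral {0..1} (\<lambda>x. F (t, x))) has_real_derivative
    - integral {0..1} (\<lambda>x. (g (t, x))\<^sup>2 * v (t, x))) (at t within {0..})"
    using integral_has_dt[OF F t_nonneg, of 0 1] by (simp add: has_real_derivative_iff_has_vector_derivative)
  moreover have "t \<in> interior {0..}" using t by (simp add: interior_Ici[of "-1"])
  ultimately show ?thesis unfolding F_def by (simp only: at_within_interior)
qed

end
end

context elastic_evolution
begin

lemma length_unbounded:
  assumes turn: "integral {0..1} (\<lambda>x. Im (r (0, x))) = 0"
  shows "\<not> bounded ((\<lambda>t. integral {0..1} (\<lambda>x. v (t, x))) ` {0..})"
proof
  assume "bounded ((\<lambda>t. integral {0..1} (\<lambda>x. v (t, x))) ` {0..})"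
  then obtain L where L: "\<And>t. 0 \<le> t \<Longrightarrow> \<bar>integral {0..1} (\<lambda>x. v (t, x))\<bar> \<le> L"
    by (auto simp: bounded_iff)
  define E where "E t = integral {0..1} (\<lambda>x. (k (t, x))\<^sup>2 * v (t, x))" for t
  define Q where "Q t = integral {0..1} (\<lambda>x. (g (t, x))\<^sup>2 * v (t, x))" for t
  have E': "(E has_real_derivative - Q t) (at t)" if "0 < t" for t
    unfolding E_def[abs_def] Q_def by (rule energy_derivative[OF that])
  have slice_len: "closed_curve.len (\<lambda>x. v (t, x)) = integral {0..1} (\<lambda>x. v (t, x))"
    and slice_energy: "closed_curve.energy (\<lambda>x. v (t, x)) (\<lambda>x. k (t, x)) = E t"
    and slice_grad: "closed_curve.grad (\<lambda>x. v (t, x)) (\<lambda>x. k (t, x)) (\<lambda>x. k2 (t, x)) = Q t"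
    and slice_turning: "closed_curve.turning (\<lambda>x. a (t, x) / n (t, x)) (\<lambda>x. v (t, x)) (\<lambda>x. k (t, x)) = 0"
    if t: "0 \<le> t" for t
  proof -
    interpret C: closed_curve "\<lambda>x. Re (G (t, x))" "\<lambda>x. y (t, x)" "\<lambda>x. a (t, x) / n (t, x)" "\<lambda>x. b (t, x) / n (t, x)"
      "\<lambda>x. v (t, x)" "\<lambda>x. k (t, x)" "\<lambda>x. k1 (t, x)" "\<lambda>x. k2 (t, x)"
      by (rule slice_curve[OF t])
    show "C.len = integral {0..1} (\<lambda>x. v (t, x))" by (simp add: C.len_def)
    show "C.energy = E t" by (simp add: C.energy_def E_def)
    show "C.grad = Q t" by (simp add: C.grad_def C.g_def Q_def g_def)
    show "C.turning = 0"
      using turning_constant[OF t] turn by (simp add: C.turning_def turning_density[OF t])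
  qed
  have E0: "0 \<le> E t" and Q0: "0 \<le> Q t" if "0 \<le> t" for t
    using closed_curve.energy_nonneg[OF slice_curve[OF that]] closed_curve.grad_nonneg[OF slice_curve[OF that]]
    by (simp_all add: slice_energy slice_grad that)
  have L0: "0 \<le> L" using L[of 0] by linarith
  \<comment> \<open>Time 1 is the starting point because the energy identity is available at
    positive times.\<close>
  have mono: "E t \<le> E 1" if "1 \<le> t" for t
  proof (rule DERIV_nonpos_imp_nonincreasing[OF that])
    show "\<exists>d. (E has_real_derivative d) (at u) \<and> d \<le> 0" if "1 \<le> u" for u :: real
      using E'[of u] Q0[of u] that by (intro exI[of _ "- Q u"]) auto
  qed
  obtain \<epsilon> where \<epsilon>: "0 < \<epsilon>" and gap: "\<And>p Y c s v k k1 k2. closed_curve p Y c s v k k1 k2 \<Longrightarrow>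
    closed_curve.len v \<le> L \<Longrightarrow> closed_curve.energy v k \<le> E 1 \<Longrightarrow>
    closed_curve.turning c v k = 0 \<Longrightarrow> \<epsilon> < closed_curve.grad v k k2"
    by (rule gradient_gap[OF E0[of 1] L0]) (simp, rule that)
  have Q: "\<epsilon> < Q t" if t: "1 \<le> t" for t
  proof -
    have t0: "0 \<le> t" using t by simp
    show ?thesis
      using gap[OF slice_curve[OF t0]] L[OF t0] mono[OF t]
      by (simp add: slice_len slice_energy slice_grad slice_turning t0)
  qed
  \<comment> \<open>At this time the decay at rate at least \<epsilon> from E 1 has brought the
    energy down to at most -1.\<close>
  define T where "T = 1 + (E 1 + 1) / \<epsilon>"
  have T: "1 \<le> T" using \<epsilon> E0[of 1] by (simp add: T_def)
  have "E T + \<epsilon> * T \<le> E 1 + \<epsilon> * 1"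
  proof (rule DERIV_nonpos_imp_nonincreasing[OF T])
    fix u :: real assume u: "1 \<le> u"
    have "((\<lambda>t. E t + \<epsilon> * t) has_real_derivative - Q u + \<epsilon>) (at u)"
      using u by (auto intro!: derivative_eq_intros E')
    then show "\<exists>d. ((\<lambda>t. E t + \<epsilon> * t) has_real_derivative d) (at u) \<and> d \<le> 0"
      using Q[OF u] by (intro exI[of _ "- Q u + \<epsilon>"]) auto
  qed
  moreover have "\<epsilon> * T = \<epsilon> + E 1 + 1" using \<epsilon> by (simp add: T_def field_simps)
  ultimately show False using E0[of T] T by simp
qed

end

section \<open>Agreement with the geometric definitions\<close>

context evolution
begin

context
  fixes t :: real and \<gamma> :: "real \<Rightarrow> complex"
  assumes t: "0 \<le> t" and \<gamma>: "\<And>x. \<gamma> x = G (t, x)"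
begin

lemma vderiv_slice: "smooth_on spacetime F \<Longrightarrow> vderiv (\<lambda>x. F (t, x)) x = dx F (t, x)"
  unfolding vderiv_def by (rule vector_derivative_at[OF has_dx[OF _ t]])

lemma slice_eq: "\<gamma> = (\<lambda>x. G (t, x))" using \<gamma> by blast

lemma vderiv_curve: "vderiv \<gamma> x = dx G (t, x)"
  unfolding slice_eq by (rule vderiv_slice[OF smooth_G])

lemma vderiv2_curve: "vderiv (vderiv \<gamma>) x = dx (dx G) (t, x)"
  unfolding vderiv_curve[abs_def] by (rule vderiv_slice[OF smooth_dx[OF smooth_G]])

lemma norm_vderiv: "norm (vderiv \<gamma> x) = n (t, x)"
  by (simp add: vderiv_curve cmod_def n_def a_def b_def)

lemma hyp_speed_slice: "hyp_speed \<gamma> x = v (t, x)"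
  using positive(2)[OF slice[OF t], of x]
  by (simp add: hyp_speed_def hyp_metric_def real_sqrt_divide norm_vderiv \<gamma> v_def flip: norm_eq_sqrt_inner)
    (simp add: y_def)

lemma hyp_length_slice: "hyp_length \<gamma> = integral {0..1} (\<lambda>x. v (t, x))"
  unfolding hyp_length_def hyp_speed_slice[abs_def] ..

lemma total_curvature_slice: "total_curvature \<gamma> = 1 / (2 * pi) * integral {0..1} (\<lambda>x. Im (r (t, x)))"
proof -
  have "euclid_curvature \<gamma> x * norm (vderiv \<gamma> x) = Im (r (t, x))" for x
    unfolding euclid_curvature_def norm_vderiv Im_r[OF slice[OF t]] vderiv2_curve
    using nonzero(2)[OF slice[OF t], of x]
    by (simp add: vderiv_curve a_def b_def power2_eq_square power3_eq_cube)
  then show ?thesis by (simp add: total_curvature_def)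
qed

lemma hyp_tangent_slice: "hyp_tangent \<gamma> x = dx G (t, x) / of_real (v (t, x))"
  by (simp add: hyp_tangent_def arc_deriv_def vderiv_curve hyp_speed_slice scaleR_conv_of_real field_simps)

text \<open>Logarithmic differentiation of T = dx G / v gives r - lam, and the Christoffel term adds
  \<i> dx G / y. The real part cancels, T having constant length, and \<i> K is left.\<close>

lemma nabla_slice: "nabla_T_T \<gamma> x = k (t, x) *\<^sub>R hyp_normal \<gamma> x"
proof -
  note s = slice[OF t, of x] and nn = nonzero[OF slice[OF t], of x] and G1 = positive(1)[OF slice[OF t], of x]
  have "((\<lambda>x. dx G (t, x) / of_real (v (t, x))) has_vector_derivative
     (dx (dx G) (t, x) * of_real (v (t, x)) - dx G (t, x) * of_real (v (t, x) * lam (t, x))) / (of_real (v (t, x)))\<^sup>2) (at x)"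
    by (intro has_vector_derivative_quotient has_dx smooth_dx smooth_G t has_vector_derivative_of_real dx_v)
      (use nn in auto)
  then have T: "vderiv (hyp_tangent \<gamma>) x =
     (dx (dx G) (t, x) * of_real (v (t, x)) - dx G (t, x) * of_real (v (t, x) * lam (t, x))) / (of_real (v (t, x)))\<^sup>2"
    unfolding vderiv_def hyp_tangent_slice[abs_def] by (rule vector_derivative_at)
  have "dx (dx G) (t, x) = r (t, x) * dx G (t, x)" using G1 by (simp add: r_def)
  then have "cov_deriv \<gamma> (hyp_tangent \<gamma>) x = dx G (t, x) / of_real (v (t, x)) *
      (r (t, x) - of_real (lam (t, x)) + \<i> * dx G (t, x) / of_real (y (t, x)))"
    unfolding cov_deriv_def T vderiv_curve hyp_tangent_slice using nn
    by (simp add: \<gamma> y_def[symmetric] field_simps power2_eq_square)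
  also have "r (t, x) - of_real (lam (t, x)) + \<i> * dx G (t, x) / of_real (y (t, x)) = \<i> * of_real (K (t, x))"
    using nn by (simp add: complex_eq_iff lam_def K_def a_def b_def Re_divide_of_real Im_divide_of_real)
  finally show ?thesis
    unfolding nabla_T_T_def hyp_normal_def hyp_tangent_slice hyp_speed_slice k_def using nn
    by (simp add: scaleR_conv_of_real field_simps)
qed

lemma elastic_gradient_slice:
  assumes ci: "closed_immersion \<gamma>"
  shows "elastic_gradient \<gamma> x = - (\<i> * of_real (\<psi> (t, x)) * dx G (t, x))"
proof -
  have N: "hyp_normal \<gamma> x \<noteq> 0" for x
    using positive(1)[OF slice[OF t], of x] nonzero[OF slice[OF t], of x] by (simp add: hyp_normal_def hyp_tangent_slice)
  have c: "hyp_curvature \<gamma> = (\<lambda>x. k (t, x))"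
  proof
    fix x
    have "hyp_curvature \<gamma> x *\<^sub>R hyp_normal \<gamma> x = k (t, x) *\<^sub>R hyp_normal \<gamma> x"
      by (rule trans[OF hyp_curvature[OF ci, symmetric] nabla_slice])
    then show "hyp_curvature \<gamma> x = k (t, x)" using N[of x] by simp
  qed
  have 1: "arc_deriv \<gamma> (\<lambda>x. k (t, x)) = (\<lambda>x. k1 (t, x))"
    by (rule ext) (simp add: arc_deriv_def hyp_speed_slice vderiv_slice[OF smooth_k(2)] k1_def divide_inverse)
  have 2: "arc_deriv \<gamma> (\<lambda>x. k1 (t, x)) x = k2 (t, x)"
    by (simp add: arc_deriv_def hyp_speed_slice vderiv_slice[OF smooth_k(3)] k2_def divide_inverse)
  show ?thesis
    unfolding elastic_gradient_def c 1 2 hyp_normal_def hyp_tangent_slice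
    using nonzero[OF slice[OF t], of x] by (simp add: g_def \<psi>_def scaleR_conv_of_real field_simps)
qed

end

end

lemma elastic_flow_imp_evolution:
  assumes "elastic_flow \<gamma>\<^sub>0 \<gamma>"
  shows "elastic_evolution (\<lambda>(t, x). \<gamma> t x)"
proof -
  let ?G = "\<lambda>(t, x). \<gamma> t x"
  have sm: "smooth_on spacetime ?G" and ci: "\<And>t. 0 \<le> t \<Longrightarrow> closed_immersion (\<gamma> t)"
    and fl: "\<And>t x. 0 < t \<Longrightarrow> ((\<lambda>s. \<gamma> s x) has_vector_derivative - elastic_gradient (\<gamma> t) x) (at t)"
    using assms by (auto simp: elastic_flow_def spacetime_def)
  interpret evolution ?G
  proof
    show "smooth_on spacetime ?G" by (rule sm)
    fix t x :: real assume t: "0 \<le> t"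
    show "?G (t, x + 1) = ?G (t, x)" "0 < Im (?G (t, x))" using ci[OF t] by (simp_all add: closed_immersion_def)
    have "vderiv (\<gamma> t) x = dx ?G (t, x)"
      using has_dx[OF sm t, of x] unfolding vderiv_def by (auto intro: vector_derivative_at)
    then show "dx ?G (t, x) \<noteq> 0" using ci[OF t] by (auto simp: closed_immersion_def)
  qed
  show ?thesis
  proof
    fix t x :: real assume t: "0 < t"
    have "((\<lambda>s. ?G (s, x)) has_vector_derivative - elastic_gradient (\<gamma> t) x) (at t within {0..})"
      using fl[OF t, of x] by (simp add: has_vector_derivative_at_within)
    then have "dt ?G (t, x) = - elastic_gradient (\<gamma> t) x"
      using t by (intro dt_eqI[OF sm]) auto
    also have "\<dots> = \<i> * of_real (\<psi> (t, x)) * dx ?G (t, x)"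
      using t by (subst elastic_gradient_slice[of t]) (auto intro: ci)
    finally show "dt ?G (t, x) = \<i> * of_real (\<psi> (t, x)) * dx ?G (t, x)" .
  qed
qed

lemma unbounded_length:
  assumes "elastic_flow \<gamma>\<^sub>0 \<gamma>" "total_curvature \<gamma>\<^sub>0 = 0"
  shows "\<not> bounded ((\<lambda>t. hyp_length (\<gamma> t)) ` {0..})"
proof -
  interpret elastic_evolution "\<lambda>(t, x). \<gamma> t x" by (rule elastic_flow_imp_evolution[OF assms(1)])
  have "\<gamma> 0 = \<gamma>\<^sub>0" using assms(1) by (simp add: elastic_flow_def)
  then have "integral {0..1} (\<lambda>x. Im (r (0, x))) = 0"
    using total_curvature_slice[of 0 "\<gamma> 0"] assms(2) by simp
  moreover have "hyp_length (\<gamma> t) = integral {0..1} (\<lambda>x. v (t, x))" if "0 \<le> t" for t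
    using hyp_length_slice[OF that, of "\<gamma> t"] by simp
  then have "(\<lambda>t. hyp_length (\<gamma> t)) ` {0..} = (\<lambda>t. integral {0..1} (\<lambda>x. v (t, x))) ` {0..}"
    by (intro image_cong) auto
  ultimately show ?thesis using length_unbounded by simp
qed

lemma length_continuous:
  assumes "elastic_flow \<gamma>\<^sub>0 \<gamma>"
  shows "continuous_on {0..} (\<lambda>t. hyp_length (\<gamma> t))"
proof -
  interpret elastic_evolution "\<lambda>(t, x). \<gamma> t x" by (rule elastic_flow_imp_evolution[OF assms])
  have eq: "hyp_length (\<gamma> t) = integral {0..1} (\<lambda>x. v (t, x))" if "t \<in> {0..}" for t
    using hyp_length_slice[of t "\<gamma> t"] that by simp
  have "continuous_on {0..} (\<lambda>t. integral {0..1} (\<lambda>x. v (t, x)))"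
    unfolding continuous_on_eq_continuous_within
    by (auto intro!: has_vector_derivative_continuous[OF integral_has_dt[OF smooth_abyn(5)]])
  then show ?thesis by (rule continuous_on_eq) (rule eq[symmetric])
qed

section \<open>Convergence bounds the length\<close>

lemma smooth_vderiv:
  assumes "smooth_on UNIV f"
  shows "(f has_vector_derivative vderiv f x) (at x)" "continuous_on A (vderiv f)"
proof -
  show "(f has_vector_derivative vderiv f x) (at x)"
    unfolding vderiv_def using smooth_on_imp(1)[OF assms] vector_derivative_works by blast
  show "continuous_on A (vderiv f)"
    using smooth_on_imp(2)[OF assms] differentiable_imp_continuous_within
    by (intro continuous_at_imp_continuous_on) blast
qed

lemma closed_immersion_speed:
  assumes "closed_immersion \<gamma>"
  shows "hyp_speed \<gamma> x = norm (vderiv \<gamma> x) / Im (\<gamma> x)" "continuous_on A (hyp_speed \<gamma>)"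
proof -
  have Y: "0 < Im (\<gamma> x)" for x using assms by (simp add: closed_immersion_def)
  show 1: "hyp_speed \<gamma> x = norm (vderiv \<gamma> x) / Im (\<gamma> x)" for x
    using Y[of x] by (simp add: hyp_speed_def hyp_metric_def real_sqrt_divide flip: norm_eq_sqrt_inner)
  have "continuous_on A \<gamma>"
    using assms smooth_imp_continuous[of UNIV \<gamma>] by (auto simp: closed_immersion_def intro: continuous_on_subset)
  then show "continuous_on A (hyp_speed \<gamma>)"
    unfolding 1[abs_def] using smooth_vderiv(2)[of \<gamma> A] assms Y
    by (intro continuous_on_divide continuous_on_norm continuous_on_Im)
      (auto simp: closed_immersion_def less_imp_neq[symmetric])
qed

text \<open>An antiderivative S of a periodic function grows by the same amount over every period,
  so S (\<phi> 1) - S (\<phi> 0) is S 1 - S 0.\<close>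

lemma periodic_integral_substitution:
  fixes f \<phi> \<phi>' :: "real \<Rightarrow> real"
  assumes f: "continuous_on UNIV f" "\<And>x. f (x + 1) = f x"
    and \<phi>: "\<And>x. (\<phi> has_real_derivative \<phi>' x) (at x)" "\<phi> 1 = \<phi> 0 + 1"
  shows "integral {0..1} (\<lambda>x. f (\<phi> x) * \<phi>' x) = integral {0..1} f"
proof -
  have c: "continuous_on {0..1} \<phi>"
    by (intro continuous_at_imp_continuous_on ballI DERIV_isCont[OF \<phi>(1)])
  have "bounded (\<phi> ` {0..1})" by (intro compact_imp_bounded compact_continuous_image c) simp
  then obtain B where "\<forall>y\<in>\<phi> ` {0..1}. norm y \<le> B" unfolding bounded_iff by blast
  then have B: "\<bar>\<phi> x\<bar> \<le> B" if "x \<in> {0..1}" for x using that by simp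
  \<comment> \<open>The margin 3 leaves room for the image of \<phi>, its shift by 1 and the unit
    interval inside the open interval where S is differentiable.\<close>
  define M where "M = \<bar>B\<bar> + 3"
  obtain S where S': "\<And>x. x \<in> {-M..M} \<Longrightarrow> (S has_vector_derivative f x) (at x within {-M..M})"
    using antiderivative_continuous[of "-M" M f] f(1) continuous_on_subset by blast
  have S: "(S has_real_derivative f x) (at x)" if "x \<in> {-M<..<M}" for x
    using S'[of x] that at_within_interior[of x "{-M..M}"]
    by (simp add: has_real_derivative_iff_has_vector_derivative)
  have shift: "S (x + 1) - S x = S 1 - S 0" if x: "x \<in> {-(M - 2)..M - 2}" for x
  proof -
    have "((\<lambda>x. S (x + 1) - S x) has_real_derivative 0) (at u)" if "u \<in> {-(M - 2)..M - 2}" for u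
      using DERIV_diff[OF DERIV_shift[THEN iffD1, OF S[of "u + 1"]] S[of u]] that f(2)[of u] by simp
    then have "((\<lambda>x. S (x + 1) - S x) has_vector_derivative 0) (at u within {-(M - 2)..M - 2})"
      if "u \<in> {-(M - 2)..M - 2}" for u
      using that by (simp add: has_real_derivative_iff_has_vector_derivative has_vector_derivative_at_within)
    then obtain c where "\<And>u. u \<in> {-(M - 2)..M - 2} \<Longrightarrow> S (u + 1) - S u = c"
      using has_vector_derivative_zero_constant[of "{-(M - 2)..M - 2}" "\<lambda>x. S (x + 1) - S x"] by auto
    from this[OF x] this[of 0] show ?thesis by (simp add: M_def)
  qed
  have B0: "0 \<le> B" using order_trans[OF abs_ge_zero B[of 0]] by simp
  have in1: "\<phi> x \<in> {-M<..<M}" "\<phi> x \<in> {-(M - 2)..M - 2}" if "x \<in> {0..1}" for x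
    using B[OF that] B0 by (auto simp: M_def abs_le_iff)
  have "((\<lambda>x. f (\<phi> x) * \<phi>' x) has_integral (S (\<phi> 1) - S (\<phi> 0))) {0..1}"
  proof (rule fundamental_theorem_of_calculus)
    fix x :: real assume "x \<in> {0..1}"
    then show "((\<lambda>x. S (\<phi> x)) has_vector_derivative f (\<phi> x) * \<phi>' x) (at x within {0..1})"
      using DERIV_chain2[OF S[OF in1(1)] \<phi>(1)]
      by (simp add: has_real_derivative_iff_has_vector_derivative has_vector_derivative_at_within)
  qed simp
  moreover have "(f has_integral (S 1 - S 0)) {0..1}"
  proof (rule fundamental_theorem_of_calculus)
    fix x :: real assume "x \<in> {0..1}"
    then have "(S has_real_derivative f x) (at x)" by (intro S) (auto simp: M_def)
    then show "(S has_vector_derivative f x) (at x within {0..1})"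
      by (simp add: has_real_derivative_iff_has_vector_derivative has_vector_derivative_at_within)
  qed simp
  moreover have "S (\<phi> 1) - S (\<phi> 0) = S 1 - S 0" using shift[OF in1(2)[of 0]] \<phi>(2) by simp
  ultimately show ?thesis by (simp add: integral_unique)
qed

lemma reparam_derivative:
  assumes "smooth_on UNIV \<gamma>" "smooth_on UNIV \<phi>"
  shows "((\<gamma> \<circ> \<phi>) has_vector_derivative vderiv \<phi> x *\<^sub>R vderiv \<gamma> (\<phi> x)) (at x)"
  using vector_diff_chain_at[OF smooth_vderiv(1)[OF assms(2)] smooth_vderiv(1)[OF assms(1)]] .

lemma hyp_length_reparam:
  fixes \<phi> :: "real \<Rightarrow> real"
  assumes ci: "closed_immersion \<gamma>" and sm: "smooth_on UNIV \<phi>"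
    and \<phi>: "\<And>x. 0 < vderiv \<phi> x" "\<And>x. \<phi> (x + 1) = \<phi> x + 1"
  shows "hyp_length (\<gamma> \<circ> \<phi>) = hyp_length \<gamma>"
proof -
  have smg: "smooth_on UNIV \<gamma>" and per: "\<And>x. \<gamma> (x + 1) = \<gamma> x" and Y: "\<And>x. 0 < Im (\<gamma> x)"
    using ci by (auto simp: closed_immersion_def)
  have sp: "hyp_speed (\<gamma> \<circ> \<phi>) x = hyp_speed \<gamma> (\<phi> x) * vderiv \<phi> x" for x
  proof -
    have "vderiv (\<gamma> \<circ> \<phi>) x = vderiv \<phi> x *\<^sub>R vderiv \<gamma> (\<phi> x)"
      using reparam_derivative[OF smg sm, of x] unfolding vderiv_def by (rule vector_derivative_at)
    then show ?thesis
      using Y[of "\<phi> x"] \<phi>(1)[of x]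
      by (simp add: closed_immersion_speed(1)[OF ci] hyp_speed_def[of "\<gamma> \<circ> \<phi>"] hyp_metric_def real_sqrt_divide
        flip: norm_eq_sqrt_inner) (simp add: real_sqrt_mult norm_eq_sqrt_inner)
  qed
  have "hyp_speed \<gamma> (x + 1) = hyp_speed \<gamma> x" for x
  proof -
    have "((\<lambda>x. \<gamma> (x + 1)) has_vector_derivative vderiv \<gamma> (x + 1)) (at x)"
      using vector_diff_chain_at[of "\<lambda>x. x + 1" 1 x \<gamma> "vderiv \<gamma> (x + 1)"] smooth_vderiv(1)[OF smg]
      by (simp add: o_def has_vector_derivative_add_const)
    then have "vderiv \<gamma> (x + 1) = vderiv \<gamma> x"
      using vector_derivative_unique_at[OF _ smooth_vderiv(1)[OF smg]] unfolding per by blast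
    then show ?thesis by (simp add: closed_immersion_speed(1)[OF ci] per)
  qed
  then have "integral {0..1} (\<lambda>x. hyp_speed \<gamma> (\<phi> x) * vderiv \<phi> x) = integral {0..1} (hyp_speed \<gamma>)"
    using closed_immersion_speed(2)[OF ci] smooth_vderiv(1)[OF sm] \<phi>(2)[of 0]
    by (intro periodic_integral_substitution) (auto simp: has_real_derivative_iff_has_vector_derivative)
  then show ?thesis unfolding hyp_length_def sp[abs_def] .
qed

section \<open>Length of curves close in Sobolev norm to a fixed curve\<close>

lemma L1_le_L2:
  fixes f :: "real \<Rightarrow> 'a::real_normed_vector"
  assumes "continuous_on {0..1} f"
  shows "integral {0..1} (\<lambda>x. norm (f x)) \<le> sqrt (integral {0..1} (\<lambda>x. (norm (f x))\<^sup>2))"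
  using weighted_Cauchy_Schwarz[of "\<lambda>x. norm (f x)" "\<lambda>_. 1" "\<lambda>_. 1"] assms
  by (simp add: continuous_on_norm)

text \<open>The one-dimensional Sobolev embedding: a value differs from any other by at most the
  integral of the norm of the derivative, and averaging over the other point leaves the two L^2
  norms.\<close>

lemma sobolev_norm_bounds:
  assumes h: "\<And>x. (h has_vector_derivative vderiv h x) (at x)" and c: "continuous_on {0..1} (vderiv h)"
  shows "integral {0..1} (\<lambda>x. norm (vderiv h x)) \<le> sobolev_norm 1 h"
    and "x \<in> {0..1} \<Longrightarrow> \<bar>Im (h x)\<bar> \<le> 2 * sobolev_norm 1 h"
proof -
  define A B where "A = integral {0..1} (\<lambda>x. (norm (h x))\<^sup>2)" and "B = integral {0..1} (\<lambda>x. (norm (vderiv h x))\<^sup>2)"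
  have hc: "continuous_on {0..1} h"
    by (intro continuous_at_imp_continuous_on ballI has_vector_derivative_continuous[OF h])
  have AB: "0 \<le> A" "0 \<le> B" unfolding A_def B_def
    by (auto intro!: integral_nonneg integrable_continuous_real continuous_on_power continuous_on_norm hc c)
  have S: "sobolev_norm 1 h = sqrt (A + B)"
    by (simp add: sobolev_norm_def A_def B_def)
  have I1: "integral {0..1} (\<lambda>x. norm (vderiv h x)) \<le> sqrt B" unfolding B_def by (rule L1_le_L2[OF c])
  have I0: "integral {0..1} (\<lambda>x. norm (h x)) \<le> sqrt A" unfolding A_def by (rule L1_le_L2[OF hc])
  have le: "sqrt B \<le> sqrt (A + B)" "sqrt A \<le> sqrt (A + B)" using AB by simp_all
  show "integral {0..1} (\<lambda>x. norm (vderiv h x)) \<le> sobolev_norm 1 h"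
    unfolding S using I1 le(1) by (rule order_trans)
  show "\<bar>Im (h x)\<bar> \<le> 2 * sobolev_norm 1 h" if x: "x \<in> {0..1}"
  proof -
    have osc: "\<bar>Im (h x) - Im (h u)\<bar> \<le> integral {0..1} (\<lambda>x. norm (vderiv h x))" if "u \<in> {0..1}" for u
    proof (rule oscillation_le_integral[where F = "\<lambda>x. Im (h x)" and f = "\<lambda>x. Im (vderiv h x)"])
      show "((\<lambda>x. Im (h x)) has_real_derivative Im (vderiv h x)) (at x)" for x
        using h[of x] by (simp add: has_vector_derivative_complex_iff)
      show "\<bar>Im (vderiv h x)\<bar> \<le> norm (vderiv h x)" for x by (rule abs_Im_le_cmod)
    qed (use x that c in \<open>auto intro: continuous_on_norm\<close>)
    have "integral {0..1} (\<lambda>u::real. \<bar>Im (h x)\<bar>) \<le> integral {0..1} (\<lambda>u. norm (h u) + sqrt B)"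
    proof (rule integral_le)
      show "\<bar>Im (h x)\<bar> \<le> norm (h u) + sqrt B" if "u \<in> {0..1}" for u
        using osc[OF that] I1 abs_Im_le_cmod[of "h u"] by linarith
    qed (auto intro!: integrable_continuous_real continuous_intros hc)
    also have "\<dots> = integral {0..1} (\<lambda>u. norm (h u)) + sqrt B"
      by (subst integral_add) (auto intro!: integrable_continuous_real continuous_intros hc)
    finally have "\<bar>Im (h x)\<bar> \<le> integral {0..1} (\<lambda>u. norm (h u)) + sqrt B" by simp
    then show ?thesis unfolding S using I0 le by linarith
  qed
qed

text \<open>Dilation, translation and reparametrization preserve the hyperbolic length. At late
  times the normalized curve has height at least half the minimal height \<mu> of the limit and
  Euclidean length at most C + \<mu> / 4; before that, continuity in time on a compact interval
  suffices.\<close>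

lemma convergent_length_bounded:
  assumes ci: "\<And>t. 0 \<le> t \<Longrightarrow> closed_immersion (\<gamma> t)"
    and cont: "continuous_on {0..} (\<lambda>t. hyp_length (\<gamma> t))"
    and conv: "convergent_evolution \<gamma>"
  shows "bounded ((\<lambda>t. hyp_length (\<gamma> t)) ` {0..})"
proof -
  obtain \<beta> p a \<sigma> where \<beta>: "\<And>t. 0 \<le> t \<Longrightarrow> const_speed_reparam (\<gamma> t) (\<beta> t)"
    and a: "\<And>t. 0 \<le> t \<Longrightarrow> 0 < a t" and \<sigma>: "closed_immersion \<sigma>"
    and lim: "\<And>m. ((\<lambda>t. sobolev_norm m (\<lambda>x. a t *\<^sub>R (\<beta> t x - of_real (p t)) - \<sigma> x)) \<longlongrightarrow> 0) at_top"
    using conv unfolding convergent_evolution_def by blast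
  have s\<sigma>: "smooth_on UNIV \<sigma>" and Y\<sigma>: "\<And>x. 0 < Im (\<sigma> x)" using \<sigma> by (auto simp: closed_immersion_def)
  have c\<sigma>: "continuous_on {0..1} \<sigma>"
    using smooth_imp_continuous[OF s\<sigma>] by (rule continuous_on_subset) simp
  have "\<exists>x0\<in>{0..1}. \<forall>x\<in>{0..1}. Im (\<sigma> x0) \<le> Im (\<sigma> x)"
    by (intro continuous_attains_inf continuous_on_Im c\<sigma>) auto
  then obtain x0 where x0: "\<And>x. x \<in> {0..1} \<Longrightarrow> Im (\<sigma> x0) \<le> Im (\<sigma> x)" by blast
  define \<mu> where "\<mu> = Im (\<sigma> x0)"
  have \<mu>: "0 < \<mu>" using Y\<sigma> by (simp add: \<mu>_def)
  define C where "C = integral {0..1} (\<lambda>x. norm (vderiv \<sigma> x))"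
  define B where "B = (C + \<mu> / 4) / (\<mu> / 2)"
  \<comment> \<open>The threshold \<mu> / 4 makes the deviation in height at most \<mu> / 2, the
    embedding constant being 2.\<close>
  have ev: "eventually (\<lambda>t. sobolev_norm 1 (\<lambda>x. a t *\<^sub>R (\<beta> t x - of_real (p t)) - \<sigma> x) < \<mu> / 4) at_top"
    by (rule order_tendstoD(2)[OF lim]) (use \<mu> in simp)
  have late: "hyp_length (\<gamma> t) \<le> B"
    if t: "0 \<le> t" and small: "sobolev_norm 1 (\<lambda>x. a t *\<^sub>R (\<beta> t x - of_real (p t)) - \<sigma> x) < \<mu> / 4" for t
  proof -
    obtain \<phi> where \<phi>: "smooth_on UNIV \<phi>" "\<And>x. 0 < vderiv \<phi> x" "\<And>x. \<phi> (x + 1) = \<phi> x + 1"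
      and \<beta>\<phi>: "\<beta> t = \<gamma> t \<circ> \<phi>"
      using \<beta>[OF t] unfolding const_speed_reparam_def by blast
    have s\<gamma>: "smooth_on UNIV (\<gamma> t)" and Y\<gamma>: "\<And>x. 0 < Im (\<gamma> t x)" using ci[OF t] by (auto simp: closed_immersion_def)
    define d where "d x = vderiv \<phi> x *\<^sub>R vderiv (\<gamma> t) (\<phi> x)" for x
    have d: "(\<beta> t has_vector_derivative d x) (at x)" for x
      unfolding \<beta>\<phi> d_def by (rule reparam_derivative[OF s\<gamma> \<phi>(1)])
    have cd: "continuous_on {0..1} d"
      unfolding d_def
    proof (rule continuous_on_scaleR[OF smooth_vderiv(2)[OF \<phi>(1)]])
      have "continuous_on {0..1} \<phi>"
        using smooth_imp_continuous[OF \<phi>(1)] by (rule continuous_on_subset) simp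
      then show "continuous_on {0..1} (\<lambda>x. vderiv (\<gamma> t) (\<phi> x))"
        by (rule continuous_on_compose2[OF smooth_vderiv(2)[OF s\<gamma>, of UNIV]]) simp
    qed
    define h where "h x = a t *\<^sub>R (\<beta> t x - of_real (p t)) - \<sigma> x" for x
    have h0: "(h has_vector_derivative a t *\<^sub>R (d x - 0) - vderiv \<sigma> x) (at x)" for x
      unfolding h_def[abs_def]
      by (intro has_vector_derivative_diff bounded_linear.has_vector_derivative[OF bounded_linear_scaleR_right]
          d smooth_vderiv s\<sigma> has_vector_derivative_const)
    have vh: "vderiv h x = a t *\<^sub>R d x - vderiv \<sigma> x" for x
      using vector_derivative_at[OF h0[of x]] by (simp add: vderiv_def[of h])
    have h: "(h has_vector_derivative vderiv h x) (at x)" for x using h0[of x] by (simp add: vh)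
    have ch: "continuous_on {0..1} (vderiv h)"
      unfolding vh[abs_def] by (intro continuous_intros cd smooth_vderiv s\<sigma>)
    have small': "sobolev_norm 1 h < \<mu> / 4" using small by (simp add: h_def[abs_def])
    have "hyp_length (\<gamma> t) = hyp_length (\<beta> t)"
      unfolding \<beta>\<phi> using hyp_length_reparam[OF ci[OF t] \<phi>] by simp
    also have "\<dots> = integral {0..1} (\<lambda>x. norm (d x) / Im (\<beta> t x))"
    proof -
      have "hyp_speed (\<beta> t) x = norm (d x) / Im (\<beta> t x)" for x
      proof -
        have "vderiv (\<beta> t) x = d x" unfolding vderiv_def by (rule vector_derivative_at[OF d])
        then show ?thesis using Y\<gamma>[of "\<phi> x"]
          by (simp add: hyp_speed_def hyp_metric_def real_sqrt_divide \<beta>\<phi> flip: norm_eq_sqrt_inner)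
      qed
      then show ?thesis by (simp add: hyp_length_def cong: integral_cong)
    qed
    also have "\<dots> \<le> integral {0..1} (\<lambda>x. (norm (vderiv h x) + norm (vderiv \<sigma> x)) * (1 / (\<mu> / 2)))"
    proof (rule integral_le)
      have cb: "continuous_on {0..1} (\<beta> t)"
        by (intro continuous_at_imp_continuous_on ballI has_vector_derivative_continuous[OF d])
      have Y\<beta>: "0 < Im (\<beta> t x)" for x using Y\<gamma> by (simp add: \<beta>\<phi>)
      show "(\<lambda>x. norm (d x) / Im (\<beta> t x)) integrable_on {0..1}"
        by (intro integrable_continuous_real continuous_on_divide continuous_on_norm continuous_on_Im cd cb)
          (use Y\<beta> in \<open>auto simp: less_imp_neq[symmetric]\<close>)
      show "(\<lambda>x. (norm (vderiv h x) + norm (vderiv \<sigma> x)) * (1 / (\<mu> / 2))) integrable_on {0..1}"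
        by (intro integrable_continuous_real continuous_on_mult continuous_on_add continuous_on_norm continuous_on_const ch smooth_vderiv s\<sigma>)
      fix x :: real assume x: "x \<in> {0..1}"
      have "\<mu> / 2 \<le> Im (\<sigma> x) + Im (h x)"
        using x0[OF x] sobolev_norm_bounds(2)[OF h ch x] small' by (simp add: \<mu>_def)
      also have "\<dots> = a t * Im (\<beta> t x)" by (simp add: h_def)
      finally have Y: "\<mu> / 2 \<le> a t * Im (\<beta> t x)" .
      \<comment> \<open>Scale invariance of the speed: the dilation factor, about which nothing but
        positivity is known, cancels here.\<close>
      have "norm (d x) / Im (\<beta> t x) = norm (a t *\<^sub>R d x) / (a t * Im (\<beta> t x))"
        using a[OF t] by simp
      also have "\<dots> \<le> norm (a t *\<^sub>R d x) / (\<mu> / 2)"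
        using Y \<mu> a[OF t] Y\<beta>[of x] by (intro divide_left_mono mult_pos_pos) auto
      also have "a t *\<^sub>R d x = vderiv h x + vderiv \<sigma> x" by (simp add: vh)
      also have "norm (vderiv h x + vderiv \<sigma> x) / (\<mu> / 2) \<le> (norm (vderiv h x) + norm (vderiv \<sigma> x)) / (\<mu> / 2)"
        using \<mu> by (intro divide_right_mono norm_triangle_ineq) auto
      finally show "norm (d x) / Im (\<beta> t x) \<le> (norm (vderiv h x) + norm (vderiv \<sigma> x)) * (1 / (\<mu> / 2))"
        by simp
    qed
    also have "\<dots> = (integral {0..1} (\<lambda>x. norm (vderiv h x)) + C) * (1 / (\<mu> / 2))"
      unfolding C_def integral_mult_left
      by (subst integral_add)
        (intro refl integrable_continuous_real continuous_on_norm ch smooth_vderiv(2)[OF s\<sigma>])+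
    also have "\<dots> \<le> (\<mu> / 4 + C) * (1 / (\<mu> / 2))"
      using sobolev_norm_bounds(1)[OF h ch] small' \<mu> by (intro mult_right_mono add_right_mono) auto
    finally show ?thesis by (simp add: B_def add.commute)
  qed
  obtain t1 where t1: "\<And>t. t1 \<le> t \<Longrightarrow> sobolev_norm 1 (\<lambda>x. a t *\<^sub>R (\<beta> t x - of_real (p t)) - \<sigma> x) < \<mu> / 4"
    using ev unfolding eventually_at_top_linorder by blast
  have "bounded ((\<lambda>t. hyp_length (\<gamma> t)) ` {0..\<bar>t1\<bar>})"
    by (intro compact_imp_bounded compact_continuous_image continuous_on_subset[OF cont]) auto
  then obtain M where "\<forall>y\<in>(\<lambda>t. hyp_length (\<gamma> t)) ` {0..\<bar>t1\<bar>}. norm y \<le> M"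
    unfolding bounded_iff by blast
  then have M: "\<bar>hyp_length (\<gamma> t)\<bar> \<le> M" if "t \<in> {0..\<bar>t1\<bar>}" for t using that by simp
  have "\<bar>hyp_length (\<gamma> t)\<bar> \<le> max M B" if t: "0 \<le> t" for t
  proof (cases "t \<le> \<bar>t1\<bar>")
    case True
    then show ?thesis using M[of t] t by simp
  next
    case False
    have "0 \<le> hyp_length (\<gamma> t)" unfolding hyp_length_def
      by (intro integral_nonneg integrable_continuous_real closed_immersion_speed(2)[OF ci[OF t]])
        (simp add: hyp_speed_def hyp_metric_def)
    moreover have "t1 \<le> t" using False by linarith
    ultimately show ?thesis using late[OF t t1] by simp
  qed
  then show ?thesis by (auto simp: bounded_iff intro!: exI[of _ "max M B"])
qed

theorem corollary5p9:
  fixes \<gamma>\<^sub>0 :: "real \<Rightarrow> complex" and \<gamma> :: "real \<Rightarrow> real \<Rightarrow> complex"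
  assumes "closed_immersion \<gamma>\<^sub>0"
    and "total_curvature \<gamma>\<^sub>0 = 0"
    and "elastic_flow \<gamma>\<^sub>0 \<gamma>"
  shows "\<not> bounded ((\<lambda>t. hyp_length (\<gamma> t)) ` {0..}) \<and> \<not> convergent_evolution \<gamma>"
proof -
  have "\<not> bounded ((\<lambda>t. hyp_length (\<gamma> t)) ` {0..})"
    by (rule unbounded_length[OF assms(3,2)])
  moreover have "\<And>t. 0 \<le> t \<Longrightarrow> closed_immersion (\<gamma> t)"
    using assms(3) by (simp add: elastic_flow_def)
  ultimately show ?thesis
    using convergent_length_bounded[of \<gamma>, OF _ length_continuous[OF assms(3)]] by (intro conjI notI) simp_all
qed

end
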